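(* Let $\Lambda=[-1,1]^2$ and let $\Pi^y$ be the anisotropic macro-element interpolation operator on the reference macro-element over $\Lambda$. There is a constant $C$ such that for every $u\in H^3(\Lambda)$ and every multi-index $\boldsymbol{\gamma}$ with $|\boldsymbol{\gamma}|\le2$: $$\|\boldsymbol{D}^{\boldsymbol{\gamma}}(u-\Pi^yu)\|_0\le C\,|\boldsymbol{D}^{\boldsymbol{\gamma}}u|_{3-|\boldsymbol{\gamma}|}\qquad\text{for }\boldsymbol{\gamma}\ne(2,0),$$ $$\|(u-\Pi^yu)_{xx}\|_0\le C\big(|u_{xx}|_1+|u_x|_2\big).$$
   Context: $\boldsymbol{D}^{\boldsymbol{\gamma}}=\partial_x^{\gamma_1}\partial_y^{\gamma_2}$; $\|\cdot\|_0$ is the $L_2(\Lambda)$ norm and $|\cdot|_k$ the $H^k(\Lambda)$ semi-norm. For $j\in\{-1,1\}$ let $\hat\varphi_j,\hat\psi_j\in C^1[-1,1]$ be the functions that are quadratic polynomials on each of $[-1,0]$ and $[0,1]$ and are uniquely determined by $\hat\varphi_j(k)=\delta_{jk}$, $\hat\varphi_j'(k)=0$, $\hat\psi_j(k)=0$, $\hat\psi_j'(k)=\delta_{jk}$ for $k\in\{-1,1\}$. For $i\in\{-1,0,1\}$ let $\hat\ell_i\in P_2[-1,1]$ be the quadratic Lagrange basis functions for the nodes $-1,0,1$. The operator (tensor product of $P_2$ Lagrange interpolation in $x$ and $C^1$-$P_2$ macro-interpolation in $y$) is defined for $u\in C^1(\Lambda)$ by $$\Pi^yu(x,y)=\sum_{i\in\{-1,0,1\}}\sum_{j\in\{-1,1\}}\left(u(i,j)\hat\ell_i(x)\hat\varphi_j(y)+\frac{\partial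 u}{\partial y}(i,j)\hat\ell_i(x)\hat\psi_j(y)\right).$$ *)

theory Defs
  imports "HOL-Analysis.Analysis" "HOL-Computational_Algebra.Polynomial"
begin

definition Lam :: "(real \<times> real) set" where
  "Lam = {-1..1} \<times> {-1..1}"


definition dx :: "(real \<times> real \<Rightarrow> real) \<Rightarrow> real \<times> real \<Rightarrow> real" where
  "dx f = (\<lambda>(x, y). deriv (\<lambda>s. f (s, y)) x)"

definition dy :: "(real \<times> real \<Rightarrow> real) \<Rightarrow> real \<times> real \<Rightarrow> real" where
  "dy f = (\<lambda>(x, y). deriv (\<lambda>t. f (x, t)) y)"

definition classical_deriv ::
    "nat \<times> nat \<Rightarrow> (real \<times> real \<Rightarrow> real) \<Rightarrow> real \<times> real \<Rightarrow> real" where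
  "classical_deriv \<gamma> f = (dx ^^ fst \<gamma>) ((dy ^^ snd \<gamma>) f)"

fun C_k :: "nat \<Rightarrow> (real \<times> real \<Rightarrow> real) \<Rightarrow> bool" where
  "C_k 0 f \<longleftrightarrow> continuous_on UNIV f"
| "C_k (Suc k) f \<longleftrightarrow> f differentiable_on UNIV \<and> C_k k (dx f) \<and> C_k k (dy f)"

definition test_function :: "(real \<times> real \<Rightarrow> real) \<Rightarrow> bool" where
  "test_function \<phi> \<longleftrightarrow> (\<forall>k. C_k k \<phi>) \<and> closure {p. \<phi> p \<noteq> 0} \<subseteq> interior Lam"

definition locally_integrable :: "(real \<times> real \<Rightarrow> real) \<Rightarrow> bool" where
  "locally_integrable f \<longleftrightarrow>
     (\<forall>K. compact K \<and> K \<subseteq> interior Lam \<longrightarrow> integrable (lebesgue_on K) f)"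

definition mi_order :: "nat \<times> nat \<Rightarrow> nat" where
  "mi_order \<gamma> = fst \<gamma> + snd \<gamma>"

definition has_weak_deriv ::
    "nat \<times> nat \<Rightarrow> (real \<times> real \<Rightarrow> real) \<Rightarrow> (real \<times> real \<Rightarrow> real) \<Rightarrow> bool" where
  "has_weak_deriv \<gamma> u v \<longleftrightarrow> locally_integrable u \<and> locally_integrable v \<and>
     (\<forall>\<phi>. test_function \<phi> \<longrightarrow>
        (LINT p|lebesgue_on Lam. u p * classical_deriv \<gamma> \<phi> p) =
        (-1) ^ mi_order \<gamma> * (LINT p|lebesgue_on Lam. v p * \<phi> p))"

text \<open>Functions are representatives of almost-everywhere classes on the square; the weak derivative
  is determined only up to a null set (and is arbitrary outside the square).\<close>

definition weak_deriv ::
    "nat \<times> nat \<Rightarrow> (real \<times> real \<Rightarrow> real) \<Rightarrow> real \<times> real \<Rightarrow> real" where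
  "weak_deriv \<gamma> u = (SOME v. has_weak_deriv \<gamma> u v)"


definition L2_Lam :: "(real \<times> real \<Rightarrow> real) set" where
  "L2_Lam = {f \<in> borel_measurable (lebesgue_on Lam). integrable (lebesgue_on Lam) (\<lambda>p. (f p)\<^sup>2)}"

text \<open>Meaningful on \<open>L2_Lam\<close> only: the integral is zero when the square is not integrable.\<close>

definition L2_norm :: "(real \<times> real \<Rightarrow> real) \<Rightarrow> real" where
  "L2_norm f = sqrt (LINT p|lebesgue_on Lam. (f p)\<^sup>2)"

definition H_Lam :: "nat \<Rightarrow> (real \<times> real \<Rightarrow> real) set" where
  "H_Lam k = {u \<in> L2_Lam. \<forall>\<gamma>. mi_order \<gamma> \<le> k \<longrightarrow> (\<exists>v\<in>L2_Lam. has_weak_deriv \<gamma> u v)}"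

definition H_seminorm :: "nat \<Rightarrow> (real \<times> real \<Rightarrow> real) \<Rightarrow> real" where
  "H_seminorm k u = sqrt (\<Sum>\<alpha> | mi_order \<alpha> = k. (L2_norm (weak_deriv \<alpha> u))\<^sup>2)"


definition C1_Lam :: "(real \<times> real \<Rightarrow> real) set" where
  "C1_Lam = {u. \<exists>g h. continuous_on Lam g \<and> continuous_on Lam h \<and>
     (\<forall>p\<in>Lam. (u has_derivative (\<lambda>(s, t). g p * s + h p * t)) (at p within Lam))}"

text \<open>The continuously differentiable representative of a class in \<open>H\<^sup>3\<close>. It exists by the
  Sobolev embedding theorem and is unique on the square; point values of a Sobolev function and
  of its first-order derivatives are those of this representative.\<close>

definition C1_rep :: "(real \<times> real \<Rightarrow> real) \<Rightarrow> real \<times> real \<Rightarrow> real" where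
  "C1_rep u = (SOME v. v \<in> C1_Lam \<and> (AE p in lebesgue_on Lam. v p = u p))"

text \<open>One-sided at the upper and lower edges of the square.\<close>

definition partial_y :: "(real \<times> real \<Rightarrow> real) \<Rightarrow> real \<times> real \<Rightarrow> real" where
  "partial_y u = (\<lambda>(x, y). vector_derivative (\<lambda>t. u (x, t)) (at y within {-1..1}))"

definition lagrange :: "real \<Rightarrow> real \<Rightarrow> real" where
  "lagrange i x = (\<Prod>k\<in>{-1, 0, 1} - {i}. (x - k) / (i - k))"

definition C1_P2_macro :: "(real \<Rightarrow> real) set" where
  "C1_P2_macro = {f.
     (\<exists>f'. continuous_on {-1..1} f' \<and>
        (\<forall>y\<in>{-1..1}. (f has_real_derivative f' y) (at y within {-1..1}))) \<and>
     (\<exists>p. degree p \<le> 2 \<and> (\<forall>y\<in>{-1..0}. f y = poly p y)) \<and>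
     (\<exists>q. degree q \<le> 2 \<and> (\<forall>y\<in>{0..1}. f y = poly q y))}"

definition is_macro_phi :: "real \<Rightarrow> (real \<Rightarrow> real) \<Rightarrow> bool" where
  "is_macro_phi j f \<longleftrightarrow> f \<in> C1_P2_macro \<and>
     (\<forall>k\<in>{-1, 1}. f k = of_bool (j = k) \<and> (f has_real_derivative 0) (at k within {-1..1}))"

definition is_macro_psi :: "real \<Rightarrow> (real \<Rightarrow> real) \<Rightarrow> bool" where
  "is_macro_psi j f \<longleftrightarrow> f \<in> C1_P2_macro \<and>
     (\<forall>k\<in>{-1, 1}. f k = 0 \<and> (f has_real_derivative of_bool (j = k)) (at k within {-1..1}))"

text \<open>The conditions determine these functions on \<open>[-1, 1]\<close>; only values there matter.\<close>

definition macro_phi :: "real \<Rightarrow> real \<Rightarrow> real" where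
  "macro_phi j = (SOME f. is_macro_phi j f)"

definition macro_psi :: "real \<Rightarrow> real \<Rightarrow> real" where
  "macro_psi j = (SOME f. is_macro_psi j f)"

definition Pi_y :: "(real \<times> real \<Rightarrow> real) \<Rightarrow> real \<times> real \<Rightarrow> real" where
  "Pi_y u = (\<lambda>(x, y). \<Sum>i\<in>{-1, 0, 1}. \<Sum>j\<in>{-1, 1}.
     u (i, j) * lagrange i x * macro_phi j y + partial_y u (i, j) * lagrange i x * macro_psi j y)"

end

theory Submission
  imports Defs
begin

text \<open>Testing a weak derivative against products of one-dimensional test functions yields, for a
  function \<open>w\<close> with \<open>w\<close>, \<open>w\<^sub>x\<close>, \<open>w\<^sub>y\<close>, \<open>w\<^sub>x\<^sub>y\<close> square integrable, a representation of \<open>w\<close> as a sum of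
  integral operators with bounded kernels applied to these four functions. The right-hand side is
  continuous, which gives the embedding of \<open>H\<^sup>3\<close> into \<open>C\<^sup>1\<close> without any density argument, and differences
  of point values in \<open>x\<close> (or \<open>y\<close>) only involve the terms with an \<open>x\<close>- (or \<open>y\<close>-) derivative. A similar
  representation gives the Poincare inequality. Since the interpolation reproduces quadratic
  polynomials, one may subtract from \<open>u\<close> the quadratic for which all derivatives up to order two have
  vanishing weighted mean; the derivative \<open>D\<^sup>\<gamma>\<close> of the interpolant depends only on such differences of
  nodal values and slopes that are controlled by derivatives of \<open>D\<^sup>\<gamma> u\<close>. For \<open>\<gamma> = (2, 0)\<close> the required
  trace of \<open>u\<^sub>x\<^sub>x\<^sub>y\<close> is not available, but first differences in \<open>x\<close> are, and these are bounded
  through \<open>u\<^sub>x\<close>.\<close>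

section \<open>Smooth functions and test functions\<close>

text \<open>The decisive choice is an averaging weight \<open>\<rho>\<close> that is itself a test
  function of integral one. A test function \<open>\<theta>\<close> of integral \<open>A\<close> can
  then be written as \<open>A * \<rho> - deriv a\<close> with \<open>a\<close> again a test
  function, so pairing with \<open>\<theta>\<close> splits into a mean and a weak derivative. Every
  representation formula is this splitting, in one or both variables, read backwards through Fubini;
  for this reason products of one-dimensional test functions suffice throughout. A continuous
  representative of a derivative costs one further derivative in each variable. In H^3 this is
  affordable for orders zero and one, which covers the nodal values and the y-slopes. The anisotropy
  is index bookkeeping. A Poincare step only raises a multi-index, so all derivatives with index
  above \<gamma> are controlled by third-order derivatives above \<gamma>, which are derivatives of
  D^\<gamma> u. Normalising the means of all orders up to two at once makes each such step
  available.\<close>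

fun Ck1 :: "nat \<Rightarrow> (real \<Rightarrow> real) \<Rightarrow> bool" where
  "Ck1 0 f \<longleftrightarrow> continuous_on UNIV f"
| "Ck1 (Suc k) f \<longleftrightarrow> (\<exists>f'. (\<forall>x. (f has_real_derivative f' x) (at x)) \<and> Ck1 k f')"

lemma Ck1_SucD: "Ck1 (Suc k) f \<Longrightarrow> Ck1 k f"
proof (induction k arbitrary: f)
  case 0
  then show ?case
    by (auto simp: continuous_on_eq_continuous_at intro: DERIV_isCont)
next
  case (Suc k)
  then show ?case by (metis Ck1.simps(2))
qed

lemma Ck1_add: "Ck1 k f \<Longrightarrow> Ck1 k g \<Longrightarrow> Ck1 k (\<lambda>x. f x + g x)"
proof (induction k arbitrary: f g)
  case 0
  then show ?case by (simp add: continuous_on_add)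
next
  case (Suc k)
  then obtain f' g' where "\<forall>x. (f has_real_derivative f' x) (at x)" "Ck1 k f'"
    "\<forall>x. (g has_real_derivative g' x) (at x)" "Ck1 k g'"
    by auto
  then show ?case using Suc.IH
    by (auto intro!: exI[of _ "\<lambda>x. f' x + g' x"] derivative_intros)
qed

lemma Ck1_mult: "Ck1 k f \<Longrightarrow> Ck1 k g \<Longrightarrow> Ck1 k (\<lambda>x. f x * g x)"
proof (induction k arbitrary: f g)
  case 0
  then show ?case by (simp add: continuous_on_mult)
next
  case (Suc k)
  then obtain f' g' where d: "\<forall>x. (f has_real_derivative f' x) (at x)" "Ck1 k f'"
    "\<forall>x. (g has_real_derivative g' x) (at x)" "Ck1 k g'"
    by auto
  moreover have "Ck1 k f" "Ck1 k g" using Suc.prems Ck1_SucD by blast+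
  ultimately have "Ck1 k (\<lambda>x. f' x * g x + g' x * f x)"
    using Suc.IH by (intro Ck1_add) auto
  then show ?case using d by (auto intro!: exI[of _ "\<lambda>x. f' x * g x + g' x * f x"] DERIV_mult)
qed

lemma Ck1_const: "Ck1 k (\<lambda>x. c)"
proof (induction k arbitrary: c)
  case (Suc k)
  then show ?case by (auto intro!: exI[of _ "\<lambda>x. 0"])
qed simp

lemma Ck1_affine: "Ck1 k f \<Longrightarrow> Ck1 k (\<lambda>x. f (c * x + d))"
proof (induction k arbitrary: f)
  case 0
  then show ?case by (auto intro!: continuous_intros continuous_on_compose2[of UNIV f])
next
  case (Suc k)
  then obtain f' where d: "\<And>x. (f has_real_derivative f' x) (at x)" "Ck1 k f'"
    by auto
  have "((\<lambda>x. f (c * x + d)) has_real_derivative f' (c * x + d) * c) (at x)" for x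
    by (rule DERIV_chain2[of f]) (auto intro!: d derivative_eq_intros)
  moreover have "Ck1 k (\<lambda>x. f' (c * x + d) * c)"
    using Suc.IH[OF d(2)] by (intro Ck1_mult Ck1_const)
  ultimately have "(\<forall>x. ((\<lambda>x. f (c * x + d)) has_real_derivative f' (c * x + d) * c) (at x)) \<and>
      Ck1 k (\<lambda>x. f' (c * x + d) * c)" by blast
  then show ?case unfolding Ck1.simps by (rule exI[of _ "\<lambda>x. f' (c * x + d) * c"])
qed

text \<open>Arbitrary polynomials in \<open>1 / t\<close> make the family closed under
  differentiation, with p replaced by X^2 (p - p'); smoothness is then a single induction. The case
  p = 1 is the classical exp(-1/t).\<close>

definition flat :: "real poly \<Rightarrow> real \<Rightarrow> real" where
  "flat p t = (if t > 0 then poly p (1 / t) * exp (- (1 / t)) else 0)"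

lemma poly_exp_tendsto_0: "((\<lambda>s::real. poly p s * exp (- s)) \<longlongrightarrow> 0) at_top"
proof -
  have "((\<lambda>s. \<Sum>i\<le>degree p. coeff p i * (s ^ i / exp s)) \<longlongrightarrow> (\<Sum>i\<le>degree p. coeff p i * 0)) at_top"
    by (intro tendsto_intros tendsto_power_div_exp_0)
  then show ?thesis
    by (simp add: poly_altdef sum_distrib_right exp_minus divide_inverse mult.assoc)
qed

lemma flat_tendsto_0: "(flat p \<longlongrightarrow> 0) (at 0)"
proof (rule filterlim_split_at_real)
  have "\<forall>\<^sub>F t in at_left (0::real). 0 = flat p t"
    by (auto simp: flat_def eventually_at_filter)
  then show "(flat p \<longlongrightarrow> 0) (at_left 0)"
    by (rule Lim_transform_eventually[rotated]) simp
  have "((\<lambda>t. poly p (inverse t) * exp (- inverse t)) \<longlongrightarrow> 0) (at_right (0::real))"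
    by (rule filterlim_compose[OF poly_exp_tendsto_0 filterlim_inverse_at_top_right])
  moreover have "\<forall>\<^sub>F t in at_right (0::real). poly p (inverse t) * exp (- inverse t) = flat p t"
    by (auto simp: flat_def eventually_at_filter divide_inverse)
  ultimately show "(flat p \<longlongrightarrow> 0) (at_right 0)"
    by (rule Lim_transform_eventually)
qed

lemma flat_deriv:
  "(flat p has_real_derivative flat ([:0, 0, 1:] * (p - pderiv p)) t) (at t)"
proof -
  consider "t > 0" | "t < 0" | "t = 0" by linarith
  then show ?thesis
  proof cases
    case 1
    have "((\<lambda>t. poly p (1 / t) * exp (- (1 / t))) has_real_derivative
        flat ([:0, 0, 1:] * (p - pderiv p)) t) (at t)"
      using 1 by (auto intro!: derivative_eq_intros simp: flat_def field_simps power2_eq_square)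
    then show ?thesis
      by (rule has_field_derivative_transform_within_open[of _ _ _ "{0<..}"])
        (use 1 in \<open>auto simp: flat_def\<close>)
  next
    case 2
    have "((\<lambda>t. 0) has_real_derivative flat ([:0, 0, 1:] * (p - pderiv p)) t) (at t)"
      using 2 by (auto simp: flat_def)
    then show ?thesis
      by (rule has_field_derivative_transform_within_open[of _ _ _ "{..<0}"])
        (use 2 in \<open>auto simp: flat_def\<close>)
  next
    case 3
    have "((\<lambda>h. (flat p (0 + h) - flat p 0) / h) \<longlongrightarrow> 0) (at 0)"
    \<comment> \<open>The difference quotient at 0 is again a member of the family: dividing by
      \<open>h\<close> multiplies the polynomial by its variable.\<close>
    proof (rule Lim_transform_eventually[OF flat_tendsto_0[of "[:0, 1:] * p"]])
      show "\<forall>\<^sub>F h in at 0. flat ([:0, 1:] * p) h = (flat p (0 + h) - flat p 0) / h"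
        by (auto simp: flat_def eventually_at_filter)
    qed
    then show ?thesis using 3 by (simp add: DERIV_def flat_def)
  qed
qed

lemma flat_smooth: "Ck1 k (flat p)"
proof (induction k arbitrary: p)
  case 0
  then show ?case
    using flat_deriv by (auto simp: continuous_on_eq_continuous_at intro: DERIV_isCont)
next
  case (Suc k)
  then show ?case using flat_deriv by auto
qed

text \<open>The smooth functions with compact support in (-1, 1). The margin \<open>r < 1\<close>
  keeps the supports of tensor products inside the interior of the square.\<close>

definition test1 :: "(real \<Rightarrow> real) \<Rightarrow> bool" where
  "test1 a \<longleftrightarrow> (\<forall>k. Ck1 k a) \<and> (\<exists>r. 0 < r \<and> r < 1 \<and> (\<forall>x. r < \<bar>x\<bar> \<longrightarrow> a x = 0))"

lemma test1_Ck1: "test1 a \<Longrightarrow> Ck1 k a"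
  by (simp add: test1_def)

lemma test1_continuous: "test1 a \<Longrightarrow> continuous_on UNIV a"
  using test1_Ck1[of a 0] by simp

lemma test1_has_deriv: "test1 a \<Longrightarrow> (a has_real_derivative deriv a x) (at x)"
  using test1_Ck1[of a "Suc 0"] by (auto dest: DERIV_imp_deriv simp del: One_nat_def)
      (metis DERIV_imp_deriv)

lemma test1_bounds:
  assumes "test1 a" "test1 b"
  obtains r where "0 < r" "r < 1" "\<And>x. r < \<bar>x\<bar> \<Longrightarrow> a x = 0" "\<And>x. r < \<bar>x\<bar> \<Longrightarrow> b x = 0"
proof -
  obtain r s where r: "0 < r" "r < 1" "\<forall>x. r < \<bar>x\<bar> \<longrightarrow> a x = 0"
    and s: "0 < s" "s < 1" "\<forall>x. s < \<bar>x\<bar> \<longrightarrow> b x = 0"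
    using assms by (auto simp: test1_def)
  show thesis
    by (rule that[of "max r s"]) (use r s in \<open>auto simp: max_def split: if_splits\<close>)
qed

lemma Ck1_deriv: "Ck1 (Suc k) a \<Longrightarrow> Ck1 k (deriv a)"
proof -
  assume "Ck1 (Suc k) a"
  then obtain a' where a': "\<forall>x. (a has_real_derivative a' x) (at x)" "Ck1 k a'" by auto
  then have "deriv a = a'" by (auto simp: DERIV_imp_deriv)
  with a' show ?thesis by simp
qed

lemma deriv_zero_outside:
  assumes "\<And>x. r < \<bar>x\<bar> \<Longrightarrow> a x = 0" "r < \<bar>x::real\<bar>"
  shows "deriv a x = (0::real)"
proof (rule DERIV_imp_deriv)
  have "((\<lambda>x. 0) has_real_derivative 0) (at x)" by simp
  moreover have "open {x::real. r < \<bar>x\<bar>}"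
    by (intro open_Collect_less continuous_intros)
  ultimately show "(a has_real_derivative 0) (at x)"
    by (rule has_field_derivative_transform_within_open) (use assms in auto)
qed

lemma test1_deriv: "test1 a \<Longrightarrow> test1 (deriv a)"
  unfolding test1_def using Ck1_deriv deriv_zero_outside by metis

lemma test1_outside: "test1 a \<Longrightarrow> \<bar>x\<bar> \<ge> 1 \<Longrightarrow> a x = 0"
  by (auto simp: test1_def)

definition tensor :: "(real \<Rightarrow> real) \<Rightarrow> (real \<Rightarrow> real) \<Rightarrow> real \<times> real \<Rightarrow> real" where
  "tensor a b = (\<lambda>(x, y). a x * b y)"

lemma dx_tensor: "\<forall>x. (a has_real_derivative a' x) (at x) \<Longrightarrow> dx (tensor a b) = tensor a' b"
  by (auto simp: dx_def tensor_def fun_eq_iff intro!: DERIV_imp_deriv DERIV_cmult_right)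

lemma dy_tensor: "\<forall>x. (b has_real_derivative b' x) (at x) \<Longrightarrow> dy (tensor a b) = tensor a b'"
  by (auto simp: dy_def tensor_def fun_eq_iff intro!: DERIV_imp_deriv DERIV_cmult)

lemma C_k_tensor: "Ck1 k a \<Longrightarrow> Ck1 k b \<Longrightarrow> C_k k (tensor a b)"
proof (induction k arbitrary: a b)
  case 0
  then show ?case
    by (auto simp: tensor_def case_prod_beta intro!: continuous_intros continuous_on_compose2[of
        UNIV a] continuous_on_compose2[of UNIV b])
next
  case (Suc k)
  then obtain a' b' where d: "\<forall>x. (a has_real_derivative a' x) (at x)" "Ck1 k a'"
    "\<forall>x. (b has_real_derivative b' x) (at x)" "Ck1 k b'"
    by auto
  have "C_k k (dx (tensor a b))" "C_k k (dy (tensor a b))"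
    unfolding dx_tensor[OF d(1)] dy_tensor[OF d(3)] using Suc Ck1_SucD d by blast+
  moreover have "tensor a b differentiable_on UNIV"
    unfolding differentiable_on_def
  proof
    fix p :: "real \<times> real"
    have "a differentiable (at (fst p))" "b differentiable (at (snd p))"
      using d by (auto simp: real_differentiable_def)
    then show "tensor a b differentiable at p"
      unfolding tensor_def case_prod_beta
      using differentiable_chain_at[of fst p a] differentiable_chain_at[of snd p b]
      by (auto intro!: differentiable_mult simp: o_def bounded_linear_imp_differentiable
          bounded_linear_fst bounded_linear_snd)
  qed
  ultimately show ?case by simp
qed

lemma interior_Lam: "interior Lam = {-1<..<1} \<times> {-1<..<1}"
  unfolding Lam_def by (simp add: interior_Times)

lemma test_tensor:
  assumes "test1 a" "test1 b" shows "test_function (tensor a b)"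
proof -
  obtain r where r: "0 < r" "r < 1" "\<And>x. r < \<bar>x\<bar> \<Longrightarrow> a x = 0" "\<And>x. r < \<bar>x\<bar> \<Longrightarrow> b x = 0"
    using test1_bounds[OF assms] by metis
  have "{p. tensor a b p \<noteq> 0} \<subseteq> {-r..r} \<times> {-r..r}"
    using r by (force simp: tensor_def not_less[symmetric])
  then have "closure {p. tensor a b p \<noteq> 0} \<subseteq> {-r..r} \<times> {-r..r}"
    by (rule closure_minimal) (intro closed_Times; simp)
  also have "\<dots> \<subseteq> interior Lam"
    using r by (auto simp: interior_Lam)
  finally show ?thesis
    using assms by (auto simp: test_function_def test1_def C_k_tensor)
qed

text \<open>Since \<open>flat 1 t = exp (- 1 / t)\<close> tends to \<open>1\<close> for large \<open>t\<close>, these bumps tend to an indicator function.\<close>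

definition plateau :: "real \<Rightarrow> real \<Rightarrow> nat \<Rightarrow> real \<Rightarrow> real" where
  "plateau c d n x = flat 1 (real n * (x - c)) * flat 1 (real n * (d - x))"

lemma test1_plateau:
  assumes "-1 < c" "d < 1" shows "test1 (plateau c d n)"
proof -
  have "Ck1 k (plateau c d n)" for k
    using Ck1_mult[OF Ck1_affine[OF flat_smooth, of k 1 "real n" "- (real n * c)"]
        Ck1_affine[OF flat_smooth, of k 1 "- real n" "real n * d"]]
    by (simp add: plateau_def[abs_def] algebra_simps)
  moreover have "plateau c d n x = 0" if "max (1/2) (max \<bar>c\<bar> \<bar>d\<bar>) < \<bar>x\<bar>" for x
  proof -
    have "x < c \<or> d < x"
      using that by linarith
    then show ?thesis
      by (auto simp: plateau_def flat_def zero_less_mult_iff)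
  qed
  \<comment> \<open>Under the assumptions an endpoint of modulus at least one forces an empty
    interval, and the bump vanishes identically. Such intervals do occur, when boxes are intersected
    with a smaller square.\<close>
  moreover have "plateau c d n x = 0" if "\<bar>c\<bar> \<ge> 1 \<or> \<bar>d\<bar> \<ge> 1" for x
  proof -
    have "d \<le> c" using that assms by linarith
    then have "x \<le> c \<or> d \<le> x" by linarith
    then show ?thesis
      by (auto simp: plateau_def flat_def zero_less_mult_iff)
  qed
  moreover have "\<exists>r. 0 < r \<and> r < 1 \<and> (\<forall>x. r < \<bar>x\<bar> \<longrightarrow> plateau c d n x = 0)"
  proof (cases "\<bar>c\<bar> \<ge> 1 \<or> \<bar>d\<bar> \<ge> 1")
    case True
    then show ?thesis using calculation(3) by (intro exI[of _ "1/2"]) simp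
  next
    case False
    then show ?thesis
      using calculation(2) by (intro exI[of _ "max (1/2) (max \<bar>c\<bar> \<bar>d\<bar>)"]) auto
  qed
  ultimately show ?thesis
    unfolding test1_def by blast
qed

lemma plateau_bounds: "0 \<le> plateau c d n x" "plateau c d n x \<le> 1"
  by (auto simp: plateau_def flat_def intro!: mult_le_one)

lemma plateau_outside: "x \<notin> {c<..<d} \<Longrightarrow> plateau c d n x = 0"
  by (auto simp: plateau_def flat_def zero_less_mult_iff)

lemma flat_tendsto_1: 
  assumes "t > 0" shows "(\<lambda>n. flat 1 (real n * t)) \<longlonglongrightarrow> 1"
proof -
  have "(\<lambda>n. exp (- (inverse (real n) * inverse t))) \<longlonglongrightarrow> exp (- (0 * inverse t))"
    by (intro tendsto_intros lim_inverse_n)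
  moreover have "\<forall>\<^sub>F n in sequentially. exp (- (inverse (real n) * inverse t)) = flat 1 (real n * t)"
    using eventually_gt_at_top[of 0]
    by eventually_elim (use assms in \<open>auto simp: flat_def field_simps\<close>)
  ultimately show ?thesis
    using Lim_transform_eventually by fastforce
qed

lemma plateau_tendsto: "(\<lambda>n. plateau c d n x) \<longlonglongrightarrow> indicator {c<..<d} x"
proof (cases "x \<in> {c<..<d}")
  case True
  then have "(\<lambda>n. plateau c d n x) \<longlonglongrightarrow> 1 * 1"
    unfolding plateau_def by (intro tendsto_mult flat_tendsto_1) auto
  with True show ?thesis by simp
qed (simp add: plateau_outside)

section \<open>Lebesgue measure on the interval and on the square\<close>

text \<open>Restriction to the interval is encoded as a density on the Borel sets of the whole line.
  Product measures and Fubini then apply directly, whereas the completed measure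
  \<open>lebesgue_on Lam\<close> is not a product measure.\<close>

definition NI :: "real measure" where
  "NI = density lborel (\<lambda>x. ennreal (indicator {-1..1} x))"

definition LL :: "(real \<times> real) measure" where
  "LL = NI \<Otimes>\<^sub>M NI"

lemma sets_NI [simp, measurable_cong]: "sets NI = sets borel"
  by (simp add: NI_def)

lemma space_NI [simp]: "space NI = UNIV"
  by (simp add: NI_def)

lemma sets_LL [simp, measurable_cong]: "sets LL = sets borel"
  unfolding LL_def borel_prod[symmetric] by (intro sets_pair_measure_cong) auto

lemma space_LL [simp]: "space LL = UNIV"
  by (simp add: LL_def space_pair_measure)

lemma emeasure_NI_UNIV: "emeasure NI UNIV = 2"
  by (simp add: NI_def emeasure_density ennreal_indicator)

interpretation NI: finite_measure NI
  by (rule finite_measureI) (simp add: emeasure_NI_UNIV)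

interpretation NN: pair_sigma_finite NI NI ..

interpretation LL: finite_measure LL
  unfolding LL_def by (rule finite_measure_pair_measure) unfold_locales

lemma measure_NI_UNIV [simp]: "measure NI UNIV = 2"
  by (simp add: measure_def emeasure_NI_UNIV)

lemma measure_LL_UNIV [simp]: "measure LL UNIV = 4"
proof -
  have "emeasure LL (UNIV \<times> UNIV) = 2 * 2"
    unfolding LL_def by (subst NI.emeasure_pair_measure_Times) (auto simp: emeasure_NI_UNIV)
  then show ?thesis by (simp add: measure_def)
qed

lemma Lam_borel [measurable, simp]: "Lam \<in> sets borel"
  unfolding Lam_def by (intro borel_closed closed_Times) auto

lemma LL_density: "LL = density lborel (\<lambda>p. ennreal (indicator Lam p))"
proof -
  have "LL = density (lborel \<Otimes>\<^sub>M lborel) (\<lambda>(x, y). ennreal (indicator {-1..1} x)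
      * ennreal (indicator {-1..1} y))"
    unfolding LL_def NI_def
    by (intro pair_measure_density) (auto simp: NI_def[symmetric] intro: sigma_finite_lborel
        NI.sigma_finite_measure_axioms)
  also have "\<dots> = density lborel (\<lambda>p. ennreal (indicator Lam p))"
    unfolding lborel_prod
    by (intro arg_cong[where f="density lborel"]) (auto simp: Lam_def indicator_def)
  finally show ?thesis .
qed

lemma AE_NI: "(AE x in NI. P x) \<longleftrightarrow> (AE x in lborel. x \<in> {-1..1} \<longrightarrow> P x)"
  unfolding NI_def by (subst AE_density) (auto simp: indicator_def)

lemma AE_NI_interval: "AE x in NI. x \<in> {-1..1}"
  by (simp add: AE_NI)

lemma AE_NI_neq: "AE x in NI. x \<noteq> c"
proof -
  have "AE x in lborel. x \<noteq> c" by (rule AE_lborel_singleton)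
  then show ?thesis unfolding AE_NI by eventually_elim simp
qed

lemma AE_LL: "(AE p in LL. P p) \<longleftrightarrow> (AE p in lborel. p \<in> Lam \<longrightarrow> P p)"
  unfolding LL_density by (subst AE_density) (auto simp: indicator_def)

lemma AE_LL_Lam: "AE p in LL. p \<in> Lam"
  by (simp add: AE_LL)

lemma AE_lebesgue_on_Lam: "(AE p in lebesgue_on Lam. P p) \<longleftrightarrow> (AE p in LL. P p)"
  by (simp add: AE_LL AE_restrict_space_iff AE_completion_iff)

text \<open>Bridge from the completed measure of the definitions to the Borel product measure; for
  Borel integrands the completion changes nothing.\<close>

lemma integrable_LL:
  fixes f :: "real \<times> real \<Rightarrow> real"
  assumes [measurable]: "f \<in> borel_measurable borel"
  shows "integrable (lebesgue_on Lam) f \<longleftrightarrow> integrable LL f"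
  unfolding LL_density
  by (simp add: integrable_restrict_space integrable_completion integrable_real_density)

lemma integral_LL:
  fixes f :: "real \<times> real \<Rightarrow> real"
  assumes [measurable]: "f \<in> borel_measurable borel"
  shows "(LINT p|lebesgue_on Lam. f p) = (LINT p|LL. f p)"
  unfolding LL_density
  by (simp add: integral_restrict_space integral_completion integral_real_density)

lemma borel_imp_lebesgue_on: 
  fixes f :: "'a::euclidean_space \<Rightarrow> real"
  shows "f \<in> borel_measurable borel \<Longrightarrow> f \<in> borel_measurable (lebesgue_on S)"
  by (intro measurable_restrict_space1 measurable_completion) simp

text \<open>The entry to \<open>LL\<close>: after this choice of representative the later estimates
  deal with Borel functions only.\<close>

lemma lebesgue_on_ex_borel:
  fixes f :: "real \<times> real \<Rightarrow> real"
  assumes "f \<in> borel_measurable (lebesgue_on Lam)"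
  obtains g where "g \<in> borel_measurable borel" "AE p in lebesgue_on Lam. f p = g p"
proof -
  have "(\<lambda>p. indicator Lam p *\<^sub>R f p) \<in> borel_measurable lebesgue"
    using assms by (subst (asm) borel_measurable_restrict_space_iff) auto
  then obtain g where g: "g \<in> borel_measurable lborel" "AE p in lborel. indicator Lam p *\<^sub>R f p = g p"
    using completion_ex_borel_measurable_real by blast
  have "AE p in LL. f p = g p"
    using g(2) unfolding AE_LL by eventually_elim (auto simp: indicator_def split: if_splits)
  with g show thesis by (intro that) (auto simp: AE_lebesgue_on_Lam)
qed

lemma NI_bounded_integrable:
  fixes f :: "real \<Rightarrow> real"
  assumes "f \<in> borel_measurable borel" "\<And>x. x \<in> {-1..1} \<Longrightarrow> \<bar>f x\<bar> \<le> B"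
  shows "integrable NI f"
proof (rule NI.integrable_const_bound[where B=B])
  show "AE x in NI. norm (f x) \<le> B"
    using AE_NI_interval by eventually_elim (use assms in auto)
qed (use assms in measurable)

lemma LL_bounded_integrable:
  fixes f :: "real \<times> real \<Rightarrow> real"
  assumes "f \<in> borel_measurable borel" "\<And>p. p \<in> Lam \<Longrightarrow> \<bar>f p\<bar> \<le> B"
  shows "integrable LL f"
proof (rule LL.integrable_const_bound[where B=B])
  show "AE x in LL. norm (f x) \<le> B"
    using AE_LL_Lam by eventually_elim (use assms in auto)
qed (use assms in measurable)

lemma integral_NI:
  fixes f :: "real \<Rightarrow> real"
  assumes [measurable]: "f \<in> borel_measurable borel" and "\<And>x. x \<in> {-1..1} \<Longrightarrow> \<bar>f x\<bar> \<le> B"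
  shows "(LINT x|NI. f x) = integral {-1..1} f"
proof -
  have i: "integrable NI f" by (rule NI_bounded_integrable[OF assms])
  have "set_integrable lborel {-1..1} f"
    using i unfolding NI_def set_integrable_def by (subst (asm) integrable_real_density) auto
  then show ?thesis
    using set_borel_integral_eq_integral(2)[of "{-1..1}" f]
    unfolding NI_def set_lebesgue_integral_def by (subst integral_real_density) auto
qed

text \<open>The finite set \<open>S\<close> admits kinks of \<open>F\<close>, which come from the
  jump of the averaging kernel and from the knot of the spline.\<close>

lemma FTC_NI:
  fixes f F :: "real \<Rightarrow> real"
  assumes "f \<in> borel_measurable borel" "\<And>x. x \<in> {-1..1} \<Longrightarrow> \<bar>f x\<bar> \<le> B" "finite S"
    "continuous_on {-1..1} F" 
    "\<And>x. -1 < x \<Longrightarrow> x < 1 \<Longrightarrow> x \<notin> S \<Longrightarrow> (F has_real_derivative f x) (at x)"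
  shows "(LINT x|NI. f x) = F 1 - F (-1)"
proof -
  have "(f has_integral (F 1 - F (-1))) {-1..1}"
    by (rule fundamental_theorem_of_calculus_interior_strong[OF assms(3)])
      (use assms in \<open>auto simp: has_real_derivative_iff_has_vector_derivative[symmetric]\<close>)
  then show ?thesis
    using integral_NI[OF assms(1,2)] by (simp add: integral_unique)
qed

lemma LL_Fubini:
  fixes f :: "real \<times> real \<Rightarrow> real"
  assumes "integrable LL f"
  shows "(LINT p|LL. f p) = (LINT x|NI. LINT y|NI. f (x, y))"
    and "(LINT p|LL. f p) = (LINT y|NI. LINT x|NI. f (x, y))"
  using NN.integral_fst'[of f] NN.integral_snd[of "\<lambda>x y. f (x, y)"] assms by (auto simp: LL_def)

lemma tensor_borel: "test1 a \<Longrightarrow> test1 b \<Longrightarrow> tensor a b \<in> borel_measurable borel"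
  using C_k_tensor[of 0 a b] test1_Ck1[of a 0] test1_Ck1[of b 0]
  by (intro borel_measurable_continuous_onI) simp

section \<open>The fundamental lemma of the calculus of variations\<close>

text \<open>Open boxes are stable under intersection and generate the Borel sets, so Dynkin's
  theorem extends the vanishing of the integral to all Borel sets. The total integral is a separate
  hypothesis because complements are taken in the whole space, which is not a box.\<close>

lemma AE_zero_if_box_integrals_zero:
  fixes f :: "'a::euclidean_space \<Rightarrow> real"
  assumes int: "integrable lborel f" and tot: "(LINT x|lborel. f x) = 0"
    and box: "\<And>a b. (LINT x|lborel. indicator (box a b) x * f x) = 0"
  shows "AE x in lborel. f x = 0"
proof (rule density_unique_real[OF int])
  note [measurable] = borel_measurable_integrable[OF int]
  fix A :: "'a set" assume "A \<in> sets lborel"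
  then have "A \<in> sigma_sets UNIV (range (\<lambda>(a, b). box a b))"
    by (simp add: borel_eq_box)
  have "Int_stable (range (\<lambda>(a, b). box a b :: 'a set))"
    unfolding Int_stable_def by (auto simp: box_Int_box)
  moreover have "range (\<lambda>(a, b). box a b :: 'a set) \<subseteq> Pow UNIV" by simp
  moreover note \<open>A \<in> sigma_sets UNIV (range (\<lambda>(a, b). box a b))\<close>
  ultimately have "(LINT x:A|lborel. f x) = 0"
  proof (induction rule: sigma_sets_induct_disjoint)
    case (compl A)
    then have [measurable]: "A \<in> sets borel" by (simp add: borel_eq_box)
    have "(LINT x:UNIV - A|lborel. f x) = (LINT x|lborel. f x - indicator A x * f x)"
      unfolding set_lebesgue_integral_def by (intro Bochner_Integration.integral_cong) (auto simp:
          indicator_def)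
    also have "\<dots> = 0"
      using compl(2) tot int by (subst Bochner_Integration.integral_diff)
        (auto simp: set_lebesgue_integral_def intro!: integrable_real_mult_indicator simp: mult.commute)
    finally show ?case .
  next
    case (union A)
    have "range A \<subseteq> sets borel" using union(2) by (simp add: borel_eq_box)
    then have A: "A i \<in> sets lborel" for i by auto
    have "set_integrable lborel (\<Union>i. A i) f"
      unfolding set_integrable_def using A int by (intro integrable_mult_indicator) auto
    then have "(LINT x:(\<Union>i. A i)|lborel. f x) = (\<Sum>i. (LINT x:(A i)|lborel. f x))"
      using union(1) A by (intro lebesgue_integral_countable_add) (auto simp: disjoint_family_on_def)
    with union(3) show ?case by simp
  qed (use box in \<open>auto simp: set_lebesgue_integral_def\<close>)
  then show "(LINT x:A|lborel. f x) = (LINT x:A|lborel. 0)" by simp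
qed simp

text \<open>Products of plateaus lie in [0, 1] and tend to the indicator of the open box, so
  dominated convergence with majorant |g| applies. All test functions involved vanish outside the
  box itself.\<close>

lemma test_integral_box_zero:
  fixes g :: "real \<times> real \<Rightarrow> real"
  assumes int: "integrable lborel g" and "-1 < c" "d < 1" "-1 < c'" "d' < 1"
    and zero: "\<And>a b. test1 a \<Longrightarrow> test1 b \<Longrightarrow> (\<And>x. x \<notin> {c<..<d} \<Longrightarrow> a x = 0) \<Longrightarrow> (\<And>y. y \<notin> {c'<..<d'} \<Longrightarrow> b y = 0)
        \<Longrightarrow> (LINT p|lborel. tensor a b p * g p) = 0"
  shows "(LINT p|lborel. indicator ({c<..<d} \<times> {c'<..<d'}) p * g p) = 0"
proof -
  let ?t = "\<lambda>n. tensor (plateau c d n) (plateau c' d' n)"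
  note [measurable] = borel_measurable_integrable[OF int]
  have [measurable]: "{c<..<d} \<times> {c'<..<d'} \<in> sets borel" by (intro borel_open open_Times) auto
  have [measurable]: "?t n \<in> borel_measurable borel" for n
    using assms by (intro tensor_borel test1_plateau)
  have "(\<lambda>n. LINT p|lborel. ?t n p * g p) \<longlonglongrightarrow> (LINT p|lborel. indicator ({c<..<d} \<times> {c'<..<d'}) p * g p)"
  proof (rule integral_dominated_convergence[where w="\<lambda>p. \<bar>g p\<bar>"])
    show "AE p in lborel. (\<lambda>n. ?t n p * g p) \<longlonglongrightarrow> indicator ({c<..<d} \<times> {c'<..<d'}) p * g p"
    proof (rule AE_I2)
      fix p :: "real \<times> real"
      have "(\<lambda>n. ?t n p * g p) \<longlonglongrightarrow> (indicator {c<..<d} (fst p) * indicator {c'<..<d'} (snd p)) * g p"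
        unfolding tensor_def case_prod_beta by (intro tendsto_intros plateau_tendsto)
      then show "(\<lambda>n. ?t n p * g p) \<longlonglongrightarrow> indicator ({c<..<d} \<times> {c'<..<d'}) p * g p"
        by (cases p) (simp add: indicator_times)
    qed
    show "AE p in lborel. norm (?t n p * g p) \<le> \<bar>g p\<bar>" for n
    proof (rule AE_I2)
      fix p
      have "\<bar>?t n p\<bar> \<le> 1"
        using plateau_bounds by (auto simp: tensor_def case_prod_beta abs_mult intro!: mult_le_one)
      then show "norm (?t n p * g p) \<le> \<bar>g p\<bar>"
        by (simp add: abs_mult mult_left_le_one_le)
    qed
  qed (use int in \<open>auto\<close>)
  moreover have "(LINT p|lborel. ?t n p * g p) = 0" for n
    using assms by (intro zero test1_plateau plateau_outside) auto
  ultimately show ?thesis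
    by (simp add: LIMSEQ_const_iff)
qed

text \<open>Integrability is known only away from the boundary, and \<open>f\<close> need not be
  Borel. The argument therefore runs on smaller squares (-r, r)^2 with a Borel representative of the
  truncated function, and an exhaustion of the open square follows.\<close>

lemma fundamental_lemma:
  assumes loc: "locally_integrable f"
    and zero: "\<And>a b. test1 a \<Longrightarrow> test1 b \<Longrightarrow> (LINT p|lebesgue_on Lam. f p * tensor a b p) = 0"
  shows "AE p in LL. f p = 0"
proof -
  have K: "AE p in lborel. p \<in> {-r<..<r} \<times> {-r<..<r} \<longrightarrow> f p = 0" if r: "0 < r" "r < 1" for r :: real
  proof -
    let ?K = "{-r<..<r} \<times> {-r<..<r}"
    have Ks [measurable]: "?K \<in> sets borel" by (intro borel_open open_Times) auto
    have "{-r..r} \<times> {-r..r} \<subseteq> interior Lam" using r by (auto simp: interior_Lam)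
    then have "integrable (lebesgue_on ({-r..r} \<times> {-r..r})) f"
      using loc by (simp add: locally_integrable_def compact_Times)
    moreover have [measurable]: "{-r..r} \<times> {-r..r} \<in> sets borel" by (intro borel_closed closed_Times) auto
    ultimately have "integrable lebesgue (\<lambda>p. indicator ({-r..r} \<times> {-r..r}) p *\<^sub>R f p)"
      by (subst (asm) integrable_restrict_space) auto
    from integrable_mult_indicator[OF _ this, of ?K]
    have "integrable lebesgue (\<lambda>p. indicator ?K p *\<^sub>R (indicator ({-r..r} \<times> {-r..r}) p *\<^sub>R f p))"
      using Ks by simp
    moreover have "indicator ?K p *\<^sub>R (indicator ({-r..r} \<times> {-r..r}) p *\<^sub>R f p)
        = indicator ?K p * f p" for p
      by (auto simp: indicator_def)
    ultimately have fi: "integrable lebesgue (\<lambda>p. indicator ?K p * f p)"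
      by (simp only:)
    from completion_ex_borel_measurable_real[OF borel_measurable_integrable[OF this]]
    obtain g where g[measurable]: "g \<in> borel_measurable borel"
      and ae: "AE p in lborel. indicator ?K p * f p = g p" by auto
    have ae': "AE p in lebesgue. indicator ?K p * f p = g p" using ae by (simp add: AE_completion_iff)
    have "g \<in> borel_measurable lebesgue" by (intro measurable_completion) (simp add: g)
    from integrable_cong_AE_imp[OF fi this ae'] have gi: "integrable lborel g"
      by (simp add: integrable_completion)
    \<comment> \<open>A test function supported in a box inside the smaller square does not see the
      truncation, so the hypothesis on \<open>f\<close> transfers to \<open>g\<close>.\<close>
    have main: "(LINT p|lborel. indicator ({c<..<d} \<times> {c'<..<d'}) p * g p) = 0"
      if "-r \<le> c" "d \<le> r" "-r \<le> c'" "d' \<le> r" for c d c' d'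
    proof (rule test_integral_box_zero[OF gi])
      fix a b assume t: "test1 a" "test1 b" and s: "\<And>x. x \<notin> {c<..<d} \<Longrightarrow> a x = 0"
          "\<And>y. y \<notin> {c'<..<d'} \<Longrightarrow> b y = 0"
      have [measurable]: "tensor a b \<in> borel_measurable borel"
        using t by (rule tensor_borel)
      have "(LINT p|lborel. tensor a b p * g p) = (LINT p|lebesgue. tensor a b p * g p)"
        by (simp add: integral_completion)
      also have "\<dots> = (LINT p|lebesgue. tensor a b p * (indicator ?K p * f p))"
        by (intro integral_cong_AE borel_measurable_times borel_measurable_integrable[OF fi])
          (use ae' in \<open>auto intro!: measurable_completion\<close>)
      also have "\<dots> = (LINT p|lebesgue. indicator Lam p *\<^sub>R (f p * tensor a b p))"
      proof (rule Bochner_Integration.integral_cong[OF refl])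
        fix p :: "real \<times> real"
        have "tensor a b p = 0" if "p \<notin> ?K"
        proof -
          have "fst p \<notin> {c<..<d} \<or> snd p \<notin> {c'<..<d'}"
            using that \<open>-r \<le> c\<close> \<open>d \<le> r\<close> \<open>-r \<le> c'\<close> \<open>d' \<le> r\<close> by (cases p) auto
          then show ?thesis using s by (cases p) (auto simp: tensor_def)
        qed
        moreover have "p \<in> Lam" if "p \<in> ?K" using that r by (auto simp: Lam_def)
        ultimately show "tensor a b p * (indicator ?K p * f p) = indicator Lam p *\<^sub>R (f p * tensor a b p)"
          by (cases "p \<in> ?K") auto
      qed
      also have "\<dots> = 0"
        using zero[OF t] by (simp add: integral_restrict_space)
      finally show "(LINT p|lborel. tensor a b p * g p) = 0" .
    qed (use that r in auto)
    \<comment> \<open>Since \<open>g\<close> vanishes almost everywhere off the smaller square, an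
      arbitrary box may be intersected with that square.\<close>
    have gK: "AE p in lborel. indicator ?K p * g p = g p"
      using ae by eventually_elim (metis indicator_simps mult_zero_left mult_1)
    have "AE p in lborel. g p = 0"
    proof (rule AE_zero_if_box_integrals_zero[OF gi])
      have "(LINT p|lborel. g p) = (LINT p|lborel. indicator ?K p * g p)"
        using gK by (intro integral_cong_AE) auto
      then show "(LINT p|lborel. g p) = 0" using main[of "-r" r "-r" r] by simp
    next
      fix a b :: "real \<times> real"
      have "(LINT p|lborel. indicator (box a b) p * g p) = (LINT p|lborel. indicator (box a b)
          p * (indicator ?K p * g p))"
        using gK by (intro integral_cong_AE) auto
      also have "\<dots> = (LINT p|lborel. indicator ({max (fst a) (-r)<..<min (fst b) r} \<times> {max (snd a)
          (-r)<..<min (snd b) r}) p * g p)"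
        by (cases a, cases b, intro Bochner_Integration.integral_cong)
          (auto simp: indicator_def mem_box Basis_prod_def inner_Pair)
      also have "\<dots> = 0" by (rule main) auto
      finally show "(LINT p|lborel. indicator (box a b) p * g p) = 0" .
    qed
    with ae show ?thesis by eventually_elim auto
  qed
  \<comment> \<open>The offset 2 keeps every \<open>r n\<close> strictly between 0 and 1, also for
    \<open>n = 0\<close>.\<close>
  define r where "r n = 1 - 1 / (real n + 2)" for n
  have "AE p in lborel. \<forall>n. p \<in> {- r n<..<r n} \<times> {- r n<..<r n} \<longrightarrow> f p = 0"
    unfolding AE_all_countable by (intro allI K) (auto simp: r_def)
  moreover have "AE p in lborel. p \<in> Lam \<longrightarrow> p \<in> interior Lam"
  proof -
    \<comment> \<open>The exhaustion misses the edges, but the boundary of a convex set is a null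
      set.\<close>
    have "convex Lam" unfolding Lam_def by (intro convex_Times) auto
    then have "negligible (frontier Lam)" by (rule negligible_convex_frontier)
    then have "AE p in lebesgue. p \<notin> frontier Lam"
      by (simp add: negligible_iff_null_sets AE_not_in)
    then have "AE p in lborel. p \<notin> frontier Lam" by (simp add: AE_completion_iff)
    then show ?thesis by eventually_elim (use closure_subset in \<open>auto simp: frontier_def\<close>)
  qed
  ultimately show ?thesis
    unfolding AE_LL
  proof eventually_elim
    case (elim p)
    show ?case
    proof
      assume "p \<in> Lam"
      with elim have p: "\<bar>fst p\<bar> < 1" "\<bar>snd p\<bar> < 1" by (auto simp: interior_Lam)
      then obtain n where n: "1 / real (Suc n) < 1 - max \<bar>fst p\<bar> \<bar>snd p\<bar>"
        using nat_approx_posE[of "1 - max \<bar>fst p\<bar> \<bar>snd p\<bar>"] by auto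
      have "1 - 1 / real (Suc n) \<le> r n" by (simp add: r_def frac_le)
      with n have "p \<in> {- r n<..<r n} \<times> {- r n<..<r n}"
        by (cases p) auto
      with elim(1) show "f p = 0" by blast
    qed
  qed
qed

section \<open>Calculus of weak derivatives\<close>

definition smooth2 :: "(real \<times> real \<Rightarrow> real) \<Rightarrow> bool" where
  "smooth2 f \<longleftrightarrow> (\<forall>k. C_k k f)"

lemma smooth2_dx: "smooth2 f \<Longrightarrow> smooth2 (dx f)" and smooth2_dy: "smooth2 f \<Longrightarrow> smooth2 (dy f)"
  by (metis C_k.simps(2) smooth2_def)+

lemma smooth2_continuous: "smooth2 f \<Longrightarrow> continuous_on UNIV f"
  by (metis C_k.simps(1) smooth2_def)

lemma smooth2_differentiable: "smooth2 f \<Longrightarrow> f differentiable (at p)"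
  unfolding smooth2_def by (metis C_k.simps(2) differentiable_on_def UNIV_I)

lemma smooth2_has_dx:
  assumes "smooth2 f" shows "((\<lambda>s. f (s, y)) has_real_derivative dx f (x, y)) (at x)"
proof -
  have "(\<lambda>s. f (s, y)) differentiable (at x)"
    using differentiable_chain_at[of "\<lambda>s. (s, y)" x f] smooth2_differentiable[OF assms]
    by (simp add: o_def)
  then show ?thesis
    by (metis DERIV_deriv_iff_real_differentiable dx_def prod.simps(2))
qed

lemma smooth2_has_dy:
  assumes "smooth2 f" shows "((\<lambda>t. f (x, t)) has_real_derivative dy f (x, y)) (at y)"
proof -
  have "(\<lambda>t. f (x, t)) differentiable (at y)"
    using differentiable_chain_at[of "\<lambda>t. (x, t)" y f] smooth2_differentiable[OF assms]
    by (simp add: o_def)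
  then show ?thesis
    by (metis DERIV_deriv_iff_real_differentiable dy_def prod.simps(2))
qed

text \<open>Both mixed derivatives are limits of the second difference quotient over a small square.\<close>

lemma dx_dy_commute:
  assumes f: "smooth2 f" shows "dx (dy f) = dy (dx f)"
proof
  fix p :: "real \<times> real"
  obtain x y where p: "p = (x, y)" by fastforce
  have ex: "\<exists>q r. dist q p \<le> 2 * h \<and> dist r p \<le> 2 * h \<and> dx (dy f) q = dy (dx f) r" if h: "h > 0"
      for h :: real
  proof -
    have d: "dist (s, t) p \<le> 2 * h" if "x < s" "s < x + h" "y < t" "t < y + h" for s t
    proof -
      have "dist (s, t) p \<le> dist s x + dist t y"
        unfolding p dist_Pair_Pair by (rule sqrt_sum_squares_le_sum) auto
      then show ?thesis using that by (simp add: dist_real_def)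
    qed
    let ?D = "f (x + h, y + h) - f (x + h, y) - f (x, y + h) + f (x, y)"
    have "\<exists>s>x. s < x + h \<and> (f (x + h, y + h) - f (x + h, y)) - (f (x, y + h) - f (x, y))
        = (x + h - x) * (dx f (s, y + h) - dx f (s, y))"
      using h by (intro MVT2) (auto intro!: derivative_intros smooth2_has_dx f)
    then obtain s where s: "x < s" "s < x + h" "?D = h * (dx f (s, y + h) - dx f (s, y))"
      by (auto simp: algebra_simps)
    have "\<exists>t>y. t < y + h \<and> dx f (s, y + h) - dx f (s, y) = (y + h - y) * dy (dx f) (s, t)"
      using h by (intro MVT2) (auto intro!: smooth2_has_dy smooth2_dx f)
    then obtain t where t: "y < t" "t < y + h" "?D = h * (h * dy (dx f) (s, t))"
      using s by auto
    have "\<exists>t>y. t < y + h \<and> (f (x + h, y + h) - f (x, y + h)) - (f (x + h, y) - f (x, y))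
        = (y + h - y) * (dy f (x + h, t) - dy f (x, t))"
      using h by (intro MVT2) (auto intro!: derivative_intros smooth2_has_dy f)
    then obtain t' where t': "y < t'" "t' < y + h" "?D = h * (dy f (x + h, t') - dy f (x, t'))"
      by (auto simp: algebra_simps)
    have "\<exists>s>x. s < x + h \<and> dy f (x + h, t') - dy f (x, t') = (x + h - x) * dx (dy f) (s, t')"
      using h by (intro MVT2) (auto intro!: smooth2_has_dx smooth2_dy f)
    then obtain s' where s': "x < s'" "s' < x + h" "?D = h * (h * dx (dy f) (s', t'))"
      using t' by auto
    have "dx (dy f) (s', t') = dy (dx f) (s, t)" using t(3) s'(3) h by simp
    then show ?thesis using d[OF s(1,2) t(1,2)] d[OF s'(1,2) t'(1,2)] by blast
  qed
  have "\<exists>q r. dist q p \<le> 2 * inverse (real (Suc n)) \<and> dist r p \<le> 2 * inverse (real (Suc n)) \<and>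
      dx (dy f) q = dy (dx f) r" for n
    by (rule ex) simp
  then obtain q r where qr: "\<And>n. dist (q n) p \<le> 2 * inverse (real (Suc n))"
    "\<And>n. dist (r n) p \<le> 2 * inverse (real (Suc n))" "\<And>n. dx (dy f) (q n) = dy (dx f) (r n)"
    by metis
  have z: "(\<lambda>n. 2 * inverse (real (Suc n))) \<longlonglongrightarrow> 2 * 0" by (intro tendsto_intros LIMSEQ_inverse_real_of_nat)
  have lim: "s \<longlonglongrightarrow> p" if "\<And>n. dist (s n) p \<le> 2 * inverse (real (Suc n))" for s
  proof -
    have "(\<lambda>n. dist (s n) p) \<longlonglongrightarrow> 0"
      by (rule tendsto_sandwich[OF _ _ tendsto_const, of _ _ _ "\<lambda>n. 2 * inverse (real (Suc n))"])
          (use z that in auto)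
    then show ?thesis by (simp add: tendsto_dist_iff[of s p])
  qed
  have c: "isCont (dx (dy f)) p" "isCont (dy (dx f)) p"
    using smooth2_continuous[OF smooth2_dx[OF smooth2_dy[OF f]]] smooth2_continuous[OF smooth2_dy[OF
        smooth2_dx[OF f]]]
    by (simp_all add: continuous_on_eq_continuous_at del: split_paired_All)
  have "(\<lambda>n. dx (dy f) (q n)) \<longlonglongrightarrow> dx (dy f) p" "(\<lambda>n. dy (dx f) (r n)) \<longlonglongrightarrow> dy (dx f) p"
    by (rule isCont_tendsto_compose[OF c(1) lim[OF qr(1)]], rule isCont_tendsto_compose[OF c(2)
        lim[OF qr(2)]])
  then show "dx (dy f) p = dy (dx f) p"
    using qr(3) LIMSEQ_unique by simp
qed

section \<open>Iterated derivatives and test functions of two variables\<close>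

lemma smooth2_dx_pow: "smooth2 f \<Longrightarrow> smooth2 ((dx ^^ n) f)"
  by (induction n) (auto intro: smooth2_dx)

lemma smooth2_dy_pow: "smooth2 f \<Longrightarrow> smooth2 ((dy ^^ n) f)"
  by (induction n) (auto intro: smooth2_dy)

lemma dy_dx_pow: "smooth2 f \<Longrightarrow> dy ((dx ^^ n) f) = (dx ^^ n) (dy f)"
  by (induction n) (auto simp: smooth2_dx_pow dx_dy_commute[symmetric])

lemma dy_pow_dx_pow: "smooth2 f \<Longrightarrow> (dy ^^ m) ((dx ^^ n) f) = (dx ^^ n) ((dy ^^ m) f)"
  by (induction m) (auto simp: smooth2_dy_pow dy_dx_pow)

text \<open>\<open>classical_deriv\<close> takes all y-derivatives first, so composing two of them
  rests on the commutation of mixed derivatives.\<close>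

lemma classical_deriv_comp:
  assumes "smooth2 f"
  shows "classical_deriv (a, b) (classical_deriv (c, d) f) = classical_deriv (a + c, b + d) f"
  using assms by (simp add: classical_deriv_def dy_pow_dx_pow smooth2_dy_pow funpow_add)

lemma test_function_smooth2: "test_function f \<Longrightarrow> smooth2 f"
  by (simp add: test_function_def smooth2_def)

text \<open>Off the support \<open>f\<close> vanishes on an open set, hence so do its partial
  derivatives: differentiation does not enlarge the support.\<close>

lemma zero_nhds_dx:
  assumes "p \<notin> closure {p. f p \<noteq> 0}" shows "dx f p = 0" and "dy f p = 0"
proof -
  obtain x y where p: "p = (x, y)" by fastforce
  let ?S = "- closure {p. f p \<noteq> 0}"
  have f0: "f q = 0" if "q \<in> ?S" for q using that closure_subset[of "{p. f p \<noteq> 0}"] by auto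
  have o: "open ((\<lambda>s. (s, y)) -` ?S)" "open ((\<lambda>t. (x, t)) -` ?S)"
    by (auto intro!: open_vimage continuous_intros)
  have "((\<lambda>s. f (s, y)) has_real_derivative 0) (at x)"
    by (rule has_field_derivative_transform_within_open[OF DERIV_const[of 0] o(1)], use assms p in
        simp, rule f0[symmetric], simp)
  moreover have "((\<lambda>t. f (x, t)) has_real_derivative 0) (at y)"
    by (rule has_field_derivative_transform_within_open[OF DERIV_const[of 0] o(2)], use assms p in
        simp, rule f0[symmetric], simp)
  ultimately show "dx f p = 0" "dy f p = 0"
    by (auto simp: dx_def dy_def p DERIV_imp_deriv)
qed

lemma test_function_dx: "test_function f \<Longrightarrow> test_function (dx f)"
  and test_function_dy: "test_function f \<Longrightarrow> test_function (dy f)"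
proof -
  assume f: "test_function f"
  have "{p. dx f p \<noteq> 0} \<subseteq> closure {p. f p \<noteq> 0}" "{p. dy f p \<noteq> 0} \<subseteq> closure {p. f p \<noteq> 0}"
    using zero_nhds_dx by blast+
  then have "closure {p. dx f p \<noteq> 0} \<subseteq> closure {p. f p \<noteq> 0}"
      "closure {p. dy f p \<noteq> 0} \<subseteq> closure {p. f p \<noteq> 0}"
    by (simp_all add: closure_minimal)
  with f show "test_function (dx f)" "test_function (dy f)"
    using smooth2_dx smooth2_dy test_function_smooth2 unfolding test_function_def smooth2_def by blast+
qed

lemma test_function_classical_deriv:
  assumes "test_function f" shows "test_function (classical_deriv \<gamma> f)"
proof -
  have y: "test_function ((dy ^^ n) f)" for n
    by (induction n) (auto intro: assms test_function_dy)
  have "test_function ((dx ^^ n) ((dy ^^ m) f))" for n m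
    by (induction n) (auto intro: y test_function_dx)
  then show ?thesis by (simp add: classical_deriv_def)
qed

lemma test_function_borel: "test_function f \<Longrightarrow> f \<in> borel_measurable borel"
  using smooth2_continuous test_function_smooth2 by (blast intro: borel_measurable_continuous_onI)

lemma test_function_outside: "test_function f \<Longrightarrow> p \<notin> interior Lam \<Longrightarrow> f p = 0"
  using closure_subset[of "{p. f p \<noteq> 0}"] by (auto simp: test_function_def)

lemma compact_Lam: "compact Lam"
  by (simp add: Lam_def compact_Times)

lemma test_function_bounded:
  assumes "test_function f" obtains B where "\<And>p. \<bar>f p\<bar> \<le> B"
proof -
  have "continuous_on Lam f"
    using smooth2_continuous[OF test_function_smooth2[OF assms]] continuous_on_subset by blast
  then have "bounded (f ` Lam)"
    by (intro compact_imp_bounded compact_continuous_image compact_Lam)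
  then obtain B where B: "\<And>p. p \<in> Lam \<Longrightarrow> \<bar>f p\<bar> \<le> B"
    by (auto simp: bounded_iff)
  have "\<bar>f p\<bar> \<le> max B 0" for p
    using B[of p] test_function_outside[OF assms, of p] interior_subset[of Lam]
    by (cases "p \<in> Lam") (auto simp: le_max_iff_disj)
  then show thesis by (rule that)
qed

text \<open>The support of a test function is compact in the interior, where the integrability of
  \<open>u\<close> is given.\<close>

lemma integrable_mult_test:
  assumes u: "locally_integrable u" and f: "test_function f"
  shows "integrable (lebesgue_on Lam) (\<lambda>p. u p * f p)"
proof -
  let ?K = "closure {p. f p \<noteq> 0}"
  have KL: "?K \<subseteq> interior Lam" using f by (simp add: test_function_def)
  have "bounded ?K"
    using KL interior_subset compact_imp_bounded[OF compact_Lam] bounded_subset by metis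
  then have "compact ?K" by (simp add: compact_eq_bounded_closed)
  then have "integrable (lebesgue_on ?K) u" using u KL by (simp add: locally_integrable_def)
  then have i: "integrable lebesgue (\<lambda>p. indicator ?K p *\<^sub>R u p)"
    by (subst (asm) integrable_restrict_space) auto
  obtain B where B: "\<And>p. \<bar>f p\<bar> \<le> B" using test_function_bounded[OF f] by metis
  have fm: "f \<in> borel_measurable lebesgue" 
    using test_function_borel[OF f] by (intro measurable_completion) simp
  have "integrable lebesgue (\<lambda>p. B * (indicator ?K p *\<^sub>R u p))" using i by (rule integrable_mult_right)
  then have "integrable lebesgue (\<lambda>p. f p * (indicator ?K p *\<^sub>R u p))"
  proof (rule Bochner_Integration.integrable_bound)
    show "(\<lambda>p. f p * (indicator ?K p *\<^sub>R u p)) \<in> borel_measurable lebesgue"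
      by (intro borel_measurable_times fm borel_measurable_integrable[OF i])
    have "\<bar>B\<bar> = B" using B[of 0] by linarith
    then show "AE p in lebesgue. norm (f p * (indicator ?K p *\<^sub>R u p)) \<le> norm (B * (indicator ?K p
        *\<^sub>R u p))"
      using B by (auto simp: abs_mult intro!: mult_right_mono)
  qed
  moreover have "f p * (indicator ?K p *\<^sub>R u p) = indicator Lam p *\<^sub>R (u p * f p)" for p
    using closure_subset[of "{p. f p \<noteq> 0}"] KL interior_subset[of Lam]
    by (cases "f p = 0") (auto simp: indicator_def)
  ultimately have "integrable lebesgue (\<lambda>p. indicator Lam p *\<^sub>R (u p * f p))"
    by (simp only:)
  then show ?thesis
    by (simp add: integrable_restrict_space)
qed

lemma locally_integrableI:
  assumes "integrable (lebesgue_on Lam) u" shows "locally_integrable u"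
  unfolding locally_integrable_def
proof safe
  fix K assume K: "compact K" "K \<subseteq> interior Lam"
  then have KL: "K \<subseteq> Lam" using interior_subset by blast
  have Km: "K \<in> sets borel" using K(1) by (simp add: borel_compact)
  have "integrable lebesgue (\<lambda>p. indicator Lam p *\<^sub>R u p)"
    using assms by (subst (asm) integrable_restrict_space) auto
  from integrable_mult_indicator[OF _ this, of K]
  have "integrable lebesgue (\<lambda>p. indicator K p *\<^sub>R (indicator Lam p *\<^sub>R u p))"
    using Km by simp
  moreover have "indicator K p *\<^sub>R (indicator Lam p *\<^sub>R u p) = indicator K p *\<^sub>R u p" for p
    using KL by (auto simp: indicator_def)
  ultimately have "integrable lebesgue (\<lambda>p. indicator K p *\<^sub>R u p)" by (simp only:)
  then show "integrable (lebesgue_on K) u"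
    using Km by (subst integrable_restrict_space) auto
qed

section \<open>Differences, uniqueness and composition of weak derivatives\<close>

lemma locally_integrable_diff:
  "locally_integrable u \<Longrightarrow> locally_integrable v \<Longrightarrow> locally_integrable (\<lambda>p. u p - v p)"
  by (auto simp: locally_integrable_def)

lemma weak_deriv_diff:
  assumes "has_weak_deriv \<gamma> u v" "has_weak_deriv \<gamma> u' v'"
  shows "has_weak_deriv \<gamma> (\<lambda>p. u p - u' p) (\<lambda>p. v p - v' p)"
  using assms integrable_mult_test test_function_classical_deriv
  by (auto simp: has_weak_deriv_def locally_integrable_diff left_diff_distrib right_diff_distrib)

lemma weak_deriv_unique:
  assumes "has_weak_deriv \<gamma> u v" "has_weak_deriv \<gamma> u v'"
  shows "AE p in LL. v p = v' p"
proof -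
  have "AE p in LL. v p - v' p = 0"
  proof (rule fundamental_lemma)
    show "locally_integrable (\<lambda>p. v p - v' p)"
      using assms locally_integrable_diff by (auto simp: has_weak_deriv_def)
    fix a b assume "test1 a" "test1 b"
    then have t: "test_function (tensor a b)" by (rule test_tensor)
    have "(-1) ^ mi_order \<gamma> * (LINT p|lebesgue_on Lam. v p * tensor a b p) =
        (-1) ^ mi_order \<gamma> * (LINT p|lebesgue_on Lam. v' p * tensor a b p)"
      using assms t by (auto simp: has_weak_deriv_def)
    then have "(LINT p|lebesgue_on Lam. v p * tensor a b p) = (LINT p|lebesgue_on Lam. v' p * tensor a b p)"
      by simp
    moreover have "integrable (lebesgue_on Lam) (\<lambda>p. v p * tensor a b p)"
      "integrable (lebesgue_on Lam) (\<lambda>p. v' p * tensor a b p)"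
      using assms t integrable_mult_test by (auto simp: has_weak_deriv_def)
    ultimately show "(LINT p|lebesgue_on Lam. (v p - v' p) * tensor a b p) = 0"
      by (simp add: left_diff_distrib)
  qed
  then show ?thesis by simp
qed

text \<open>Serves to replace a weak derivative by a Borel representative of its class.\<close>

lemma weak_deriv_cong_right:
  assumes u: "has_weak_deriv \<gamma> u v" and ae: "AE p in LL. v p = v' p"
      and v': "integrable (lebesgue_on Lam) v'"
  shows "has_weak_deriv \<gamma> u v'"
  unfolding has_weak_deriv_def
proof (intro conjI allI impI)
  show l': "locally_integrable v'" by (rule locally_integrableI[OF v'])
  show "locally_integrable u" using u by (simp add: has_weak_deriv_def)
  fix \<phi> assume t: "test_function \<phi>"
  have l: "locally_integrable v" using u by (simp add: has_weak_deriv_def)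
  have "(LINT p|lebesgue_on Lam. v p * \<phi> p) = (LINT p|lebesgue_on Lam. v' p * \<phi> p)"
    using ae unfolding AE_lebesgue_on_Lam[symmetric]
    by (intro integral_cong_AE borel_measurable_integrable[OF integrable_mult_test[OF l t]]
      borel_measurable_integrable[OF integrable_mult_test[OF l' t]]) auto
  then show "(LINT p|lebesgue_on Lam. u p * classical_deriv \<gamma> \<phi> p) =
      (-1) ^ mi_order \<gamma> * (LINT p|lebesgue_on Lam. v' p * \<phi> p)"
    using u t by (simp add: has_weak_deriv_def)
qed

text \<open>A derivative of a test function is a test function, so the two defining identities can
  be chained. This reaches the derivatives of the interpolant one order at a time.\<close>

lemma weak_deriv_comp1:
  assumes u: "has_weak_deriv (a, b) u v" and v: "has_weak_deriv (c, d) v w"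
  shows "has_weak_deriv (a + c, b + d) u w"
  unfolding has_weak_deriv_def
proof (intro conjI allI impI)
  show "locally_integrable u" "locally_integrable w" using u v by (auto simp: has_weak_deriv_def)
  fix \<phi> assume t: "test_function \<phi>"
  have "(LINT p|lebesgue_on Lam. u p * classical_deriv (a + c, b + d) \<phi> p) =
      (LINT p|lebesgue_on Lam. u p * classical_deriv (a, b) (classical_deriv (c, d) \<phi>) p)"
    using t by (simp add: classical_deriv_comp test_function_smooth2)
  also have "\<dots> = (-1) ^ (a + b) * (LINT p|lebesgue_on Lam. v p * classical_deriv (c, d) \<phi> p)"
    using u test_function_classical_deriv[OF t] by (simp add: has_weak_deriv_def mi_order_def)
  also have "\<dots> = (-1) ^ (a + b) * ((-1) ^ (c + d) * (LINT p|lebesgue_on Lam. w p * \<phi> p))"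
    using v t by (simp add: has_weak_deriv_def mi_order_def)
  also have "\<dots> = (-1) ^ mi_order (a + c, b + d) * (LINT p|lebesgue_on Lam. w p * \<phi> p)"
    by (simp add: mi_order_def power_add)
  finally show "(LINT p|lebesgue_on Lam. u p * classical_deriv (a + c, b + d) \<phi> p) =
      (-1) ^ mi_order (a + c, b + d) * (LINT p|lebesgue_on Lam. w p * \<phi> p)" .
qed

text \<open>Membership in H^3 supplies the derivatives of \<open>u\<close> separately; this relates
  them to one another, because the test function of the first identity may itself be a
  derivative.\<close>

lemma weak_deriv_comp2:
  assumes u: "has_weak_deriv (a, b) u v" and w: "has_weak_deriv (a + c, b + d) u w"
  shows "has_weak_deriv (c, d) v w"
  unfolding has_weak_deriv_def
proof (intro conjI allI impI)
  show "locally_integrable v" "locally_integrable w" using u w by (auto simp: has_weak_deriv_def)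
  fix \<phi> assume t: "test_function \<phi>"
  have "(-1) ^ (a + b) * (LINT p|lebesgue_on Lam. v p * classical_deriv (c, d) \<phi> p) =
      (LINT p|lebesgue_on Lam. u p * classical_deriv (a, b) (classical_deriv (c, d) \<phi>) p)"
    using u test_function_classical_deriv[OF t] by (simp add: has_weak_deriv_def mi_order_def)
  also have "\<dots> = (LINT p|lebesgue_on Lam. u p * classical_deriv (a + c, b + d) \<phi> p)"
    using t by (simp add: classical_deriv_comp test_function_smooth2)
  also have "\<dots> = (-1) ^ mi_order (a + c, b + d) * (LINT p|lebesgue_on Lam. w p * \<phi> p)"
    using w t by (simp add: has_weak_deriv_def)
  also have "\<dots> = (-1) ^ (a + b) * ((-1) ^ mi_order (c, d) * (LINT p|lebesgue_on Lam. w p * \<phi> p))"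
    by (simp add: mi_order_def power_add)
  finally show "(LINT p|lebesgue_on Lam. v p * classical_deriv (c, d) \<phi> p) =
      (-1) ^ mi_order (c, d) * (LINT p|lebesgue_on Lam. w p * \<phi> p)"
    by simp
qed

section \<open>Weak derivatives of piecewise smooth functions\<close>

lemma bounded_borel_locally_integrable:
  fixes f :: "real \<times> real \<Rightarrow> real"
  assumes "f \<in> borel_measurable borel" "\<And>p. p \<in> Lam \<Longrightarrow> \<bar>f p\<bar> \<le> B"
  shows "locally_integrable f"
  using LL_bounded_integrable[OF assms] assms by (intro locally_integrableI) (simp add: integrable_LL)

lemma test_function_dx_dy:
  assumes "test_function \<phi>"
  shows "classical_deriv (Suc 0, 0) \<phi> = dx \<phi>" "classical_deriv (0, Suc 0) \<phi> = dy \<phi>"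
  by (auto simp: classical_deriv_def)

text \<open>Fubini reduces the identity to lines parallel to the x-axis. There
  \<open>G * \<phi>\<close> is continuous and differentiable off a finite set, and the boundary
  terms of the fundamental theorem vanish with \<open>\<phi>\<close>.\<close>

lemma weak_deriv_piecewise_x:
  fixes G g :: "real \<times> real \<Rightarrow> real"
  assumes G [measurable]: "G \<in> borel_measurable borel" and GB: "\<And>p. p \<in> Lam \<Longrightarrow> \<bar>G p\<bar> \<le> B"
    and g [measurable]: "g \<in> borel_measurable borel" and gB: "\<And>p. p \<in> Lam \<Longrightarrow> \<bar>g p\<bar> \<le> B"
    and S: "finite S"
    and cont: "\<And>y. y \<in> {-1..1} \<Longrightarrow> continuous_on {-1..1} (\<lambda>x. G (x, y))"
    and deriv: "\<And>x y. y \<in> {-1..1} \<Longrightarrow> -1 < x \<Longrightarrow> x < 1 \<Longrightarrow> x \<notin> S \<Longrightarrow>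
        ((\<lambda>x. G (x, y)) has_real_derivative g (x, y)) (at x)"
  shows "has_weak_deriv (Suc 0, 0) G g"
  unfolding has_weak_deriv_def
proof (intro conjI allI impI)
  show "locally_integrable G" "locally_integrable g"
    using bounded_borel_locally_integrable G g GB gB by blast+
  fix \<phi> assume t: "test_function \<phi>"
  obtain M where M: "\<And>p. \<bar>\<phi> p\<bar> \<le> M" using test_function_bounded[OF t] by metis
  obtain M' where M': "\<And>p. \<bar>dx \<phi> p\<bar> \<le> M'" using test_function_bounded[OF test_function_dx[OF t]] by metis
  have [measurable]: "\<phi> \<in> borel_measurable borel" "dx \<phi> \<in> borel_measurable borel"
    using t test_function_dx test_function_borel by auto
  have bd: "\<bar>G p * dx \<phi> p\<bar> \<le> B * M'" "\<bar>g p * \<phi> p\<bar> \<le> B * M" if "p \<in> Lam" for p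
    using GB[OF that] gB[OF that] M[of p] M'[of p] by (auto simp: abs_mult intro!: mult_mono)
  have i: "integrable LL (\<lambda>p. G p * dx \<phi> p)" "integrable LL (\<lambda>p. g p * \<phi> p)"
    by (rule LL_bounded_integrable[OF _ bd(1)], measurable) (rule LL_bounded_integrable[OF _ bd(2)],
        measurable)
  have "(LINT p|LL. G p * dx \<phi> p + g p * \<phi> p) = (LINT y|NI. LINT x|NI. G (x, y) * dx \<phi> (x, y)
      + g (x, y) * \<phi> (x, y))"
    using i by (intro LL_Fubini(2)) auto
  also have "\<dots> = (LINT y|NI. 0)"
  proof (rule integral_cong_AE)
    show "AE y in NI. (LINT x|NI. G (x, y) * dx \<phi> (x, y) + g (x, y) * \<phi> (x, y)) = 0"
      using AE_NI_interval
    proof eventually_elim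
      case (elim y)
      have "(LINT x|NI. G (x, y) * dx \<phi> (x, y) + g (x, y) * \<phi> (x, y)) = G (1, y) * \<phi> (1, y)
          - G (-1, y) * \<phi> (-1, y)"
      proof (rule FTC_NI[OF _ _ S])
        show "\<bar>G (x, y) * dx \<phi> (x, y) + g (x, y) * \<phi> (x, y)\<bar> \<le> B * M' + B * M" if "x \<in> {-1..1}" for x
          using bd[of "(x, y)"] that elim by (auto simp: Lam_def)
        have "continuous_on UNIV (\<lambda>x. \<phi> (x, y))"
          by (intro continuous_at_imp_continuous_on ballI DERIV_isCont[OF smooth2_has_dx[OF
              test_function_smooth2[OF t]]])
        then show "continuous_on {-1..1} (\<lambda>x. G (x, y) * \<phi> (x, y))"
          using cont[OF elim] by (intro continuous_on_mult) (auto intro: continuous_on_subset)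
        show "((\<lambda>x. G (x, y) * \<phi> (x, y)) has_real_derivative G (x, y) * dx \<phi> (x, y) + g (x, y)
            * \<phi> (x, y)) (at x)"
          if "-1 < x" "x < 1" "x \<notin> S" for x
          using DERIV_mult[OF deriv[OF elim that] smooth2_has_dx[OF test_function_smooth2[OF t]]]
          by (simp add: algebra_simps)
      qed measurable
      also have "\<dots> = 0"
        using test_function_outside[OF t, of "(1, y)"] test_function_outside[OF t, of "(-1, y)"]
        by (simp add: interior_Lam)
      finally show ?case .
    qed
  qed measurable
  finally have "(LINT p|LL. G p * dx \<phi> p) = - (LINT p|LL. g p * \<phi> p)"
    using i by simp
  moreover have "(LINT p|lebesgue_on Lam. G p * dx \<phi> p) = (LINT p|LL. G p * dx \<phi> p)"
    "(LINT p|lebesgue_on Lam. g p * \<phi> p) = (LINT p|LL. g p * \<phi> p)"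
    by (rule integral_LL; measurable)+
  ultimately show "(LINT p|lebesgue_on Lam. G p * classical_deriv (Suc 0, 0) \<phi> p) =
      (-1) ^ mi_order (Suc 0, 0) * (LINT p|lebesgue_on Lam. g p * \<phi> p)"
    by (simp add: test_function_dx_dy[OF t] mi_order_def)
qed

text \<open>In this direction the exceptional set will be the spline knot, where the second
  derivative jumps.\<close>

lemma weak_deriv_piecewise_y:
  fixes G g :: "real \<times> real \<Rightarrow> real"
  assumes G [measurable]: "G \<in> borel_measurable borel" and GB: "\<And>p. p \<in> Lam \<Longrightarrow> \<bar>G p\<bar> \<le> B"
    and g [measurable]: "g \<in> borel_measurable borel" and gB: "\<And>p. p \<in> Lam \<Longrightarrow> \<bar>g p\<bar> \<le> B"
    and S: "finite S"
    and cont: "\<And>x. x \<in> {-1..1} \<Longrightarrow> continuous_on {-1..1} (\<lambda>y. G (x, y))"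
    and deriv: "\<And>x y. x \<in> {-1..1} \<Longrightarrow> -1 < y \<Longrightarrow> y < 1 \<Longrightarrow> y \<notin> S \<Longrightarrow>
        ((\<lambda>y. G (x, y)) has_real_derivative g (x, y)) (at y)"
  shows "has_weak_deriv (0, Suc 0) G g"
  unfolding has_weak_deriv_def
proof (intro conjI allI impI)
  show "locally_integrable G" "locally_integrable g"
    using bounded_borel_locally_integrable G g GB gB by blast+
  fix \<phi> assume t: "test_function \<phi>"
  obtain M where M: "\<And>p. \<bar>\<phi> p\<bar> \<le> M" using test_function_bounded[OF t] by metis
  obtain M' where M': "\<And>p. \<bar>dy \<phi> p\<bar> \<le> M'" using test_function_bounded[OF test_function_dy[OF t]] by metis
  have [measurable]: "\<phi> \<in> borel_measurable borel" "dy \<phi> \<in> borel_measurable borel"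
    using t test_function_dy test_function_borel by auto
  have bd: "\<bar>G p * dy \<phi> p\<bar> \<le> B * M'" "\<bar>g p * \<phi> p\<bar> \<le> B * M" if "p \<in> Lam" for p
    using GB[OF that] gB[OF that] M[of p] M'[of p] by (auto simp: abs_mult intro!: mult_mono)
  have i: "integrable LL (\<lambda>p. G p * dy \<phi> p)" "integrable LL (\<lambda>p. g p * \<phi> p)"
    by (rule LL_bounded_integrable[OF _ bd(1)], measurable) (rule LL_bounded_integrable[OF _ bd(2)],
        measurable)
  have "(LINT p|LL. G p * dy \<phi> p + g p * \<phi> p) = (LINT x|NI. LINT y|NI. G (x, y) * dy \<phi> (x, y)
      + g (x, y) * \<phi> (x, y))"
    using i by (intro LL_Fubini(1)) auto
  also have "\<dots> = (LINT x|NI. 0)"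
  proof (rule integral_cong_AE)
    show "AE x in NI. (LINT y|NI. G (x, y) * dy \<phi> (x, y) + g (x, y) * \<phi> (x, y)) = 0"
      using AE_NI_interval
    proof eventually_elim
      case (elim x)
      have "(LINT y|NI. G (x, y) * dy \<phi> (x, y) + g (x, y) * \<phi> (x, y)) = G (x, 1) * \<phi> (x, 1)
          - G (x, -1) * \<phi> (x, -1)"
      proof (rule FTC_NI[OF _ _ S])
        show "\<bar>G (x, y) * dy \<phi> (x, y) + g (x, y) * \<phi> (x, y)\<bar> \<le> B * M' + B * M" if "y \<in> {-1..1}" for y
          using bd[of "(x, y)"] that elim by (auto simp: Lam_def)
        have "continuous_on UNIV (\<lambda>y. \<phi> (x, y))"
          by (intro continuous_at_imp_continuous_on ballI DERIV_isCont[OF smooth2_has_dy[OF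
              test_function_smooth2[OF t]]])
        then show "continuous_on {-1..1} (\<lambda>y. G (x, y) * \<phi> (x, y))"
          using cont[OF elim] by (intro continuous_on_mult) (auto intro: continuous_on_subset)
        show "((\<lambda>y. G (x, y) * \<phi> (x, y)) has_real_derivative G (x, y) * dy \<phi> (x, y) + g (x, y)
            * \<phi> (x, y)) (at y)"
          if "-1 < y" "y < 1" "y \<notin> S" for y
          using DERIV_mult[OF deriv[OF elim that] smooth2_has_dy[OF test_function_smooth2[OF t]]]
          by (simp add: algebra_simps)
      qed measurable
      also have "\<dots> = 0"
        using test_function_outside[OF t, of "(x, 1)"] test_function_outside[OF t, of "(x, -1)"]
        by (simp add: interior_Lam)
      finally show ?case .
    qed
  qed measurable
  finally have "(LINT p|LL. G p * dy \<phi> p) = - (LINT p|LL. g p * \<phi> p)"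
    using i by simp
  moreover have "(LINT p|lebesgue_on Lam. G p * dy \<phi> p) = (LINT p|LL. G p * dy \<phi> p)"
    "(LINT p|lebesgue_on Lam. g p * \<phi> p) = (LINT p|LL. g p * \<phi> p)"
    by (rule integral_LL; measurable)+
  ultimately show "(LINT p|lebesgue_on Lam. G p * classical_deriv (0, Suc 0) \<phi> p) =
      (-1) ^ mi_order (0, Suc 0) * (LINT p|lebesgue_on Lam. g p * \<phi> p)"
    by (simp add: test_function_dx_dy[OF t] mi_order_def)
qed

section \<open>Averaging kernels\<close>

lemma fst_LL: "fst \<in> borel_measurable LL" and snd_LL: "snd \<in> borel_measurable LL"
  unfolding LL_def by measurable

lemma AE_LL_neq: "AE q in LL. fst q \<noteq> c \<and> snd q \<noteq> d"
  unfolding LL_def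
proof (rule NN.AE_pair_measure)
  show "{q \<in> space (NI \<Otimes>\<^sub>M NI). fst q \<noteq> c \<and> snd q \<noteq> d} \<in> sets (NI \<Otimes>\<^sub>M NI)"
    by measurable
  show "AE x in NI. AE y in NI. fst (x, y) \<noteq> c \<and> snd (x, y) \<noteq> d"
    using AE_NI_neq[of c] by eventually_elim (use AE_NI_neq[of d] in simp)
qed

lemma antiderivative_UNIV:
  fixes f :: "real \<Rightarrow> real"
  assumes "continuous_on UNIV f" obtains F where "\<And>x. (F has_real_derivative f x) (at x)"
proof -
  have "\<exists>F. \<forall>x::real. -\<infinity> < ereal x \<longrightarrow> ereal x < \<infinity> \<longrightarrow> (F has_vector_derivative f x) (at x)"
    by (rule einterval_antiderivative) (use assms in \<open>auto simp: continuous_on_eq_continuous_at\<close>)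
  then show thesis
    using that by (auto simp: has_real_derivative_iff_has_vector_derivative)
qed

text \<open>The primitive \<open>P\<close> of the weight \<open>\<rho>\<close> enters the kernel \<open>k x s = [s \<le> x] - \<integral>\<^sub>s\<^sup>1 \<rho>\<close>,
  for which \<open>f x = \<integral> \<rho> f + \<integral> k x s f' s ds\<close>.\<close>

locale averaging =
  fixes \<rho> P :: "real \<Rightarrow> real" and B :: real
  assumes rho_test: "test1 \<rho>"
    and P_deriv: "\<And>x. (P has_real_derivative \<rho> x) (at x)"
    and P_ends: "P (-1) = 0" "P 1 = 1"
    and rho_nonneg: "\<And>x. 0 \<le> \<rho> x"
    and rho_le: "\<And>x. \<rho> x \<le> B"
    and B_ge: "1 \<le> B"

lemma test1_bounded:
  assumes "test1 a" obtains B where "\<And>x. \<bar>a x\<bar> \<le> B"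
proof -
  have "bounded (a ` {-1..1})"
    using test1_continuous[OF assms]
    by (intro compact_imp_bounded compact_continuous_image) (auto intro: continuous_on_subset)
  then obtain B where B: "\<And>x. x \<in> {-1..1} \<Longrightarrow> \<bar>a x\<bar> \<le> B"
    unfolding bounded_iff by (metis imageI real_norm_def)
  have "\<bar>a x\<bar> \<le> max B 0" for x
    using B[of x] test1_outside[OF assms, of x] by (cases "x \<in> {-1..1}") (auto simp: le_max_iff_disj)
  then show thesis by (rule that)
qed

lemma test1_scale: "test1 a \<Longrightarrow> test1 (\<lambda>x. a x * c)"
  unfolding test1_def using Ck1_mult[OF _ Ck1_const] by (metis mult_zero_left)

text \<open>The weight is a bump on (-1/2, 1/2) divided by its integral, which is positive because
  the bump is positive on [-1/4, 1/4]. The bound \<open>max 1 ?c\<close> works because the bump is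
  at most one.\<close>

lemma averaging_exists: "\<exists>\<rho> P B. averaging \<rho> P B"
proof -
  let ?g = "plateau (-1/2) (1/2) 1"
  have g: "test1 ?g" by (rule test1_plateau) auto
  obtain G where G: "\<And>x. (G has_real_derivative ?g x) (at x)"
    using antiderivative_UNIV[OF test1_continuous[OF g]] by metis
  have mono: "G x \<le> G y" if "x \<le> y" for x y
    using that G plateau_bounds(1) by (intro DERIV_nonneg_imp_nondecreasing[of x y G]) blast+
  have dpos: "\<exists>y. (G has_real_derivative y) (at x) \<and> y > 0" if "-1/4 \<le> x" "x \<le> 1/4" for x
  proof -
    have "?g x > 0" using that by (simp add: plateau_def flat_def)
    then show ?thesis using G by blast
  qed
  have "G (-1/4) < G (1/4)"
    by (rule DERIV_pos_imp_increasing[OF _ dpos]) simp_all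
  then have pos: "G 1 - G (-1) > 0"
    using mono[of "-1" "-1/4"] mono[of "1/4" 1] by simp
  let ?c = "1 / (G 1 - G (-1))"
  have "averaging (\<lambda>x. ?g x * ?c) (\<lambda>x. (G x - G (-1)) * ?c) (max 1 ?c)"
  proof
    show "test1 (\<lambda>x. ?g x * ?c)" by (rule test1_scale[OF g])
    show "((\<lambda>x. (G x - G (-1)) * ?c) has_real_derivative ?g x * ?c) (at x)" for x
      using DERIV_cmult_right[OF DERIV_diff[OF G[of x] DERIV_const[of "G (-1)"]], of ?c] by simp
    show "?g x * ?c \<le> max 1 ?c" for x
      using plateau_bounds(2)[of "-1/2" "1/2" 1 x] pos mult_right_mono[of "?g x" 1 ?c]
      by (simp add: le_max_iff_disj)
  qed (use pos plateau_bounds(1) in auto)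
  then show ?thesis by blast
qed

lemma AE_LL_snd:
  assumes "AE y in NI. Q y" shows "AE p in LL. Q (snd p)"
proof -
  \<comment> \<open>\<open>Q\<close> need not define a measurable set, so the exceptional set is
    enlarged to a measurable null set before the product is formed.\<close>
  from assms obtain N where N: "{y \<in> space NI. \<not> Q y} \<subseteq> N" "N \<in> sets NI" "emeasure NI N = 0"
    by (rule AE_E) 
  have "AE p in LL. snd p \<notin> N"
    unfolding LL_def
  proof (rule NN.AE_pair_measure)
    show "{q \<in> space (NI \<Otimes>\<^sub>M NI). snd q \<notin> N} \<in> sets (NI \<Otimes>\<^sub>M NI)"
      using N(2) by measurable
    have "AE y in NI. y \<notin> N" using N by (intro AE_not_in) auto
    then show "AE x in NI. AE y in NI. snd (x, y) \<notin> N" by simp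
  qed
  then show ?thesis by eventually_elim (use N(1) in auto)
qed

lemma LL_integrable_snd:
  fixes h :: "real \<Rightarrow> real"
  assumes "integrable NI h" shows "integrable LL (\<lambda>p. h (snd p))"
proof -
  note [measurable] = borel_measurable_integrable[OF assms]
  show ?thesis
    unfolding LL_def
  proof (rule NN.Fubini_integrable)
    show "integrable NI (\<lambda>x. LINT y|NI. norm (h (snd (x, y))))" by simp
  qed (use assms in auto)
qed

lemma slice_integrable:
  fixes g :: "real \<times> real \<Rightarrow> real"
  assumes "integrable LL g"
  shows "AE y in NI. integrable NI (\<lambda>s. g (s, y))" "integrable NI (\<lambda>y. LINT s|NI. g (s, y))"
  using NN.AE_integrable_snd[of "\<lambda>x y. g (x, y)"] NN.integrable_snd[of "\<lambda>x y. g (x, y)"] assms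
  by (auto simp: LL_def)

text \<open>Cauchy-Schwarz against the constant 1, obtained from the nonnegativity of the variance.
  The factor is the total mass: 2 here, 4 in the version on the square.\<close>

lemma NI_integral_square_le:
  fixes h :: "real \<Rightarrow> real"
  assumes h: "integrable NI h" and h2: "integrable NI (\<lambda>x. (h x)\<^sup>2)"
  shows "(LINT x|NI. h x)\<^sup>2 \<le> 2 * (LINT x|NI. (h x)\<^sup>2)"
proof -
  define m where "m = (LINT x|NI. h x) / 2"
  have "0 \<le> (LINT x|NI. (h x - m)\<^sup>2)" by simp
  also have "\<dots> = (LINT x|NI. (h x)\<^sup>2 - 2 * m * h x + m\<^sup>2)"
    by (intro Bochner_Integration.integral_cong) (auto simp: power2_eq_square algebra_simps)
  also have "\<dots> = (LINT x|NI. (h x)\<^sup>2) - 2 * m * (2 * m) + 2 * m\<^sup>2"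
    using h h2 by (simp add: m_def)
  finally show ?thesis by (simp add: m_def power2_eq_square)
qed

lemma LL_integral_square_le:
  fixes h :: "real \<times> real \<Rightarrow> real"
  assumes h: "integrable LL h" and h2: "integrable LL (\<lambda>x. (h x)\<^sup>2)"
  shows "(LINT x|LL. h x)\<^sup>2 \<le> 4 * (LINT x|LL. (h x)\<^sup>2)"
proof -
  define m where "m = (LINT x|LL. h x) / 4"
  have "0 \<le> (LINT x|LL. (h x - m)\<^sup>2)" by simp
  also have "\<dots> = (LINT x|LL. (h x)\<^sup>2 - 2 * m * h x + m\<^sup>2)"
    by (intro Bochner_Integration.integral_cong) (auto simp: power2_eq_square algebra_simps)
  also have "\<dots> = (LINT x|LL. (h x)\<^sup>2) - 2 * m * (4 * m) + 4 * m\<^sup>2"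
    using h h2 by (simp add: m_def)
  finally show ?thesis by (simp add: m_def power2_eq_square)
qed

context averaging
begin

definition k :: "real \<Rightarrow> real \<Rightarrow> real" where
  "k x s = (if s \<le> x then 1 else 0) - 1 + P s"

text \<open>Viewing the weight as a kernel that ignores its first argument makes averaging and
  integration against \<open>k\<close> instances of the same operators.\<close>

abbreviation r :: "real \<Rightarrow> real \<Rightarrow> real" where
  "r x s \<equiv> \<rho> s"

text \<open>These are the ingredients of dominated convergence: measurability, a uniform bound, and
  continuity in the first argument off the diagonal. One bound serves both kernels because
  \<open>\<bar>k x s\<bar> \<le> 1 \<le> B\<close> on the interval.\<close>

definition kernel :: "(real \<Rightarrow> real \<Rightarrow> real) \<Rightarrow> bool" where
  "kernel \<kappa> \<longleftrightarrow> (\<lambda>p. \<kappa> (fst p) (snd p)) \<in> borel_measurable borel \<and>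
     (\<forall>x s. s \<in> {-1..1} \<longrightarrow> \<bar>\<kappa> x s\<bar> \<le> B) \<and> (\<forall>x s. s \<noteq> x \<longrightarrow> isCont (\<lambda>x. \<kappa> x s) x)"

lemma kernelD:
  assumes "kernel \<kappa>"
  shows "(\<lambda>p. \<kappa> (fst p) (snd p)) \<in> borel_measurable borel"
    "s \<in> {-1..1} \<Longrightarrow> \<bar>\<kappa> x s\<bar> \<le> B" "s \<noteq> x \<Longrightarrow> isCont (\<lambda>x. \<kappa> x s) x"
  using assms by (auto simp: kernel_def)

lemma kernel_measurable:
  assumes "kernel \<kappa>" and [measurable]: "f \<in> borel_measurable M" "g \<in> borel_measurable M"
  shows "(\<lambda>x. \<kappa> (f x) (g x)) \<in> borel_measurable M"
proof -
  have "(\<lambda>x. (f x, g x)) \<in> M \<rightarrow>\<^sub>M borel" by measurable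
  from measurable_compose[OF this kernelD(1)[OF assms(1)]] show ?thesis by simp
qed

lemma rho_borel [measurable]: "\<rho> \<in> borel_measurable borel"
  using test1_continuous[OF rho_test] by (rule borel_measurable_continuous_onI)

lemma P_continuous: "continuous_on UNIV P"
  using P_deriv DERIV_isCont by (blast intro: continuous_at_imp_continuous_on)

lemma P_borel [measurable]: "P \<in> borel_measurable borel"
  by (rule borel_measurable_continuous_onI[OF P_continuous])

lemma P_bounds: "s \<in> {-1..1} \<Longrightarrow> 0 \<le> P s \<and> P s \<le> 1"
proof -
  have "P x \<le> P y" if "x \<le> y" for x y
    using that P_deriv rho_nonneg by (intro DERIV_nonneg_imp_nondecreasing[of x y P]) blast+
  from this[of "-1" s] this[of s 1] show "s \<in> {-1..1} \<Longrightarrow> 0 \<le> P s \<and> P s \<le> 1"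
    by (auto simp: P_ends)
qed

lemma kernel_r: "kernel r"
  unfolding kernel_def
proof (intro conjI allI impI)
  show "(\<lambda>p::real \<times> real. \<rho> (snd p)) \<in> borel_measurable borel"
    unfolding borel_prod[symmetric] by measurable
qed (use rho_nonneg rho_le in \<open>simp_all add: abs_of_nonneg\<close>)

lemma kernel_k: "kernel k"
  unfolding kernel_def
proof (intro conjI allI impI)
  show "(\<lambda>p. k (fst p) (snd p)) \<in> borel_measurable borel"
    unfolding k_def borel_prod[symmetric] by measurable
  show "\<bar>k x s\<bar> \<le> B" if "s \<in> {-1..1}" for x s
    using P_bounds[OF that] B_ge by (auto simp: k_def)
  show "isCont (\<lambda>x. k x s) x" if elim: "s \<noteq> x" for x s
  proof -
    have "((\<lambda>x. k x s) has_real_derivative 0) (at x)"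
    proof (cases "s < x")
      case True
      show ?thesis
        by (rule has_field_derivative_transform_within_open[of "\<lambda>x. P s" 0 x "{s<..}"])
          (use True in \<open>auto simp: k_def\<close>)
    next
      case False
      with elim have "x < s" by simp
      then show ?thesis
        by (intro has_field_derivative_transform_within_open[OF DERIV_const[of "P s - 1"], where
            S="{..<s}"])
          (simp_all add: k_def)
    qed
    then show ?thesis by (rule DERIV_isCont)
  qed
qed

text \<open>Integrating a test function against the kernel gives again a test function; this is what
  allows the kernels to be moved onto the test functions.\<close>

lemma kernel_test:
  assumes t: "test1 \<theta>"
  obtains a A where "test1 a" "\<And>x. \<theta> x = A * \<rho> x - deriv a x"
    "\<And>s. s \<in> {-1..1} \<Longrightarrow> (LINT x|NI. k x s * \<theta> x) = a s"
    "\<And>s. (LINT x|NI. r x s * \<theta> x) = A * \<rho> s"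
proof -
  obtain T where T: "\<And>x. (T has_real_derivative \<theta> x) (at x)"
    using antiderivative_UNIV[OF test1_continuous[OF t]] by metis
  have Tc: "continuous_on S T" for S
    by (meson T DERIV_isCont continuous_at_imp_continuous_on)
  have tb [measurable]: "\<theta> \<in> borel_measurable borel"
    using test1_continuous[OF t] by (rule borel_measurable_continuous_onI)
  obtain M where M: "\<And>x. \<bar>\<theta> x\<bar> \<le> M" using test1_bounded[OF t] by metis
  define A where "A = T 1 - T (-1)"
  \<comment> \<open>This is the integral of \<open>\<theta> - A * \<rho>\<close> from
    \<open>s\<close> to 1. Removing the mass \<open>A\<close> makes it vanish to the left of the
    supports as well as to the right.\<close>
  define a where "a s = (T 1 - T s) - A * (1 - P s)" for s
  have A: "(LINT x|NI. \<theta> x) = A"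
    unfolding A_def by (rule FTC_NI[of _ M "{}"]) (use M T Tc in auto)
  have da: "(a has_real_derivative A * \<rho> x - \<theta> x) (at x)" for x
    unfolding a_def by (auto intro!: derivative_eq_intros T P_deriv)
  obtain q where q: "0 < q" "q < 1" "\<And>x. q < \<bar>x\<bar> \<Longrightarrow> \<theta> x = 0" "\<And>x. q < \<bar>x\<bar> \<Longrightarrow> \<rho> x = 0"
    using test1_bounds[OF t rho_test] by metis
  have const: "a x = a y" if "\<And>z. x \<le> z \<Longrightarrow> z \<le> y \<Longrightarrow> q < \<bar>z\<bar>" "x \<le> y" for x y
  proof (cases "x = y")
    case False
    have "a y = a x"
      by (rule DERIV_isconst_end[of x y a])
        (use False that in simp, use da DERIV_isCont in \<open>blast intro: continuous_at_imp_continuous_on\<close>,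
          use da[of _] q(3,4) that(1) in \<open>metis diff_zero less_imp_le mult_zero_right\<close>)
    then show ?thesis by simp
  qed simp
  have a0: "a x = 0" if "q < \<bar>x\<bar>" for x
  proof (cases "x > 0")
    case True
    have "a x = a (max x 1)" "a 1 = a (max x 1)"
      by (rule const; use that True q in auto)+
    then show ?thesis by (simp add: a_def P_ends)
  next
    case False
    have "a (min x (-1)) = a x" "a (min x (-1)) = a (-1)"
      by (rule const; use that False q in auto)+
    then show ?thesis by (simp add: a_def P_ends A_def)
  qed
  have "Ck1 n a" for n
  proof -
    have "Ck1 n (\<lambda>x. \<rho> x * A + \<theta> x * (-1))"
      by (intro Ck1_add Ck1_mult Ck1_const test1_Ck1 t rho_test)
    then have "Ck1 (Suc n) a"
      using da unfolding Ck1.simps by (intro exI[of _ "\<lambda>x. A * \<rho> x - \<theta> x"]) (simp add: mult.commute)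
    then show ?thesis by (rule Ck1_SucD)
  qed
  then have "test1 a" unfolding test1_def using q a0 by blast
  moreover have "\<theta> x = A * \<rho> x - deriv a x" for x
    using DERIV_imp_deriv[OF da] by simp
  moreover have "(LINT x|NI. k x s * \<theta> x) = a s" if s: "s \<in> {-1..1}" for s
  proof -
    \<comment> \<open>Freezing the antiderivative below \<open>s\<close> yields a continuous
      primitive of the truncated integrand, with a single kink at \<open>s\<close>.\<close>
    have i1: "(LINT x|NI. (if s \<le> x then 1 else 0) * \<theta> x) = T (max s 1) - T (max s (-1))"
    proof (rule FTC_NI[of _ M "{s}"])
      show "\<bar>(if s \<le> x then 1 else 0) * \<theta> x\<bar> \<le> M" for x
        using M[of x] by auto
      show "continuous_on {-1..1} (\<lambda>x. T (max s x))"
        by (intro continuous_on_compose2[OF Tc[of UNIV]] continuous_intros) auto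
      show "((\<lambda>x. T (max s x)) has_real_derivative (if s \<le> x then 1 else 0) * \<theta> x) (at x)"
          if "x \<notin> {s}" for x
      proof (cases "s < x")
        case True
        show ?thesis
          by (rule has_field_derivative_transform_within_open[of T _ _ "{s<..}"]) (use True T in auto)
      next
        case False
        show ?thesis
          by (rule has_field_derivative_transform_within_open[of "\<lambda>x. T s" _ _ "{..<s}"])
              (use False that in auto)
      qed
    qed auto
    have ii: "integrable NI (\<lambda>x. (if s \<le> x then 1 else 0) * \<theta> x)" "integrable NI \<theta>"
      by (rule NI_bounded_integrable[where B=M]; use M in \<open>auto intro: order_trans[OF abs_ge_zero M]\<close>)+
    have "(LINT x|NI. k x s * \<theta> x) = (LINT x|NI. (if s \<le> x then 1 else 0) * \<theta> x + (P s - 1) * \<theta> x)"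
      by (intro Bochner_Integration.integral_cong) (auto simp: k_def algebra_simps)
    also have "\<dots> = (T 1 - T s) + (P s - 1) * A"
      using ii i1 A s by (subst Bochner_Integration.integral_add) (auto simp: max_def)
    finally show ?thesis by (simp add: a_def algebra_simps)
  qed
  moreover have "(LINT x|NI. r x s * \<theta> x) = A * \<rho> s" for s
    using A by simp
  ultimately show thesis by (rule that)
qed

text \<open>Integrating in both variables yields values that depend continuously on the point even
  for merely integrable \<open>g\<close>. The companion \<open>T1\<close> integrates in x only; it
  gives L2 control and does without the mixed derivative.\<close>

definition T2 :: "(real \<Rightarrow> real \<Rightarrow> real) \<Rightarrow> (real \<Rightarrow> real \<Rightarrow> real) \<Rightarrow> (real \<times> real \<Rightarrow> real) \<Rightarrow> real \<times> real \<Rightarrow>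
    real" where
  "T2 \<kappa> \<kappa>' g p = (LINT q|LL. \<kappa> (fst p) (fst q) * \<kappa>' (snd p) (snd q) * g q)"

definition T1 :: "(real \<Rightarrow> real \<Rightarrow> real) \<Rightarrow> (real \<times> real \<Rightarrow> real) \<Rightarrow> real \<times> real \<Rightarrow> real" where
  "T1 \<kappa> g p = (LINT s|NI. \<kappa> (fst p) s * g (s, snd p))"

lemma kernel_prod_le:
  assumes "kernel \<kappa>" "kernel \<kappa>'" "q \<in> Lam"
  shows "\<bar>\<kappa> x (fst q) * \<kappa>' y (snd q) * c\<bar> \<le> B\<^sup>2 * \<bar>c\<bar>"
proof -
  have "\<bar>\<kappa> x (fst q)\<bar> \<le> B" "\<bar>\<kappa>' y (snd q)\<bar> \<le> B"
    using kernelD(2)[OF assms(1)] kernelD(2)[OF assms(2)] assms(3) by (auto simp: Lam_def)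
  then have "\<bar>\<kappa> x (fst q)\<bar> * \<bar>\<kappa>' y (snd q)\<bar> * \<bar>c\<bar> \<le> B * B * \<bar>c\<bar>"
    using B_ge by (intro mult_mono) auto
  then show ?thesis by (simp add: abs_mult power2_eq_square)
qed

lemma T2_integrable:
  assumes \<kappa>: "kernel \<kappa>" "kernel \<kappa>'" and g: "integrable LL g"
  shows "integrable LL (\<lambda>q. \<kappa> x (fst q) * \<kappa>' y (snd q) * g q)"
proof (rule Bochner_Integration.integrable_bound)
  show "integrable LL (\<lambda>q. B\<^sup>2 * \<bar>g q\<bar>)" using g by auto
  show "(\<lambda>q. \<kappa> x (fst q) * \<kappa>' y (snd q) * g q) \<in> borel_measurable LL"
    by (intro borel_measurable_times kernel_measurable[OF \<kappa>(1)] kernel_measurable[OF \<kappa>(2)]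
        borel_measurable_integrable[OF g] fst_LL snd_LL borel_measurable_const)
  show "AE q in LL. norm (\<kappa> x (fst q) * \<kappa>' y (snd q) * g q) \<le> norm (B\<^sup>2 * \<bar>g q\<bar>)"
    using AE_LL_Lam
  proof eventually_elim
    case (elim q)
    then show ?case using kernel_prod_le[OF \<kappa> elim, of x y "g q"] by simp
  qed
qed

lemma T2_bound:
  assumes \<kappa>: "kernel \<kappa>" "kernel \<kappa>'" and g: "integrable LL g"
  shows "\<bar>T2 \<kappa> \<kappa>' g p\<bar> \<le> B\<^sup>2 * (LINT q|LL. \<bar>g q\<bar>)"
proof -
  have "\<bar>T2 \<kappa> \<kappa>' g p\<bar> \<le> (LINT q|LL. \<bar>\<kappa> (fst p) (fst q) * \<kappa>' (snd p) (snd q) * g q\<bar>)"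
    unfolding T2_def by (rule integral_abs_bound)
  also have "\<dots> \<le> (LINT q|LL. B\<^sup>2 * \<bar>g q\<bar>)"
  proof (rule integral_mono_AE)
    show "AE q in LL. \<bar>\<kappa> (fst p) (fst q) * \<kappa>' (snd p) (snd q) * g q\<bar> \<le> B\<^sup>2 * \<bar>g q\<bar>"
      using AE_LL_Lam by eventually_elim (rule kernel_prod_le[OF \<kappa>])
  qed (use T2_integrable[OF \<kappa> g] g in auto)
  finally show ?thesis by simp
qed

text \<open>The kernels may jump only on the two coordinate lines through the limit point, a null
  set, and \<open>B\<^sup>2 * \<bar>g q\<bar>\<close> dominates.\<close>

lemma T2_continuous:
  assumes \<kappa>: "kernel \<kappa>" "kernel \<kappa>'" and g: "integrable LL g"
  shows "continuous_on UNIV (T2 \<kappa> \<kappa>' g)"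
proof (rule continuous_on_sequentiallyI)
  fix u :: "nat \<Rightarrow> real \<times> real" and a assume u: "u \<longlonglongrightarrow> a"
  show "(\<lambda>n. T2 \<kappa> \<kappa>' g (u n)) \<longlonglongrightarrow> T2 \<kappa> \<kappa>' g a"
    unfolding T2_def
  proof (rule integral_dominated_convergence[where w="\<lambda>q. B\<^sup>2 * \<bar>g q\<bar>"])
    show "AE q in LL. (\<lambda>n. \<kappa> (fst (u n)) (fst q) * \<kappa>' (snd (u n)) (snd q) * g q) \<longlonglongrightarrow> \<kappa> (fst a) (fst q)
        * \<kappa>' (snd a) (snd q) * g q"
      using AE_LL_neq[of "fst a" "snd a"]
    proof eventually_elim
      case (elim q)
      then show ?case
        by (intro tendsto_intros isCont_tendsto_compose[OF kernelD(3)[OF \<kappa>(1)]]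
            isCont_tendsto_compose[OF kernelD(3)[OF \<kappa>(2)]] tendsto_fst tendsto_snd u) auto
    qed
    show "AE q in LL. norm (\<kappa> (fst (u n)) (fst q) * \<kappa>' (snd (u n)) (snd q) * g q) \<le> B\<^sup>2 * \<bar>g q\<bar>" for n
      using AE_LL_Lam by eventually_elim (use kernel_prod_le[OF \<kappa>] in simp)
  qed (use T2_integrable[OF \<kappa> g] g in auto)
qed

lemma T1_slice_integrable:
  assumes \<kappa>: "kernel \<kappa>" and g: "integrable NI (\<lambda>s. g (s, y))"
  shows "integrable NI (\<lambda>s. \<kappa> x s * g (s, y))"
proof (rule Bochner_Integration.integrable_bound)
  show "integrable NI (\<lambda>s. B * \<bar>g (s, y)\<bar>)" using g by auto
  show "(\<lambda>s. \<kappa> x s * g (s, y)) \<in> borel_measurable NI"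
    by (intro borel_measurable_times kernel_measurable[OF \<kappa>] borel_measurable_integrable[OF g])
      simp_all
  show "AE s in NI. norm (\<kappa> x s * g (s, y)) \<le> norm (B * \<bar>g (s, y)\<bar>)"
    using AE_NI_interval
  proof eventually_elim
    case (elim s)
    then show ?case using kernelD(2)[OF \<kappa> elim, of x] B_ge by (simp add: abs_mult mult_right_mono)
  qed
qed

lemma T1_borel:
  assumes \<kappa>: "kernel \<kappa>" and [measurable]: "g \<in> borel_measurable borel"
  shows "T1 \<kappa> g \<in> borel_measurable borel"
proof -
  have "(\<lambda>q. \<kappa> (fst (fst q)) (snd q) * g (snd q, snd (fst q))) \<in> borel_measurable (borel \<Otimes>\<^sub>M NI)"
    by (intro borel_measurable_times kernel_measurable[OF \<kappa>]; unfold borel_prod[symmetric], measurable)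
  then show ?thesis
    unfolding T1_def[abs_def]
    by (intro NI.borel_measurable_lebesgue_integral) (simp add: case_prod_beta)
qed

lemma T1_abs_le:
  assumes \<kappa>: "kernel \<kappa>" and g: "integrable NI (\<lambda>s. g (s, y))"
  shows "\<bar>T1 \<kappa> g (x, y)\<bar> \<le> B * (LINT s|NI. \<bar>g (s, y)\<bar>)"
proof -
  have "\<bar>T1 \<kappa> g (x, y)\<bar> \<le> (LINT s|NI. \<bar>\<kappa> x s * g (s, y)\<bar>)"
    unfolding T1_def fst_conv snd_conv by (rule integral_abs_bound)
  also have "\<dots> \<le> (LINT s|NI. B * \<bar>g (s, y)\<bar>)"
  proof (rule integral_mono_AE)
    show "AE s in NI. \<bar>\<kappa> x s * g (s, y)\<bar> \<le> B * \<bar>g (s, y)\<bar>"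
      using AE_NI_interval
    proof eventually_elim
      case (elim s)
      then show ?case using kernelD(2)[OF \<kappa> elim, of x] by (simp add: abs_mult mult_right_mono)
    qed
  qed (use T1_slice_integrable[of \<kappa> g y x, OF \<kappa> g] g in auto)
  finally show ?thesis by simp
qed

lemma T1_integrable:
  assumes \<kappa>: "kernel \<kappa>" and g: "integrable LL g" and gb: "g \<in> borel_measurable borel"
  shows "integrable LL (T1 \<kappa> g)"
proof (rule Bochner_Integration.integrable_bound)
  have "integrable NI (\<lambda>y. B * (LINT s|NI. \<bar>g (s, y)\<bar>))"
    using slice_integrable(2)[OF integrable_abs[OF g]] by simp
  then show "integrable LL (\<lambda>p. B * (LINT s|NI. \<bar>g (s, snd p)\<bar>))"
    by (rule LL_integrable_snd)
  show "T1 \<kappa> g \<in> borel_measurable LL" using T1_borel[OF \<kappa> gb] by simp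
  show "AE p in LL. norm (T1 \<kappa> g p) \<le> norm (B * (LINT s|NI. \<bar>g (s, snd p)\<bar>))"
    using AE_LL_snd[OF slice_integrable(1)[OF g]]
  proof eventually_elim
    case (elim p)
    have "\<bar>T1 \<kappa> g (fst p, snd p)\<bar> \<le> B * (LINT s|NI. \<bar>g (s, snd p)\<bar>)"
      by (rule T1_abs_le[OF \<kappa> elim])
    then show ?case by simp
  qed
qed

text \<open>Of the factor 4, one 2 is Cauchy-Schwarz on a slice; the other is the length of the
  x-interval, over which the resulting bound is constant.\<close>

lemma T1_square:
  assumes \<kappa>: "kernel \<kappa>" and g: "integrable LL g" and gb [measurable]: "g \<in> borel_measurable borel"
    and g2: "integrable LL (\<lambda>p. (g p)\<^sup>2)"
  shows "integrable LL (\<lambda>p. (T1 \<kappa> g p)\<^sup>2)"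
    and "(LINT p|LL. (T1 \<kappa> g p)\<^sup>2) \<le> 4 * B\<^sup>2 * (LINT p|LL. (g p)\<^sup>2)"
proof -
  let ?G = "\<lambda>y. 2 * B\<^sup>2 * (LINT s|NI. (g (s, y))\<^sup>2)"
  have G: "integrable NI ?G"
    using slice_integrable(2)[OF g2] by simp
  have le: "AE p in LL. (T1 \<kappa> g p)\<^sup>2 \<le> ?G (snd p)"
    using AE_LL_snd[OF slice_integrable(1)[OF g]] AE_LL_snd[OF slice_integrable(1)[OF g2]]
  proof eventually_elim
    case (elim p)
    have "\<bar>T1 \<kappa> g (fst p, snd p)\<bar> \<le> B * (LINT s|NI. \<bar>g (s, snd p)\<bar>)"
      by (rule T1_abs_le[OF \<kappa> elim(1)])
    then have "(T1 \<kappa> g p)\<^sup>2 \<le> (B * (LINT s|NI. \<bar>g (s, snd p)\<bar>))\<^sup>2"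
      by (metis power2_abs power_mono abs_ge_zero prod.collapse)
    also have "\<dots> \<le> B\<^sup>2 * (2 * (LINT s|NI. \<bar>g (s, snd p)\<bar>\<^sup>2))"
      unfolding power_mult_distrib using elim
      by (intro mult_left_mono NI_integral_square_le) auto
    finally show ?case by simp
  qed
  have T [measurable]: "T1 \<kappa> g \<in> borel_measurable borel" by (rule T1_borel[OF \<kappa> gb])
  show i: "integrable LL (\<lambda>p. (T1 \<kappa> g p)\<^sup>2)"
  proof (rule Bochner_Integration.integrable_bound[OF LL_integrable_snd[OF G]])
    show "AE p in LL. norm ((T1 \<kappa> g p)\<^sup>2) \<le> norm (?G (snd p))"
      using le by eventually_elim simp
  qed measurable
  have "(LINT p|LL. (T1 \<kappa> g p)\<^sup>2) \<le> (LINT p|LL. ?G (snd p))"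
    by (rule integral_mono_AE[OF i LL_integrable_snd[OF G] le])
  also have "\<dots> = (LINT x|NI. LINT y|NI. ?G y)"
    using LL_Fubini(1)[OF LL_integrable_snd[OF G]] by simp
  also have "\<dots> = 2 * (2 * B\<^sup>2 * (LINT y|NI. LINT s|NI. (g (s, y))\<^sup>2))"
    by simp
  also have "(LINT y|NI. LINT s|NI. (g (s, y))\<^sup>2) = (LINT p|LL. (g p)\<^sup>2)"
    using LL_Fubini(2)[OF g2] by simp
  finally show "(LINT p|LL. (T1 \<kappa> g p)\<^sup>2) \<le> 4 * B\<^sup>2 * (LINT p|LL. (g p)\<^sup>2)"
    by simp
qed

end

section \<open>Integral representations\<close>

text \<open>The action of \<open>f\<close> as a distribution on a product test function. With
  \<open>\<rho>\<close> in both slots it is the weighted mean that will be normalised to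
  zero.\<close>

definition pairing :: "(real \<times> real \<Rightarrow> real) \<Rightarrow> (real \<Rightarrow> real) \<Rightarrow> (real \<Rightarrow> real) \<Rightarrow> real" where
  "pairing f a b = (LINT p|LL. f p * tensor a b p)"

lemma test1_borel: "test1 a \<Longrightarrow> a \<in> borel_measurable borel"
  using test1_continuous by (rule borel_measurable_continuous_onI)

lemma tensor_bounded:
  assumes "test1 a" "test1 b" obtains M where "\<And>p. \<bar>tensor a b p\<bar> \<le> M"
  using test_function_bounded[OF test_tensor[OF assms]] by metis

lemma integrable_tensor:
  assumes f: "integrable LL f" and ab: "test1 a" "test1 b"
  shows "integrable LL (\<lambda>p. f p * tensor a b p)"
proof -
  obtain M where M: "\<And>p. \<bar>tensor a b p\<bar> \<le> M" using tensor_bounded[OF ab] by metis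
  show ?thesis
  proof (rule Bochner_Integration.integrable_bound)
    show "integrable LL (\<lambda>p. f p * M)" using f by simp
    show "(\<lambda>p. f p * tensor a b p) \<in> borel_measurable LL"
      using tensor_borel[OF ab] f by (intro borel_measurable_times) auto
    show "AE p in LL. norm (f p * tensor a b p) \<le> norm (f p * M)"
      using M by (intro AE_I2) (auto simp: abs_mult intro!: mult_left_mono order_trans[OF M abs_ge_self])
  qed
qed

lemma pairing_add:
  assumes "integrable LL f" "integrable LL g" "test1 a" "test1 b"
  shows "pairing (\<lambda>p. f p + g p) a b = pairing f a b + pairing g a b"
  unfolding pairing_def distrib_right
  by (intro Bochner_Integration.integral_add integrable_tensor assms)

lemma AE_eqI_pairing:
  assumes f: "integrable LL f" "f \<in> borel_measurable borel" and g: "integrable LL g"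
      "g \<in> borel_measurable borel"
    and eq: "\<And>a b. test1 a \<Longrightarrow> test1 b \<Longrightarrow> pairing f a b = pairing g a b"
  shows "AE p in LL. f p = g p"
proof -
  have "AE p in LL. f p - g p = 0"
  proof (rule fundamental_lemma)
    have "integrable (lebesgue_on Lam) (\<lambda>p. f p - g p)"
      using f g by (subst integrable_LL) auto
    then show "locally_integrable (\<lambda>p. f p - g p)" by (rule locally_integrableI)
    fix a b assume ab: "test1 a" "test1 b"
    have "(LINT p|lebesgue_on Lam. (f p - g p) * tensor a b p) = (LINT p|LL. (f p - g p) * tensor a b p)"
      using f g tensor_borel[OF ab] by (intro integral_LL borel_measurable_times borel_measurable_diff)
    also have "\<dots> = pairing f a b - pairing g a b"
      unfolding pairing_def left_diff_distrib
      by (intro Bochner_Integration.integral_diff integrable_tensor f g ab)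
    finally show "(LINT p|lebesgue_on Lam. (f p - g p) * tensor a b p) = 0" using eq[OF ab] by simp
  qed
  then show ?thesis by simp
qed

text \<open>A weak derivative tested on products only, and on the Borel product measure: the form in
  which the kernel identities consume it.\<close>

definition weak_dx :: "(real \<times> real \<Rightarrow> real) \<Rightarrow> (real \<times> real \<Rightarrow> real) \<Rightarrow> bool" where
  "weak_dx f g \<longleftrightarrow> (\<forall>a b. test1 a \<longrightarrow> test1 b \<longrightarrow> pairing f (deriv a) b = - pairing g a b)"

definition weak_dy :: "(real \<times> real \<Rightarrow> real) \<Rightarrow> (real \<times> real \<Rightarrow> real) \<Rightarrow> bool" where
  "weak_dy f g \<longleftrightarrow> (\<forall>a b. test1 a \<longrightarrow> test1 b \<longrightarrow> pairing f a (deriv b) = - pairing g a b)"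

definition weak_dxy :: "(real \<times> real \<Rightarrow> real) \<Rightarrow> (real \<times> real \<Rightarrow> real) \<Rightarrow> bool" where
  "weak_dxy f g \<longleftrightarrow> (\<forall>a b. test1 a \<longrightarrow> test1 b \<longrightarrow> pairing f (deriv a) (deriv b) = pairing g a b)"

lemma pairing_lebesgue:
  assumes "f \<in> borel_measurable borel" "test1 a" "test1 b"
  shows "(LINT p|lebesgue_on Lam. f p * tensor a b p) = pairing f a b"
  unfolding pairing_def using assms tensor_borel by (intro integral_LL borel_measurable_times) auto

lemma dx_tensor_test: "test1 a \<Longrightarrow> dx (tensor a b) = tensor (deriv a) b"
  by (intro dx_tensor) (auto intro: test1_has_deriv)

lemma dy_tensor_test: "test1 b \<Longrightarrow> dy (tensor a b) = tensor a (deriv b)"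
  by (intro dy_tensor) (auto intro: test1_has_deriv)

lemma weak_dxI:
  assumes h: "has_weak_deriv (Suc 0, 0) f g" and f: "f \<in> borel_measurable borel"
      and g: "g \<in> borel_measurable borel"
  shows "weak_dx f g"
  unfolding weak_dx_def
proof (intro allI impI)
  fix a b assume ab: "test1 a" "test1 b"
  have "classical_deriv (Suc 0, 0) (tensor a b) = tensor (deriv a) b"
    by (simp add: classical_deriv_def dx_tensor_test ab)
  then show "pairing f (deriv a) b = - pairing g a b"
    using h test_tensor[OF ab] unfolding has_weak_deriv_def
    by (auto simp: pairing_lebesgue[symmetric] f g ab test1_deriv mi_order_def)
qed

lemma weak_dyI:
  assumes h: "has_weak_deriv (0, Suc 0) f g" and f: "f \<in> borel_measurable borel"
      and g: "g \<in> borel_measurable borel"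
  shows "weak_dy f g"
  unfolding weak_dy_def
proof (intro allI impI)
  fix a b assume ab: "test1 a" "test1 b"
  have "classical_deriv (0, Suc 0) (tensor a b) = tensor a (deriv b)"
    by (simp add: classical_deriv_def dy_tensor_test ab)
  then show "pairing f a (deriv b) = - pairing g a b"
    using h test_tensor[OF ab] unfolding has_weak_deriv_def
    by (auto simp: pairing_lebesgue[symmetric] f g ab test1_deriv mi_order_def)
qed

lemma weak_dxyI:
  assumes "weak_dx f fx" "weak_dy fx fxy"
  shows "weak_dxy f fxy"
  using assms unfolding weak_dx_def weak_dy_def weak_dxy_def by (metis test1_deriv minus_minus)

text \<open>The agreement set is closed and has full measure in the open square, so it contains that
  square and, by closure, the edges. The edges matter: all interpolation nodes lie on them.\<close>

lemma continuous_AE_eq: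
  fixes f g :: "real \<times> real \<Rightarrow> real"
  assumes f: "continuous_on Lam f" and g: "continuous_on Lam g" and ae: "AE p in LL. f p = g p"
      and p: "p \<in> Lam"
  shows "f p = g p"
proof -
  let ?C = "{p \<in> Lam. f p - g p = 0}"
  have cl: "closed ?C"
    using continuous_closed_preimage_constant[of Lam "\<lambda>p. f p - g p" 0] f g compact_imp_closed[OF
        compact_Lam]
    by (simp add: continuous_on_diff)
  have "AE p in lborel. p \<in> interior Lam \<longrightarrow> p \<in> ?C"
    using ae[unfolded AE_LL] by eventually_elim (use interior_subset in auto)
  then have "AE p \<in> interior Lam in lebesgue. p \<in> ?C" by (simp add: AE_completion_iff)
  then have "interior Lam \<subseteq> ?C"
    using mem_closed_if_AE_lebesgue_open[OF open_interior cl] by blast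
  then have "closure (interior Lam) \<subseteq> ?C" using cl by (simp add: closure_minimal)
  moreover have "closure (interior Lam) = Lam"
    unfolding interior_Lam by (simp add: closure_Times Lam_def)
  ultimately show ?thesis using p by auto
qed

lemma LL_integral_product:
  fixes u v :: "real \<Rightarrow> real"
  assumes [measurable]: "u \<in> borel_measurable borel" "v \<in> borel_measurable borel"
    and "\<And>x. x \<in> {-1..1} \<Longrightarrow> \<bar>u x\<bar> \<le> M" "\<And>x. x \<in> {-1..1} \<Longrightarrow> \<bar>v x\<bar> \<le> N"
  shows "(LINT p|LL. u (fst p) * v (snd p)) = (LINT x|NI. u x) * (LINT y|NI. v y)"
proof -
  have "integrable LL (\<lambda>p. u (fst p) * v (snd p))"
  proof (rule LL_bounded_integrable[where B="M * N"])
    show "(\<lambda>p. u (fst p) * v (snd p)) \<in> borel_measurable borel"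
      unfolding borel_prod[symmetric] by measurable
    show "\<bar>u (fst p) * v (snd p)\<bar> \<le> M * N" if "p \<in> Lam" for p
      using assms(3)[of "fst p"] assms(4)[of "snd p"] that unfolding abs_mult
      by (intro mult_mono) (auto simp: Lam_def)
  qed
  then show ?thesis using LL_Fubini(1) by simp
qed

section \<open>Moving the kernels onto test functions\<close>

context averaging
begin

lemma T2_borel: "kernel \<kappa> \<Longrightarrow> kernel \<kappa>' \<Longrightarrow> integrable LL g \<Longrightarrow> T2 \<kappa> \<kappa>' g \<in> borel_measurable borel"
  by (rule borel_measurable_continuous_onI[OF T2_continuous])

lemma T2_integrable_LL:
  assumes "kernel \<kappa>" "kernel \<kappa>'" "integrable LL g" shows "integrable LL (T2 \<kappa> \<kappa>' g)"
  by (rule LL_bounded_integrable[OF T2_borel[OF assms] T2_bound[OF assms]])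

text \<open>The adjoint of \<open>T2\<close>. Fubini on the product of two squares moves the kernels
  to the test function, and the inner integral factorises because kernel and test function are both
  products.\<close>

lemma T2_test:
  assumes \<kappa>: "kernel \<kappa>" "kernel \<kappa>'" and g: "integrable LL g"
    and t: "test1 \<theta>" "test1 \<eta>" and ab: "test1 a" "test1 b"
    and a: "\<And>s. s \<in> {-1..1} \<Longrightarrow> (LINT x|NI. \<kappa> x s * \<theta> x) = a s"
    and b: "\<And>s. s \<in> {-1..1} \<Longrightarrow> (LINT x|NI. \<kappa>' x s * \<eta> x) = b s"
  shows "pairing (T2 \<kappa> \<kappa>' g) \<theta> \<eta> = pairing g a b"
proof -
  interpret Q: pair_sigma_finite LL LL ..
  interpret QF: finite_measure "LL \<Otimes>\<^sub>M LL" by (rule finite_measure_pair_measure) unfold_locales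
  let ?F = "\<lambda>p q. \<kappa> (fst p) (fst q) * \<kappa>' (snd p) (snd q) * g q * tensor \<theta> \<eta> p"
  obtain M where M: "\<And>p. \<bar>tensor \<theta> \<eta> p\<bar> \<le> M" using tensor_bounded[OF t] by metis
  obtain M1 where M1: "\<And>x. \<bar>\<theta> x\<bar> \<le> M1" using test1_bounded[OF t(1)] by metis
  obtain M2 where M2: "\<And>x. \<bar>\<eta> x\<bar> \<le> M2" using test1_bounded[OF t(2)] by metis
  have gs: "integrable (LL \<Otimes>\<^sub>M LL) (\<lambda>z. g (snd z))"
  proof (rule Q.Fubini_integrable)
    show "(\<lambda>z. g (snd z)) \<in> borel_measurable (LL \<Otimes>\<^sub>M LL)"
      using measurable_compose[OF measurable_snd borel_measurable_integrable[OF g]] .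
  qed (use g in auto)
  have "integrable (LL \<Otimes>\<^sub>M LL) (case_prod ?F)"
  proof (rule Bochner_Integration.integrable_bound)
    show "integrable (LL \<Otimes>\<^sub>M LL) (\<lambda>z. B\<^sup>2 * \<bar>g (snd z)\<bar> * M)"
      using gs by auto
    have m: "fst \<in> measurable (LL \<Otimes>\<^sub>M LL) borel" "snd \<in> measurable (LL \<Otimes>\<^sub>M LL) borel"
      using measurable_fst[of LL LL] measurable_snd[of LL LL] by (simp_all cong: measurable_cong_sets)
    have c: "fst \<in> borel_measurable (borel :: (real \<times> real) measure)"
        "snd \<in> borel_measurable (borel :: (real \<times> real) measure)"
      by (intro borel_measurable_continuous_onI continuous_intros)+
    have "(\<lambda>z. ?F (fst z) (snd z)) \<in> borel_measurable (LL \<Otimes>\<^sub>M LL)"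
      by (intro borel_measurable_times kernel_measurable[OF \<kappa>(1)] kernel_measurable[OF \<kappa>(2)]
          borel_measurable_integrable[OF gs] measurable_compose[OF m(1) tensor_borel[OF t]]
          measurable_compose[OF m(1) c(1)] measurable_compose[OF m(1) c(2)]
          measurable_compose[OF m(2) c(1)] measurable_compose[OF m(2) c(2)])
    then show "case_prod ?F \<in> borel_measurable (LL \<Otimes>\<^sub>M LL)" by (simp add: case_prod_beta)
    have Lm: "{z \<in> space (LL \<Otimes>\<^sub>M LL). snd z \<in> Lam} \<in> sets (LL \<Otimes>\<^sub>M LL)"
      using measurable_sets[OF m(2) Lam_borel] by (simp add: vimage_def Int_def conj_commute)
    have "AE z in LL \<Otimes>\<^sub>M LL. snd z \<in> Lam"
      by (rule Q.AE_pair_measure[OF Lm]) (simp add: AE_LL_Lam)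
    then show "AE z in LL \<Otimes>\<^sub>M LL. norm (case_prod ?F z) \<le> norm (B\<^sup>2 * \<bar>g (snd z)\<bar> * M)"
    proof eventually_elim
      case (elim z)
      have "\<bar>\<kappa> (fst (fst z)) (fst (snd z)) * \<kappa>' (snd (fst z)) (snd (snd z)) * g (snd z)\<bar> * \<bar>tensor \<theta>
          \<eta> (fst z)\<bar>
          \<le> (B\<^sup>2 * \<bar>g (snd z)\<bar>) * M"
        by (intro mult_mono kernel_prod_le \<kappa> elim M) (use B_ge in auto)
      then show ?case
        unfolding case_prod_beta real_norm_def abs_mult[of _ "tensor \<theta> \<eta> (fst z)"]
        by (rule order_trans) (rule abs_ge_self)
    qed
  qed
  from Q.Fubini_integral[OF this]
  have "(LINT p|LL. LINT q|LL. ?F p q) = (LINT q|LL. LINT p|LL. ?F p q)" by simp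
  also have "(LINT p|LL. LINT q|LL. ?F p q) = pairing (T2 \<kappa> \<kappa>' g) \<theta> \<eta>"
    unfolding pairing_def T2_def by simp
  also have "(LINT q|LL. LINT p|LL. ?F p q) = (LINT q|LL. g q * tensor a b q)"
  proof (rule integral_cong_AE)
    show "AE q in LL. (LINT p|LL. ?F p q) = g q * tensor a b q"
      using AE_LL_Lam
    proof eventually_elim
      case (elim q)
      have q: "fst q \<in> {-1..1}" "snd q \<in> {-1..1}" using elim by (auto simp: Lam_def)
      have "(LINT p|LL. ?F p q) = (LINT p|LL. g q * ((\<kappa> (fst p) (fst q) * \<theta> (fst p)) * (\<kappa>' (snd p)
          (snd q) * \<eta> (snd p))))"
        by (intro Bochner_Integration.integral_cong) (auto simp: tensor_def case_prod_beta)
      also have "\<dots> = g q * (LINT p|LL. (\<kappa> (fst p) (fst q) * \<theta> (fst p)) * (\<kappa>' (snd p) (snd q) * \<eta> (snd p)))"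
        by simp
      also have "(LINT p|LL. (\<kappa> (fst p) (fst q) * \<theta> (fst p)) * (\<kappa>' (snd p) (snd q) * \<eta> (snd p)))
          = (LINT x|NI. \<kappa> x (fst q) * \<theta> x) * (LINT y|NI. \<kappa>' y (snd q) * \<eta> y)"
      proof (rule LL_integral_product)
        show "(\<lambda>x. \<kappa> x (fst q) * \<theta> x) \<in> borel_measurable borel"
          by (rule borel_measurable_times[OF kernel_measurable[OF \<kappa>(1)] test1_borel[OF t(1)]]) auto
        show "(\<lambda>x. \<kappa>' x (snd q) * \<eta> x) \<in> borel_measurable borel"
          by (rule borel_measurable_times[OF kernel_measurable[OF \<kappa>(2)] test1_borel[OF t(2)]]) auto
        show "\<bar>\<kappa> x (fst q) * \<theta> x\<bar> \<le> B * M1" for x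
          unfolding abs_mult using kernelD(2)[OF \<kappa>(1) q(1), of x] M1[of x] B_ge by (intro mult_mono) auto
        show "\<bar>\<kappa>' x (snd q) * \<eta> x\<bar> \<le> B * M2" for x
          unfolding abs_mult using kernelD(2)[OF \<kappa>(2) q(2), of x] M2[of x] B_ge by (intro mult_mono) auto
      qed
      also have "\<dots> = tensor a b q" using a[OF q(1)] b[OF q(2)] by (simp add: tensor_def case_prod_beta)
      finally show ?case .
    qed
    show "(\<lambda>q. LINT p|LL. ?F p q) \<in> borel_measurable LL"
      using Q.integrable_snd[OF \<open>integrable (LL \<Otimes>\<^sub>M LL) (case_prod ?F)\<close>] by simp
    show "(\<lambda>q. g q * tensor a b q) \<in> borel_measurable LL"
      by (rule borel_measurable_integrable[OF integrable_tensor[OF g ab]])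
  qed
  finally show ?thesis by (simp add: pairing_def)
qed

text \<open>The one-variable adjoint, carried out on those slices of constant y on which
  \<open>g\<close> is integrable, which are almost all of them.\<close>

lemma T1_test:
  assumes \<kappa>: "kernel \<kappa>" and g: "integrable LL g" and gb: "g \<in> borel_measurable borel"
    and t: "test1 \<theta>" "test1 \<eta>" and a': "test1 a"
    and a: "\<And>s. s \<in> {-1..1} \<Longrightarrow> (LINT x|NI. \<kappa> x s * \<theta> x) = a s"
  shows "pairing (T1 \<kappa> g) \<theta> \<eta> = pairing g a \<eta>"
proof -
  obtain M where M: "\<And>x. \<bar>\<theta> x\<bar> \<le> M" using test1_bounded[OF t(1)] by metis
  have i1: "integrable LL (\<lambda>p. T1 \<kappa> g p * tensor \<theta> \<eta> p)" and i2: "integrable LL (\<lambda>p. g p * tensor a \<eta> p)"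
    by (intro integrable_tensor T1_integrable \<kappa> g gb t a')+
  have "pairing (T1 \<kappa> g) \<theta> \<eta> = (LINT y|NI. LINT x|NI. T1 \<kappa> g (x, y) * tensor \<theta> \<eta> (x, y))"
    unfolding pairing_def by (rule LL_Fubini(2)[OF i1])
  also have "\<dots> = (LINT y|NI. LINT s|NI. g (s, y) * tensor a \<eta> (s, y))"
  proof (rule integral_cong_AE)
    show "AE y in NI. (LINT x|NI. T1 \<kappa> g (x, y) * tensor \<theta> \<eta> (x, y)) = (LINT s|NI. g (s, y)
        * tensor a \<eta> (s, y))"
      using slice_integrable(1)[OF g]
    proof eventually_elim
      case (elim y)
      let ?F = "\<lambda>x s. \<kappa> x s * g (s, y) * \<theta> x"
      have gs: "integrable LL (\<lambda>z. g (snd z, y))" by (rule LL_integrable_snd[OF elim])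
      have "integrable LL (case_prod ?F)"
      proof (rule Bochner_Integration.integrable_bound)
        show "integrable LL (\<lambda>z. B * \<bar>g (snd z, y)\<bar> * M)" using gs by auto
        have "(\<lambda>z. ?F (fst z) (snd z)) \<in> borel_measurable LL"
          by (intro borel_measurable_times kernel_measurable[OF \<kappa>] borel_measurable_integrable[OF gs]
              fst_LL snd_LL measurable_compose[OF fst_LL test1_borel[OF t(1)]])
        then show "case_prod ?F \<in> borel_measurable LL" by (simp add: case_prod_beta)
        show "AE z in LL. norm (case_prod ?F z) \<le> norm (B * \<bar>g (snd z, y)\<bar> * M)"
          using AE_LL_Lam
        proof eventually_elim
          case (elim z)
          then have "\<bar>\<kappa> (fst z) (snd z)\<bar> \<le> B" using kernelD(2)[OF \<kappa>] by (auto simp: Lam_def)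
          then have "\<bar>\<kappa> (fst z) (snd z)\<bar> * \<bar>g (snd z, y)\<bar> * \<bar>\<theta> (fst z)\<bar> \<le> B * \<bar>g (snd z, y)\<bar> * M"
            using B_ge by (intro mult_mono M) auto
          then show ?case
            unfolding case_prod_beta real_norm_def abs_mult[of _ "\<theta> (fst z)"] abs_mult[of "\<kappa> (fst z)
                (snd z)"]
            by (rule order_trans) (rule abs_ge_self)
        qed
      qed
      from NN.Fubini_integral[OF this[unfolded LL_def]]
      have Fub: "(LINT x|NI. LINT s|NI. ?F x s) = (LINT s|NI. LINT x|NI. ?F x s)" by simp
      have "(LINT x|NI. T1 \<kappa> g (x, y) * tensor \<theta> \<eta> (x, y)) = (LINT x|NI. (LINT s|NI. ?F x s) * \<eta> y)"
        unfolding T1_def tensor_def by (intro Bochner_Integration.integral_cong) auto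
      also have "\<dots> = (LINT s|NI. LINT x|NI. ?F x s) * \<eta> y" using Fub by simp
      also have "(LINT s|NI. LINT x|NI. ?F x s) = (LINT s|NI. g (s, y) * a s)"
      proof (rule integral_cong_AE)
        show "AE s in NI. (LINT x|NI. ?F x s) = g (s, y) * a s"
          using AE_NI_interval
        proof eventually_elim
          case (elim s)
          have "(LINT x|NI. ?F x s) = (LINT x|NI. g (s, y) * (\<kappa> x s * \<theta> x))"
            by (intro Bochner_Integration.integral_cong) auto
          then show ?case using a[OF elim] by simp
        qed
        show "(\<lambda>s. LINT x|NI. ?F x s) \<in> borel_measurable NI"
          using NN.integrable_snd[OF \<open>integrable LL (case_prod ?F)\<close>[unfolded LL_def]] by simp
        show "(\<lambda>s. g (s, y) * a s) \<in> borel_measurable NI"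
          using elim test1_borel[OF a'] by (intro borel_measurable_times) auto
      qed
      also have "\<dots> * \<eta> y = (LINT s|NI. g (s, y) * a s * \<eta> y)" by simp
      also have "\<dots> = (LINT s|NI. g (s, y) * tensor a \<eta> (s, y))"
        by (intro Bochner_Integration.integral_cong) (auto simp: tensor_def)
      finally show ?case .
    qed
  qed (use slice_integrable(2)[OF i1] slice_integrable(2)[OF i2] in auto)
  also have "\<dots> = pairing g a \<eta>"
    unfolding pairing_def by (rule LL_Fubini(2)[OF i2, symmetric])
  finally show ?thesis .
qed

lemma pairing_split_x:
  assumes f: "integrable LL f" and \<theta>: "\<And>x. \<theta> x = A * \<rho> x - deriv a x" and ab: "test1 a" "test1 b"
  shows "pairing f \<theta> b = A * pairing f \<rho> b - pairing f (deriv a) b"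
proof -
  have "pairing f \<theta> b = (LINT p|LL. A * (f p * tensor \<rho> b p) - f p * tensor (deriv a) b p)"
    unfolding pairing_def
    by (intro Bochner_Integration.integral_cong) (auto simp: tensor_def \<theta> algebra_simps)
  also have "\<dots> = A * pairing f \<rho> b - pairing f (deriv a) b"
    unfolding pairing_def
    using integrable_tensor[OF f rho_test ab(2)] integrable_tensor[OF f test1_deriv[OF ab(1)] ab(2)]
    by simp
  finally show ?thesis .
qed

lemma pairing_split_y:
  assumes f: "integrable LL f" and \<theta>: "\<And>x. \<theta> x = A * \<rho> x - deriv b x" and ab: "test1 a" "test1 b"
  shows "pairing f a \<theta> = A * pairing f a \<rho> - pairing f a (deriv b)"
proof -
  have "pairing f a \<theta> = (LINT p|LL. A * (f p * tensor a \<rho> p) - f p * tensor a (deriv b) p)"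
    unfolding pairing_def
    by (intro Bochner_Integration.integral_cong) (auto simp: tensor_def \<theta> algebra_simps)
  also have "\<dots> = A * pairing f a \<rho> - pairing f a (deriv b)"
    unfolding pairing_def
    using integrable_tensor[OF f ab(1) rho_test] integrable_tensor[OF f ab(1) test1_deriv[OF ab(2)]]
    by simp
  finally show ?thesis .
qed

lemma pairing_scale_x: "pairing f (\<lambda>s. \<rho> s * A) b = A * pairing f \<rho> b"
proof -
  have "pairing f (\<lambda>s. \<rho> s * A) b = (LINT p|LL. A * (f p * tensor \<rho> b p))"
    unfolding pairing_def by (intro Bochner_Integration.integral_cong) (auto simp: tensor_def)
  then show ?thesis by (simp add: pairing_def)
qed

lemma pairing_scale_y: "pairing f a (\<lambda>s. \<rho> s * A) = A * pairing f a \<rho>"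
proof -
  have "pairing f a (\<lambda>s. \<rho> s * A) = (LINT p|LL. A * (f p * tensor a \<rho> p))"
    unfolding pairing_def by (intro Bochner_Integration.integral_cong) (auto simp: tensor_def)
  then show ?thesis by (simp add: pairing_def)
qed

text \<open>The one-dimensional formula, average of f plus \<open>k\<close> applied to f', used in x
  and in y and multiplied out into four terms.\<close>

definition rep :: "(real \<times> real \<Rightarrow> real) \<Rightarrow> (real \<times> real \<Rightarrow> real) \<Rightarrow> (real \<times> real \<Rightarrow> real) \<Rightarrow> (real \<times> real
    \<Rightarrow> real) \<Rightarrow> real \<times> real \<Rightarrow> real" where
  "rep f fx fy fxy p = (T2 r r f p + T2 k r fx p) + (T2 r k fy p + T2 k k fxy p)"

lemma rep_continuous:
  assumes "integrable LL f" "integrable LL fx" "integrable LL fy" "integrable LL fxy"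
  shows "continuous_on UNIV (rep f fx fy fxy)"
  unfolding rep_def[abs_def]
  by (intro continuous_on_add T2_continuous kernel_r kernel_k assms)

text \<open>By duality. Both factors of the test function are split as mass times
  \<open>\<rho>\<close> minus a derivative; the four products turn into pairings with f, fx, fy and
  fxy, and each is recognised as the adjoint of one term. Classical differentiability of
  \<open>f\<close> never enters.\<close>

lemma rep_AE:
  assumes f: "integrable LL f" "f \<in> borel_measurable borel"
    and fx: "integrable LL fx" and fy: "integrable LL fy" and fxy: "integrable LL fxy"
    and w: "weak_dx f fx" "weak_dy f fy" "weak_dxy f fxy"
  shows "AE p in LL. f p = rep f fx fy fxy p"
  unfolding rep_def[abs_def]
proof (rule AE_eqI_pairing[OF f])
  note i = T2_integrable_LL[OF kernel_r kernel_r f(1)] T2_integrable_LL[OF kernel_k kernel_r fx]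
    T2_integrable_LL[OF kernel_r kernel_k fy] T2_integrable_LL[OF kernel_k kernel_k fxy]
  show "integrable LL (\<lambda>p. T2 r r f p + T2 k r fx p + (T2 r k fy p + T2 k k fxy p))"
    by (intro Bochner_Integration.integrable_add i)
  show "(\<lambda>p. T2 r r f p + T2 k r fx p + (T2 r k fy p + T2 k k fxy p)) \<in> borel_measurable borel"
    by (intro borel_measurable_add T2_borel kernel_r kernel_k f(1) fx fy fxy)
  fix \<theta> \<eta> assume t: "test1 \<theta>" "test1 \<eta>"
  obtain a A where a: "test1 a" "\<And>x. \<theta> x = A * \<rho> x - deriv a x"
      "\<And>s. s \<in> {-1..1} \<Longrightarrow> (LINT x|NI. k x s * \<theta> x) = a s" "\<And>s. (LINT x|NI. r x s * \<theta> x) = A * \<rho> s"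
    by (rule kernel_test[OF t(1)], rule that, assumption+)
  obtain b C where b: "test1 b" "\<And>x. \<eta> x = C * \<rho> x - deriv b x"
      "\<And>s. s \<in> {-1..1} \<Longrightarrow> (LINT x|NI. k x s * \<eta> x) = b s" "\<And>s. (LINT x|NI. r x s * \<eta> x) = C * \<rho> s"
    by (rule kernel_test[OF t(2)], rule that, assumption+)
  have a4: "(LINT x|NI. r x s * \<theta> x) = \<rho> s * A" and b4: "(LINT x|NI. r x s * \<eta> x) = \<rho> s * C" for s
    using a(4) b(4) by (simp_all add: mult.commute)
  have "pairing f \<theta> \<eta> = A * (C * pairing f \<rho> \<rho> - pairing f \<rho> (deriv b))
      - (C * pairing f (deriv a) \<rho> - pairing f (deriv a) (deriv b))"
    by (simp only: pairing_split_x[OF f(1) a(2,1) t(2)] pairing_split_y[OF f(1) b(2) rho_test b(1)]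
        pairing_split_y[OF f(1) b(2) test1_deriv[OF a(1)] b(1)])
  also have "\<dots> = A * (C * pairing f \<rho> \<rho>) + A * pairing fy \<rho> b + (C * pairing fx a \<rho> + pairing fxy a b)"
    using w a(1) b(1) rho_test unfolding weak_dx_def weak_dy_def weak_dxy_def
    by (simp add: algebra_simps)
  also have "A * (C * pairing f \<rho> \<rho>) = pairing (T2 r r f) \<theta> \<eta>"
    by (subst T2_test[OF kernel_r kernel_r f(1) t test1_scale[OF rho_test] test1_scale[OF rho_test] a4 b4])
      (simp add: pairing_scale_x pairing_scale_y)
  also have "A * pairing fy \<rho> b = pairing (T2 r k fy) \<theta> \<eta>"
    by (subst T2_test[OF kernel_r kernel_k fy t test1_scale[OF rho_test] b(1) a4 b(3)])
        (simp_all add: pairing_scale_x)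
  also have "C * pairing fx a \<rho> = pairing (T2 k r fx) \<theta> \<eta>"
    by (subst T2_test[OF kernel_k kernel_r fx t a(1) test1_scale[OF rho_test] a(3) b4])
        (simp_all add: pairing_scale_y)
  also have "pairing fxy a b = pairing (T2 k k fxy) \<theta> \<eta>"
    by (subst T2_test[OF kernel_k kernel_k fxy t a(1) b(1) a(3) b(3)]) simp_all
  finally show "pairing f \<theta> \<eta> = pairing (\<lambda>p. T2 r r f p + T2 k r fx p + (T2 r k fy p + T2 k k fxy p)) \<theta> \<eta>"
    using i by (simp add: pairing_add t)
qed

lemma T2_rr_const: "T2 r r f p = pairing f \<rho> \<rho>"
  unfolding T2_def pairing_def
  by (intro Bochner_Integration.integral_cong) (auto simp: tensor_def case_prod_beta)

text \<open>Only the x-average of \<open>f\<close> is expanded further in y, so no mixed derivative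
  appears. This permits Poincare steps up to order two, where third derivatives are the last ones
  available.\<close>

lemma poincare_AE:
  assumes f: "integrable LL f" "f \<in> borel_measurable borel"
    and fx: "integrable LL fx" "fx \<in> borel_measurable borel" and fy: "integrable LL fy"
    and w: "weak_dx f fx" "weak_dy f fy"
  shows "AE p in LL. f p = (T2 r r f p + T2 r k fy p) + T1 k fx p"
proof (rule AE_eqI_pairing[OF f])
  note i = T2_integrable_LL[OF kernel_r kernel_r f(1)] T1_integrable[OF kernel_k fx]
    T2_integrable_LL[OF kernel_r kernel_k fy]
  show "integrable LL (\<lambda>p. (T2 r r f p + T2 r k fy p) + T1 k fx p)"
    by (intro Bochner_Integration.integrable_add i)
  show "(\<lambda>p. (T2 r r f p + T2 r k fy p) + T1 k fx p) \<in> borel_measurable borel"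
    by (intro borel_measurable_add T2_borel T1_borel kernel_r kernel_k f(1) fx fy)
  fix \<theta> \<eta> assume t: "test1 \<theta>" "test1 \<eta>"
  obtain a A where a: "test1 a" "\<And>x. \<theta> x = A * \<rho> x - deriv a x"
      "\<And>s. s \<in> {-1..1} \<Longrightarrow> (LINT x|NI. k x s * \<theta> x) = a s" "\<And>s. (LINT x|NI. r x s * \<theta> x) = A * \<rho> s"
    by (rule kernel_test[OF t(1)], rule that, assumption+)
  obtain b C where b: "test1 b" "\<And>x. \<eta> x = C * \<rho> x - deriv b x"
      "\<And>s. s \<in> {-1..1} \<Longrightarrow> (LINT x|NI. k x s * \<eta> x) = b s" "\<And>s. (LINT x|NI. r x s * \<eta> x) = C * \<rho> s"
    by (rule kernel_test[OF t(2)], rule that, assumption+)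
  have a4: "(LINT x|NI. r x s * \<theta> x) = \<rho> s * A" and b4: "(LINT x|NI. r x s * \<eta> x) = \<rho> s * C" for s
    using a(4) b(4) by (simp_all add: mult.commute)
  have "pairing f \<theta> \<eta> = A * (C * pairing f \<rho> \<rho> - pairing f \<rho> (deriv b)) - pairing f (deriv a) \<eta>"
    by (simp only: pairing_split_x[OF f(1) a(2,1) t(2)] pairing_split_y[OF f(1) b(2) rho_test b(1)])
  also have "\<dots> = A * (C * pairing f \<rho> \<rho>) + A * pairing fy \<rho> b + pairing fx a \<eta>"
    using w a(1) b(1) t rho_test unfolding weak_dx_def weak_dy_def
    by (simp add: algebra_simps)
  also have "A * (C * pairing f \<rho> \<rho>) = pairing (T2 r r f) \<theta> \<eta>"
    by (subst T2_test[OF kernel_r kernel_r f(1) t test1_scale[OF rho_test] test1_scale[OF rho_test] a4 b4])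
      (simp add: pairing_scale_x pairing_scale_y)
  also have "A * pairing fy \<rho> b = pairing (T2 r k fy) \<theta> \<eta>"
    by (subst T2_test[OF kernel_r kernel_k fy t test1_scale[OF rho_test] b(1) a4 b(3)])
        (simp_all add: pairing_scale_x)
  also have "pairing fx a \<eta> = pairing (T1 k fx) \<theta> \<eta>"
    by (subst T1_test[OF kernel_k fx t a(1) a(3)]) simp_all
  finally show "pairing f \<theta> \<eta> = pairing (\<lambda>p. (T2 r r f p + T2 r k fy p) + T1 k fx p) \<theta> \<eta>"
    using i by (simp add: pairing_add t)
qed

text \<open>The first term depends on y only, so the whole x-dependence sits in the kernel applied
  to \<open>fx\<close>; this is the form from which a classical x-derivative can be read
  off.\<close>

lemma slice_AE:
  assumes f: "integrable LL f" "f \<in> borel_measurable borel"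
    and fx: "integrable LL fx" "fx \<in> borel_measurable borel" and w: "weak_dx f fx"
  shows "AE p in LL. f p = T1 r f p + T1 k fx p"
proof (rule AE_eqI_pairing[OF f])
  note i = T1_integrable[OF kernel_r f] T1_integrable[OF kernel_k fx]
  show "integrable LL (\<lambda>p. T1 r f p + T1 k fx p)"
    by (intro Bochner_Integration.integrable_add i)
  show "(\<lambda>p. T1 r f p + T1 k fx p) \<in> borel_measurable borel"
    by (intro borel_measurable_add T1_borel kernel_r kernel_k f fx)
  fix \<theta> \<eta> assume t: "test1 \<theta>" "test1 \<eta>"
  obtain a A where a: "test1 a" "\<And>x. \<theta> x = A * \<rho> x - deriv a x"
      "\<And>s. s \<in> {-1..1} \<Longrightarrow> (LINT x|NI. k x s * \<theta> x) = a s" "\<And>s. (LINT x|NI. r x s * \<theta> x) = A * \<rho> s"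
    by (rule kernel_test[OF t(1)], rule that, assumption+)
  have a4: "(LINT x|NI. r x s * \<theta> x) = \<rho> s * A" for s
    using a(4) by (simp add: mult.commute)
  have "pairing f \<theta> \<eta> = A * pairing f \<rho> \<eta> - pairing f (deriv a) \<eta>"
    by (rule pairing_split_x[OF f(1) a(2,1) t(2)])
  also have "\<dots> = A * pairing f \<rho> \<eta> + pairing fx a \<eta>"
    using w a(1) t unfolding weak_dx_def by simp
  also have "A * pairing f \<rho> \<eta> = pairing (T1 r f) \<theta> \<eta>"
    by (subst T1_test[OF kernel_r f t test1_scale[OF rho_test] a4]) (simp_all add: pairing_scale_x)
  also have "pairing fx a \<eta> = pairing (T1 k fx) \<theta> \<eta>"
    by (subst T1_test[OF kernel_k fx t a(1) a(3)]) simp_all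
  finally show "pairing f \<theta> \<eta> = pairing (\<lambda>p. T1 r f p + T1 k fx p) \<theta> \<eta>"
    using i by (simp add: pairing_add t)
qed

end

section \<open>The continuously differentiable representative\<close>

lemma continuous_imp_LL:
  fixes f :: "real \<times> real \<Rightarrow> real"
  assumes f: "continuous_on UNIV f"
  shows "f \<in> borel_measurable borel" "integrable LL f"
proof -
  show m: "f \<in> borel_measurable borel" by (rule borel_measurable_continuous_onI[OF f])
  have "bounded (f ` Lam)"
    using f by (intro compact_imp_bounded compact_continuous_image compact_Lam)
        (rule continuous_on_subset, auto)
  then obtain M where "\<And>p. p \<in> Lam \<Longrightarrow> \<bar>f p\<bar> \<le> M"
    unfolding bounded_iff by (metis imageI real_norm_def)
  then show "integrable LL f" by (rule LL_bounded_integrable[OF m])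
qed

lemma pairing_swap:
  assumes f: "f \<in> borel_measurable borel" and ab: "test1 a" "test1 b"
  shows "pairing (\<lambda>p. f (snd p, fst p)) b a = pairing f a b"
proof -
  have "(\<lambda>p. f p * tensor a b p) \<in> borel_measurable borel"
    using f tensor_borel[OF ab] by (intro borel_measurable_times)
  then have m: "(\<lambda>p. f p * tensor a b p) \<in> borel_measurable LL" by simp
  have "pairing (\<lambda>p. f (snd p, fst p)) b a = (LINT p|LL. (case p of (x, y) \<Rightarrow> f (y, x) * tensor a b (y, x)))"
    unfolding pairing_def by (intro Bochner_Integration.integral_cong) (auto simp: tensor_def)
  also have "\<dots> = pairing f a b"
    unfolding pairing_def LL_def
    using NN.integral_product_swap[OF m[unfolded LL_def]] by simp
  finally show ?thesis .
qed

context averaging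
begin

lemma T1_continuous:
  assumes \<kappa>: "kernel \<kappa>" and f: "continuous_on UNIV f"
  shows "continuous_on Lam (T1 \<kappa> f)"
proof (rule continuous_on_sequentiallyI)
  fix u :: "nat \<Rightarrow> real \<times> real" and a assume u: "\<forall>n. u n \<in> Lam" "a \<in> Lam" "u \<longlonglongrightarrow> a"
  have "bounded (f ` Lam)"
    using f by (intro compact_imp_bounded compact_continuous_image compact_Lam)
        (rule continuous_on_subset, auto)
  then obtain M where M: "\<And>p. p \<in> Lam \<Longrightarrow> \<bar>f p\<bar> \<le> M"
    unfolding bounded_iff by (metis imageI real_norm_def)
  have fb: "(\<lambda>s. f (s, y)) \<in> borel_measurable borel" for y
    by (intro borel_measurable_continuous_onI continuous_on_compose2[OF f] continuous_intros) auto
  show "(\<lambda>n. T1 \<kappa> f (u n)) \<longlonglongrightarrow> T1 \<kappa> f a"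
    unfolding T1_def
  proof (rule integral_dominated_convergence[where w="\<lambda>s. B * M"])
    show "(\<lambda>s. \<kappa> (fst a) s * f (s, snd a)) \<in> borel_measurable NI"
      "(\<lambda>s. \<kappa> (fst (u n)) s * f (s, snd (u n))) \<in> borel_measurable NI" for n
      using fb by (auto intro!: borel_measurable_times kernel_measurable[OF \<kappa>])
    show "integrable NI (\<lambda>s. B * M)" by simp
    show "AE s in NI. (\<lambda>n. \<kappa> (fst (u n)) s * f (s, snd (u n))) \<longlonglongrightarrow> \<kappa> (fst a) s * f (s, snd a)"
      using AE_NI_neq[of "fst a"]
    proof eventually_elim
      case (elim s)
      have "isCont f (s, snd a)" using f by (simp add: continuous_on_eq_continuous_at)
      moreover have "(\<lambda>n. (s, snd (u n))) \<longlonglongrightarrow> (s, snd a)" by (intro tendsto_intros u)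
      ultimately have "(\<lambda>n. f (s, snd (u n))) \<longlonglongrightarrow> f (s, snd a)" by (rule isCont_tendsto_compose)
      moreover have "(\<lambda>n. \<kappa> (fst (u n)) s) \<longlonglongrightarrow> \<kappa> (fst a) s"
        by (rule isCont_tendsto_compose[OF kernelD(3)[OF \<kappa> elim] tendsto_fst[OF u(3)]])
      ultimately show ?case by (intro tendsto_mult)
    qed
    show "AE s in NI. norm (\<kappa> (fst (u n)) s * f (s, snd (u n))) \<le> B * M" for n
      using AE_NI_interval
    proof eventually_elim
      case (elim s)
      have "(s, snd (u n)) \<in> Lam" using elim u(1) by (auto simp: Lam_def mem_Times_iff)
      then show ?case
        unfolding real_norm_def abs_mult using kernelD(2)[OF \<kappa> elim] M B_ge by (intro mult_mono) auto
    qed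
  qed
qed

text \<open>\<open>k x s\<close> is the indicator of \<open>s \<le> x\<close> plus a function of
  \<open>s\<close> alone, so up to a constant the integral is an ordinary primitive of
  \<open>h\<close>.\<close>

lemma kernel_primitive_deriv:
  fixes h :: "real \<Rightarrow> real"
  assumes h: "continuous_on UNIV h" and x: "x \<in> {-1..1}"
  shows "((\<lambda>x. LINT s|NI. k x s * h s) has_real_derivative h x) (at x within {-1..1})"
proof -
  have "bounded (h ` {-1..1})"
    using h by (intro compact_imp_bounded compact_continuous_image) (rule continuous_on_subset, auto)
  then obtain M where M: "\<And>s. s \<in> {-1..1} \<Longrightarrow> \<bar>h s\<bar> \<le> M"
    unfolding bounded_iff by (metis imageI real_norm_def)
  have [measurable]: "h \<in> borel_measurable borel" by (rule borel_measurable_continuous_onI[OF h])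
  have eq: "(LINT s|NI. k x s * h s) = integral {-1..x} h + (LINT s|NI. (P s - 1) * h s)"
      if x: "x \<in> {-1..1}" for x
  proof -
    let ?u = "\<lambda>s. if s \<in> {..x} then h s else 0"
    have ub: "\<bar>?u s\<bar> \<le> \<bar>M\<bar>" "\<bar>(P s - 1) * h s\<bar> \<le> 1 * \<bar>M\<bar>" if "s \<in> {-1..1}" for s
    proof -
      show "\<bar>?u s\<bar> \<le> \<bar>M\<bar>" using M[OF that] by auto
      show "\<bar>(P s - 1) * h s\<bar> \<le> 1 * \<bar>M\<bar>"
        unfolding abs_mult using M[OF that] P_bounds[OF that] by (intro mult_mono) auto
    qed
    have m: "?u \<in> borel_measurable borel" "(\<lambda>s. (P s - 1) * h s) \<in> borel_measurable borel" by measurable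
    have "(LINT s|NI. k x s * h s) = (LINT s|NI. ?u s + (P s - 1) * h s)"
      by (intro Bochner_Integration.integral_cong) (auto simp: k_def algebra_simps)
    also have "\<dots> = (LINT s|NI. ?u s) + (LINT s|NI. (P s - 1) * h s)"
      by (intro Bochner_Integration.integral_add NI_bounded_integrable[OF m(1) ub(1)]
          NI_bounded_integrable[OF m(2) ub(2)])
    also have "(LINT s|NI. ?u s) = integral {-1..1} ?u"
      by (rule integral_NI[OF m(1) ub(1)])
    also have "\<dots> = integral {-1..x} h"
    proof -
      have "{..x} \<inter> {-1..1} = {-1..x}" using x by auto
      then show ?thesis using Henstock_Kurzweil_Integration.integral_restrict_Int[of "{-1..1}" "{..x}" h]
        by (simp only:)
    qed
    finally show ?thesis .
  qed
  have "((\<lambda>x. integral {-1..x} h + (LINT s|NI. (P s - 1) * h s)) has_real_derivative h x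
      + 0) (at x within {-1..1})"
    by (intro DERIV_add DERIV_const integral_has_real_derivative x continuous_on_subset[OF h]) auto
  then have "((\<lambda>x. integral {-1..x} h + (LINT s|NI. (P s - 1) * h s)) has_real_derivative h x)
      (at x within {-1..1})"
    by simp
  then show ?thesis
    by (rule has_field_derivative_transform_within[where d=1]) (use x eq in auto)
qed

text \<open>For continuous data both sides of the slice formula are continuous, so it holds at every
  point of the closed square and may be differentiated in x, one-sidedly at the edges.\<close>

lemma weak_dx_classical:
  assumes f: "continuous_on UNIV f" and g: "continuous_on UNIV g" and w: "weak_dx f g"
    and x: "x \<in> {-1..1}" and y: "y \<in> {-1..1}"
  shows "((\<lambda>x. f (x, y)) has_real_derivative g (x, y)) (at x within {-1..1})"
proof -
  note f' = continuous_imp_LL[OF f] and g' = continuous_imp_LL[OF g]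
  have eq: "f p = T1 r f p + T1 k g p" if "p \<in> Lam" for p
    by (rule continuous_AE_eq[OF _ _ slice_AE[OF f'(2,1) g'(2,1) w] that])
      (intro continuous_on_add T1_continuous kernel_r kernel_k f g continuous_on_subset[OF f subset_UNIV])+
  have gc: "continuous_on UNIV (\<lambda>s. g (s, y))"
    by (intro continuous_on_compose2[OF g] continuous_intros) auto
  have "((\<lambda>x. (LINT s|NI. \<rho> s * f (s, y)) + (LINT s|NI. k x s * g (s, y))) has_real_derivative 0
      + g (x, y)) (at x within {-1..1})"
    by (intro DERIV_add DERIV_const kernel_primitive_deriv[OF gc x])
  then have "((\<lambda>x. (LINT s|NI. \<rho> s * f (s, y)) + (LINT s|NI. k x s * g (s, y))) has_real_derivative
      g (x, y)) (at x within {-1..1})"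
    by simp
  then show ?thesis
    by (rule has_field_derivative_transform_within[where d=1])
      (use x y eq in \<open>auto simp: T1_def Lam_def\<close>)
qed

lemma weak_dy_classical:
  assumes f: "continuous_on UNIV f" and g: "continuous_on UNIV g" and w: "weak_dy f g"
    and x: "x \<in> {-1..1}" and y: "y \<in> {-1..1}"
  shows "((\<lambda>y. f (x, y)) has_real_derivative g (x, y)) (at y within {-1..1})"
proof -
  note f' = continuous_imp_LL[OF f] and g' = continuous_imp_LL[OF g]
  have c: "continuous_on UNIV (\<lambda>p. f (snd p, fst p))" "continuous_on UNIV (\<lambda>p. g (snd p, fst p))"
    by (intro continuous_on_compose2[OF f] continuous_on_compose2[OF g] continuous_intros; simp)+
  have "weak_dx (\<lambda>p. f (snd p, fst p)) (\<lambda>p. g (snd p, fst p))"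
    using w unfolding weak_dx_def weak_dy_def
    by (auto simp: pairing_swap f' g' test1_deriv)
  from weak_dx_classical[OF c this y x] show ?thesis by simp
qed

end

section \<open>Borel representatives of all weak derivatives\<close>

lemma pairing_cong:
  assumes "AE p in LL. f p = g p" "f \<in> borel_measurable borel" "g \<in> borel_measurable borel"
      "test1 a" "test1 b"
  shows "pairing f a b = pairing g a b"
  unfolding pairing_def
proof (rule integral_cong_AE)
  show "AE p in LL. f p * tensor a b p = g p * tensor a b p"
    using assms(1) by eventually_elim simp
qed (use assms tensor_borel[OF assms(4,5)] in \<open>auto intro!: borel_measurable_times\<close>)

lemma weak_dx_cong:
  assumes "weak_dx f g" "AE p in LL. f p = f' p" "AE p in LL. g p = g' p"
    "f \<in> borel_measurable borel" "g \<in> borel_measurable borel" "f' \<in> borel_measurable borel"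
        "g' \<in> borel_measurable borel"
  shows "weak_dx f' g'"
  using assms unfolding weak_dx_def by (metis pairing_cong test1_deriv)

lemma weak_dy_cong:
  assumes "weak_dy f g" "AE p in LL. f p = f' p" "AE p in LL. g p = g' p"
    "f \<in> borel_measurable borel" "g \<in> borel_measurable borel" "f' \<in> borel_measurable borel"
        "g' \<in> borel_measurable borel"
  shows "weak_dy f' g'"
  using assms unfolding weak_dy_def by (metis pairing_cong test1_deriv)

text \<open>A consistent choice of Borel representatives of all weak derivatives up to order three.\<close>

definition jet :: "(nat \<times> nat \<Rightarrow> real \<times> real \<Rightarrow> real) \<Rightarrow> bool" where
  "jet v \<longleftrightarrow> (\<forall>i j. i + j \<le> 3 \<longrightarrow> v (i, j) \<in> borel_measurable borel \<and> integrable LL (\<lambda>p. (v (i, j) p)\<^sup>2)) \<and>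
     (\<forall>i j. i + j \<le> 2 \<longrightarrow> has_weak_deriv (Suc 0, 0) (v (i, j)) (v (Suc i, j)) \<and>
        has_weak_deriv (0, Suc 0) (v (i, j)) (v (i, Suc j)))"

lemma jetD:
  assumes "jet v" "i + j \<le> 3"
  shows "v (i, j) \<in> borel_measurable borel" "integrable LL (\<lambda>p. (v (i, j) p)\<^sup>2)" "integrable LL (v (i, j))"
proof -
  show m: "v (i, j) \<in> borel_measurable borel" and s: "integrable LL (\<lambda>p. (v (i, j) p)\<^sup>2)"
    using assms by (auto simp: jet_def)
  show "integrable LL (v (i, j))"
    by (rule LL.square_integrable_imp_integrable[OF _ s]) (use m in simp)
qed

lemma jet_weak:
  assumes "jet v" "i + j \<le> 2"
  shows "has_weak_deriv (Suc 0, 0) (v (i, j)) (v (Suc i, j))" "has_weak_deriv (0, Suc 0) (v (i, j))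
      (v (i, Suc j))"
    "weak_dx (v (i, j)) (v (Suc i, j))" "weak_dy (v (i, j)) (v (i, Suc j))"
proof -
  show *: "has_weak_deriv (Suc 0, 0) (v (i, j)) (v (Suc i, j))"
      "has_weak_deriv (0, Suc 0) (v (i, j)) (v (i, Suc j))"
    using assms by (auto simp: jet_def)
  show "weak_dx (v (i, j)) (v (Suc i, j))" "weak_dy (v (i, j)) (v (i, Suc j))"
    using assms by (intro weak_dxI * weak_dyI jetD; simp)+
qed

lemma L2_Lam_imp_locally_integrable:
  assumes "u \<in> L2_Lam" shows "locally_integrable u"
proof -
  have um: "u \<in> borel_measurable (lebesgue_on Lam)" and u2: "integrable (lebesgue_on Lam) (\<lambda>p. (u p)\<^sup>2)"
    using assms by (auto simp: L2_Lam_def)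
  have f: "finite_measure (lebesgue_on Lam)"
    by (rule finite_measure_lebesgue_on) (intro lmeasurable_compact compact_Lam)
  show ?thesis
    by (intro locally_integrableI finite_measure.square_integrable_imp_integrable[OF f um u2])
qed

lemma L2_Lam_borel:
  assumes "u \<in> L2_Lam"
  obtains g where "g \<in> borel_measurable borel" "integrable LL (\<lambda>p. (g p)\<^sup>2)" "AE p in LL. u p = g p"
proof -
  have um: "u \<in> borel_measurable (lebesgue_on Lam)" and u2: "integrable (lebesgue_on Lam) (\<lambda>p. (u p)\<^sup>2)"
    using assms by (auto simp: L2_Lam_def)
  obtain g where g: "g \<in> borel_measurable borel" "AE p in lebesgue_on Lam. u p = g p"
    using lebesgue_on_ex_borel[OF um] by metis
  have gm: "(\<lambda>p. (g p)\<^sup>2) \<in> borel_measurable borel" using g by simp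
  have "AE p in lebesgue_on Lam. (u p)\<^sup>2 = (g p)\<^sup>2" using g(2) by eventually_elim simp
  from integrable_cong_AE_imp[OF u2 borel_imp_lebesgue_on[OF gm] this]
  have "integrable LL (\<lambda>p. (g p)\<^sup>2)" using integrable_LL[OF gm] by simp
  with g show thesis by (intro that) (auto simp: AE_lebesgue_on_Lam)
qed

lemma has_weak_deriv_refl:
  assumes "locally_integrable u" shows "has_weak_deriv (0, 0) u u"
  using assms by (simp add: has_weak_deriv_def mi_order_def classical_deriv_def)

text \<open>The representatives are chosen independently for each multi-index;
  \<open>weak_deriv_comp2\<close> then shows that neighbouring ones are weak derivatives of each
  other.\<close>

lemma H_Lam_jet:
  assumes u: "u \<in> H_Lam 3"
  obtains v where "jet v" "AE p in LL. u p = v (0, 0) p" "\<And>i j. i + j \<le> 3 \<Longrightarrow>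
      has_weak_deriv (i, j) u (v (i, j))"
proof -
  have uL: "u \<in> L2_Lam" using u by (simp add: H_Lam_def)
  have "\<exists>w. w \<in> borel_measurable borel \<and> integrable LL (\<lambda>p. (w p)\<^sup>2) \<and> has_weak_deriv \<gamma> u w"
      if \<gamma>: "mi_order \<gamma> \<le> 3" for \<gamma>
  proof -
    obtain w where w: "w \<in> L2_Lam" "has_weak_deriv \<gamma> u w" using u \<gamma> unfolding H_Lam_def by blast
    obtain g where g: "g \<in> borel_measurable borel" "integrable LL (\<lambda>p. (g p)\<^sup>2)" "AE p in LL. w p = g p"
      using L2_Lam_borel[OF w(1)] by metis
    have "integrable LL g"
      by (rule LL.square_integrable_imp_integrable[OF _ g(2)]) (use g in simp)
    then have "has_weak_deriv \<gamma> u g"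
      by (intro weak_deriv_cong_right[OF w(2) g(3)]) (simp add: integrable_LL g(1))
    with g show ?thesis by blast
  qed
  then obtain v where v: "\<And>\<gamma>. mi_order \<gamma> \<le> 3 \<Longrightarrow> v \<gamma> \<in> borel_measurable borel \<and>
      integrable LL (\<lambda>p. (v \<gamma> p)\<^sup>2) \<and> has_weak_deriv \<gamma> u (v \<gamma>)"
    by metis
  have w: "has_weak_deriv (i, j) u (v (i, j))" if "i + j \<le> 3" for i j
    using v[of "(i, j)"] that by (simp add: mi_order_def)
  have "jet v"
    unfolding jet_def
  proof (intro conjI allI impI)
    fix i j :: nat assume ij: "i + j \<le> 2"
    show "has_weak_deriv (Suc 0, 0) (v (i, j)) (v (Suc i, j))"
      using weak_deriv_comp2[of i j u "v (i, j)" "Suc 0" 0 "v (Suc i, j)"] w[of i j] w[of "Suc i" j]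
          ij by simp
    show "has_weak_deriv (0, Suc 0) (v (i, j)) (v (i, Suc j))"
      using weak_deriv_comp2[of i j u "v (i, j)" 0 "Suc 0" "v (i, Suc j)"] w[of i j] w[of i "Suc j"]
          ij by simp
  qed (use v in \<open>auto simp: mi_order_def\<close>)
  \<comment> \<open>\<open>v (0, 0)\<close> was obtained as a weak derivative of order zero;
    uniqueness identifies it with \<open>u\<close>.\<close>
  moreover have "AE p in LL. u p = v (0, 0) p"
    using weak_deriv_unique[OF has_weak_deriv_refl[OF L2_Lam_imp_locally_integrable[OF uL]]
        w[of 0 0]] by simp
  ultimately show thesis using w by (rule that)
qed

context averaging
begin

text \<open>The continuous representative of \<open>v (i, j)\<close>. It uses the derivative of
  order i + j + 2, which for a jet of order three means i + j at most one.\<close>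

definition crep :: "(nat \<times> nat \<Rightarrow> real \<times> real \<Rightarrow> real) \<Rightarrow> nat \<Rightarrow> nat \<Rightarrow> real \<times> real \<Rightarrow> real" where
  "crep v i j = rep (v (i, j)) (v (Suc i, j)) (v (i, Suc j)) (v (Suc i, Suc j))"

lemma crep:
  assumes v: "jet v" and ij: "i + j \<le> 1"
  shows "continuous_on UNIV (crep v i j)" "AE p in LL. v (i, j) p = crep v i j p"
proof -
  show "continuous_on UNIV (crep v i j)"
    unfolding crep_def using ij by (intro rep_continuous jetD(3)[OF v]) auto
  have "weak_dxy (v (i, j)) (v (Suc i, Suc j))"
    using ij by (intro weak_dxyI[of _ "v (Suc i, j)"] jet_weak[OF v]) auto
  then show "AE p in LL. v (i, j) p = crep v i j p"
    unfolding crep_def using ij by (intro rep_AE jetD[OF v] jet_weak[OF v]) auto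
qed

lemma crep_deriv:
  assumes v: "jet v" and x: "x \<in> {-1..1}" and y: "y \<in> {-1..1}"
  shows "((\<lambda>x. crep v 0 0 (x, y)) has_real_derivative crep v (Suc 0) 0 (x, y)) (at x within {-1..1})"
    and "((\<lambda>y. crep v 0 0 (x, y)) has_real_derivative crep v 0 (Suc 0) (x, y)) (at y within {-1..1})"
proof -
  have b: "crep v i j \<in> borel_measurable borel" if "i + j \<le> 1" for i j
    using crep(1)[OF v that] by (rule borel_measurable_continuous_onI)
  have "weak_dx (crep v 0 0) (crep v (Suc 0) 0)"
    by (rule weak_dx_cong[OF jet_weak(3)[OF v] crep(2)[OF v] crep(2)[OF v]]) (auto intro!: b jetD[OF v])
  then show "((\<lambda>x. crep v 0 0 (x, y)) has_real_derivative crep v (Suc 0) 0 (x, y)) (at x within {-1..1})"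
    by (intro weak_dx_classical x y crep[OF v]) auto
  have "weak_dy (crep v 0 0) (crep v 0 (Suc 0))"
    by (rule weak_dy_cong[OF jet_weak(4)[OF v] crep(2)[OF v] crep(2)[OF v]]) (auto intro!: b jetD[OF v])
  then show "((\<lambda>y. crep v 0 0 (x, y)) has_real_derivative crep v 0 (Suc 0) (x, y)) (at y within {-1..1})"
    by (intro weak_dy_classical x y crep[OF v]) auto
qed

text \<open>Partial derivatives combine to a total derivative because the y-partial is jointly
  continuous; everything is taken within the closed square.\<close>

lemma crep_C1:
  assumes v: "jet v" shows "crep v 0 0 \<in> C1_Lam"
  unfolding C1_Lam_def mem_Collect_eq
proof (intro exI conjI ballI)
  let ?g = "crep v (Suc 0) 0" and ?h = "crep v 0 (Suc 0)"
  show c: "continuous_on Lam ?g" "continuous_on Lam ?h"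
    by (rule continuous_on_subset[OF crep(1)[OF v]]; simp)+
  fix p assume "p \<in> Lam"
  then obtain x y where p: "p = (x, y)" and xy: "x \<in> {-1..1}" "y \<in> {-1..1}" by (auto simp: Lam_def)
  have "((\<lambda>(x, y). crep v 0 0 (x, y)) has_derivative
      (\<lambda>(tx, ty). ?g (x, y) * tx + blinfun_apply (blinfun_scaleR_left (?h (x, y))) ty)) (at (x, y)
          within {-1..1} \<times> {-1..1})"
  proof (rule has_derivative_partialsI[where fy="\<lambda>x y. blinfun_scaleR_left (?h (x, y))"])
    show "((\<lambda>x. crep v 0 0 (x, y)) has_derivative (*) (?g (x, y))) (at x within {-1..1})"
      using crep_deriv(1)[OF v xy] by (simp add: has_field_derivative_def)
    show "((\<lambda>y. crep v 0 0 (x, y)) has_derivative blinfun_apply (blinfun_scaleR_left (?h (x, y))))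
        (at y within {-1..1})"
      if "x \<in> {-1..1}" "y \<in> {-1..1}" for x y
      using crep_deriv(2)[OF v that] by (simp add: has_field_derivative_def mult.commute[of _ "?h (x, y)"])
    have "continuous_on Lam (\<lambda>p. blinfun_scaleR_left (?h p))"
      by (rule bounded_linear.continuous_on[OF bounded_linear_blinfun_scaleR_left c(2)])
    then have "continuous (at (x, y) within Lam) (\<lambda>p. blinfun_scaleR_left (?h p))"
      using xy by (auto simp: continuous_on_eq_continuous_within Lam_def)
    moreover have "(\<lambda>(x, y). blinfun_scaleR_left (?h (x, y))) = (\<lambda>p. blinfun_scaleR_left (?h p))"
      by auto
    ultimately show "continuous (at (x, y) within {-1..1} \<times> {-1..1}) (\<lambda>(x, y). blinfun_scaleR_left
        (?h (x, y)))"
      by (simp only: Lam_def)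
  qed (use xy in auto)
  then show "(crep v 0 0 has_derivative (\<lambda>(s, t). ?g p * s + ?h p * t)) (at p within Lam)"
    by (simp add: p Lam_def mult.commute[of _ "?h (x, y)"])
qed

text \<open>\<open>C1_rep\<close> is an arbitrary choice, but any admissible choice is continuous
  and agrees almost everywhere with \<open>crep v 0 0\<close>, hence everywhere on the square; the
  one-sided slopes follow.\<close>

lemma C1_rep_eq:
  assumes v: "jet v" and u: "AE p in LL. u p = v (0, 0) p" and p: "(x, y) \<in> Lam"
  shows "C1_rep u (x, y) = crep v 0 0 (x, y)" "partial_y (C1_rep u) (x, y) = crep v 0 (Suc 0) (x, y)"
proof -
  have "AE p in LL. v (0, 0) p = crep v 0 0 p" by (rule crep(2)[OF v]) simp
  with u have "AE p in LL. crep v 0 0 p = u p" by eventually_elim simp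
  then have "\<exists>w. w \<in> C1_Lam \<and> (AE p in lebesgue_on Lam. w p = u p)"
    using crep_C1[OF v] by (auto simp: AE_lebesgue_on_Lam)
  from someI_ex[OF this]
  have C: "C1_rep u \<in> C1_Lam" "AE p in LL. C1_rep u p = u p"
    by (auto simp: C1_rep_def AE_lebesgue_on_Lam)
  have "continuous_on Lam (C1_rep u)"
    using C(1) unfolding C1_Lam_def by (auto intro: has_derivative_continuous_on)
  moreover have "AE p in LL. C1_rep u p = crep v 0 0 p"
    using C(2) \<open>AE p in LL. crep v 0 0 p = u p\<close> by eventually_elim auto
  moreover have "continuous_on Lam (crep v 0 0)"
    by (rule continuous_on_subset[OF crep(1)[OF v]]) simp_all
  ultimately have eq: "C1_rep u q = crep v 0 0 q" if "q \<in> Lam" for q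
    using continuous_AE_eq that by blast
  show "C1_rep u (x, y) = crep v 0 0 (x, y)" by (rule eq[OF p])
  have xy: "x \<in> {-1..1}" "y \<in> {-1..1}" using p by (auto simp: Lam_def)
  have "((\<lambda>t. C1_rep u (x, t)) has_vector_derivative crep v 0 (Suc 0) (x, y)) (at y within {-1..1})"
    by (rule has_vector_derivative_transform[OF xy(2) _ crep_deriv(2)[OF v xy, unfolded
        has_real_derivative_iff_has_vector_derivative]])
      (use eq xy in \<open>auto simp: Lam_def\<close>)
  then show "partial_y (C1_rep u) (x, y) = crep v 0 (Suc 0) (x, y)"
    unfolding partial_y_def using vector_derivative_within_cbox[of "-1" 1 y] xy by simp
qed

end

section \<open>The macro-element interpolant\<close>

text \<open>A quadratic spline on \<open>[-1, 1]\<close> with knot \<open>0\<close> is a quadratic plus a multiple of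
  \<open>(max 0 y)\<^sup>2\<close>; here \<open>s\<^sub>1\<close>, \<open>s\<^sub>2\<close> are the constant second derivatives on the two halves,
  determined by the end values \<open>a\<close>, \<open>b\<close> and end slopes \<open>a'\<close>, \<open>b'\<close>.\<close>

definition s1 :: "real \<Rightarrow> real \<Rightarrow> real \<Rightarrow> real \<Rightarrow> real" where
  "s1 a a' b b' = (b - a) - (3 * a' + b') / 2"

definition s2 :: "real \<Rightarrow> real \<Rightarrow> real \<Rightarrow> real \<Rightarrow> real" where
  "s2 a a' b b' = (3 * b' + a') / 2 - (b - a)"

text \<open>The index \<open>n\<close> is the order of differentiation. At the knot the second
  derivative takes its left-hand value, a choice on a null set, and every \<open>n\<close> above two
  is treated like two.\<close>

definition spl :: "nat \<Rightarrow> real \<Rightarrow> real \<Rightarrow> real \<Rightarrow> real \<Rightarrow> real \<Rightarrow> real" where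
  "spl n a a' b b' y =
    (if n = 0 then a + a' * (y + 1) + s1 a a' b b' / 2 * (y + 1)\<^sup>2 + (s2 a a' b b' - s1 a a' b b')
        / 2 * (max 0 y)\<^sup>2
     else if n = 1 then a' + s1 a a' b b' * (y + 1) + (s2 a a' b b' - s1 a a' b b') * max 0 y
     else s1 a a' b b' + (s2 a a' b b' - s1 a a' b b') * (if y > 0 then 1 else 0))"

lemma max0_square_deriv: "((\<lambda>y::real. (max 0 y)\<^sup>2) has_real_derivative 2 * max 0 y) (at y)"
proof -
  consider "y > 0" | "y < 0" | "y = 0" by linarith
  then show ?thesis
  proof cases
    case 1
    have "((\<lambda>y. y\<^sup>2) has_real_derivative 2 * max 0 y) (at y)"
      using 1 by (auto intro!: derivative_eq_intros)
    then show ?thesis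
      by (rule has_field_derivative_transform_within_open[of _ _ _ "{0<..}"]) (use 1 in auto)
  next
    case 2
    have "((\<lambda>y. 0) has_real_derivative 2 * max 0 y) (at y)" using 2 by simp
    then show ?thesis
      by (rule has_field_derivative_transform_within_open[of _ _ _ "{..<0}"]) (use 2 in auto)
  next
    case 3
    have "((\<lambda>h::real. max 0 h) \<longlongrightarrow> max 0 0) (at 0)"
      by (intro tendsto_intros)
    moreover have "\<forall>\<^sub>F h in at (0::real). max 0 h = ((max 0 (0 + h))\<^sup>2 - (max 0 0)\<^sup>2) / h"
      by (auto simp: eventually_at_filter max_def power2_eq_square)
    ultimately have "((\<lambda>h::real. ((max 0 (0 + h))\<^sup>2 - (max 0 0)\<^sup>2) / h) \<longlongrightarrow> max 0 0) (at 0)"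
      by (rule Lim_transform_eventually)
    then show ?thesis using 3 by (simp add: DERIV_def)
  qed
qed

lemma spl_deriv0: "(spl 0 a a' b b' has_real_derivative spl 1 a a' b b' y) (at y)"
proof -
  let ?s = "s1 a a' b b'" and ?t = "s2 a a' b b'"
  have "((\<lambda>y. a + a' * (y + 1) + ?s / 2 * (y + 1)\<^sup>2) has_real_derivative a' + ?s * (y + 1)) (at y)"
    by (auto intro!: derivative_eq_intros simp: field_simps)
  from DERIV_add[OF this DERIV_cmult[OF max0_square_deriv, of "(?t - ?s) / 2"]]
  show ?thesis by (simp add: spl_def[abs_def])
qed

lemma max0_deriv: "y \<noteq> 0 \<Longrightarrow> ((\<lambda>y::real. max 0 y) has_real_derivative (if y > 0 then 1 else 0)) (at y)"
proof -
  assume "y \<noteq> 0"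
  then consider "y > 0" | "y < 0" by linarith
  then show ?thesis
  proof cases
    case 1
    have "((\<lambda>y. y) has_real_derivative (if y > 0 then 1 else 0)) (at y)" using 1 by simp
    then show ?thesis
      by (rule has_field_derivative_transform_within_open[of _ _ _ "{0<..}"]) (use 1 in auto)
  next
    case 2
    have "((\<lambda>y. 0) has_real_derivative (if y > 0 then 1 else 0)) (at y)" using 2 by simp
    then show ?thesis
      by (rule has_field_derivative_transform_within_open[of _ _ _ "{..<0}"]) (use 2 in auto)
  qed
qed

lemma spl_deriv1: "y \<noteq> 0 \<Longrightarrow> (spl 1 a a' b b' has_real_derivative spl 2 a a' b b' y) (at y)"
proof -
  assume y: "y \<noteq> 0"
  let ?s = "s1 a a' b b'" and ?t = "s2 a a' b b'"
  have "((\<lambda>y. a' + ?s * (y + 1)) has_real_derivative ?s) (at y)"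
    by (auto intro!: derivative_eq_intros)
  from DERIV_add[OF this DERIV_cmult[OF max0_deriv[OF y], of "?t - ?s"]]
  show ?thesis by (simp add: spl_def[abs_def])
qed

lemma spl_continuous: "n \<le> 1 \<Longrightarrow> continuous_on S (spl n a a' b b')"
proof -
  assume "n \<le> 1"
  then consider "n = 0" | "n = 1" by linarith
  then show ?thesis
    by cases (simp_all add: spl_def[abs_def] continuous_intros)
qed

text \<open>The conditions at 1, namely s1 + s2 = b' - a' and (3 s1 + s2) / 2 = b - a - 2 a', are
  the linear system solved by \<open>s1\<close> and \<open>s2\<close>.\<close>

lemma spl_ends:
  "spl 0 a a' b b' (-1) = a" "spl 0 a a' b b' 1 = b" "spl 1 a a' b b' (-1) = a'" "spl 1 a a' b b' 1 = b'"
  by (simp_all add: spl_def s1_def s2_def field_simps)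

lemma spl_end_derivs:
  "(spl 0 a a' b b' has_real_derivative a') (at (-1) within S)"
      "(spl 0 a a' b b' has_real_derivative b') (at 1 within S)"
  using has_field_derivative_at_within[OF spl_deriv0[of a a' b b' "-1"]]
    has_field_derivative_at_within[OF spl_deriv0[of a a' b b' 1]] by (simp_all only: spl_ends)

lemma spl_macro: "spl 0 a a' b b' \<in> C1_P2_macro"
  unfolding C1_P2_macro_def mem_Collect_eq
proof (intro conjI)
  show "\<exists>f'. continuous_on {-1..1} f' \<and> (\<forall>y\<in>{-1..1}. (spl 0 a a' b b' has_real_derivative f' y)
      (at y within {-1..1}))"
    by (intro exI[of _ "spl 1 a a' b b'"] conjI spl_continuous ballI
        has_field_derivative_at_within[OF spl_deriv0]) simp
  let ?s = "s1 a a' b b'" and ?t = "s2 a a' b b'"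
  show "\<exists>p. degree p \<le> 2 \<and> (\<forall>y\<in>{-1..0}. spl 0 a a' b b' y = poly p y)"
    by (intro exI[of _ "[:a + a' + ?s / 2, a' + ?s, ?s / 2:]"])
      (auto simp: spl_def max_def power2_eq_square algebra_simps add_divide_distrib)
  show "\<exists>q. degree q \<le> 2 \<and> (\<forall>y\<in>{0..1}. spl 0 a a' b b' y = poly q y)"
    by (intro exI[of _ "[:a + a' + ?s / 2, a' + ?s, ?t / 2:]"])
      (auto simp: spl_def max_def power2_eq_square algebra_simps add_divide_distrib diff_divide_distrib)
qed

section \<open>Identification of the basis functions\<close>

lemma poly_degree_2:
  fixes p :: "real poly"
  assumes "degree p \<le> 2" shows "poly p y = coeff p 0 + coeff p 1 * y + coeff p 2 * y\<^sup>2"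
proof -
  have "poly p y = (\<Sum>i\<le>2. coeff p i * y ^ i)"
    unfolding poly_altdef using assms
    by (intro sum.mono_neutral_left) (auto simp: coeff_eq_0)
  then show ?thesis by (simp add: numeral_2_eq_2)
qed

lemma real_deriv_unique_Icc:
  fixes a b :: real
  assumes "a < b" "x \<in> {a..b}" "(f has_real_derivative D) (at x within {a..b})"
      "(f has_real_derivative E) (at x within {a..b})"
  shows "D = E"
  using vector_derivative_unique_within_closed_interval[of a b x f D E] assms
  by (simp add: has_real_derivative_iff_has_vector_derivative)

text \<open>At the knot, continuity and a common derivative identify the constant and linear
  coefficients of the two quadratics. Four unknowns remain, and the four end data determine
  them.\<close>

lemma macro_unique:
  assumes f: "f \<in> C1_P2_macro" and da: "(f has_real_derivative a') (at (-1) within {-1..1})"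
    and db: "(f has_real_derivative b') (at 1 within {-1..1})" and y: "y \<in> {-1..1}"
  shows "f y = spl 0 (f (-1)) a' (f 1) b' y"
proof -
  obtain f' p q where f': "\<And>y. y \<in> {-1..1} \<Longrightarrow> (f has_real_derivative f' y) (at y within {-1..1})"
    and p: "degree p \<le> 2" "\<And>y. y \<in> {-1..0} \<Longrightarrow> f y = poly p y"
    and q: "degree q \<le> 2" "\<And>y. y \<in> {0..1} \<Longrightarrow> f y = poly q y"
    using f unfolding C1_P2_macro_def by blast
  define p0 p1 p2 q0 q1 q2 where c: "p0 = coeff p 0" "p1 = coeff p 1" "p2 = coeff p 2"
      "q0 = coeff q 0" "q1 = coeff q 1" "q2 = coeff q 2"
  have fp: "f y = p0 + p1 * y + p2 * y\<^sup>2" if "y \<in> {-1..0}" for y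
    using p(2)[OF that] poly_degree_2[OF p(1)] by (simp add: c)
  have fq: "f y = q0 + q1 * y + q2 * y\<^sup>2" if "y \<in> {0..1}" for y
    using q(2)[OF that] poly_degree_2[OF q(1)] by (simp add: c)
  have dp: "(f has_real_derivative p1 + 2 * p2 * y) (at y within {-1..0})" if "y \<in> {-1..0}" for y
  proof -
    have "((\<lambda>y. p0 + p1 * y + p2 * y\<^sup>2) has_real_derivative p1 + 2 * p2 * y) (at y within {-1..0})"
      by (auto intro!: derivative_eq_intros)
    then show ?thesis
      by (rule has_field_derivative_transform_within[where d=1]) (use that fp in auto)
  qed
  have dq: "(f has_real_derivative q1 + 2 * q2 * y) (at y within {0..1})" if "y \<in> {0..1}" for y
  proof -
    have "((\<lambda>y. q0 + q1 * y + q2 * y\<^sup>2) has_real_derivative q1 + 2 * q2 * y) (at y within {0..1})"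
      by (auto intro!: derivative_eq_intros)
    then show ?thesis
      by (rule has_field_derivative_transform_within[where d=1]) (use that fq in auto)
  qed
  have sub: "{-1..0} \<subseteq> {-1..1::real}" "{0..1} \<subseteq> {-1..1::real}" by auto
  have "a' = p1 + 2 * p2 * (-1)"
    by (rule real_deriv_unique_Icc[of "-1" 0 "-1" f, OF _ _ DERIV_subset[OF da sub(1)] dp]) auto
  moreover have "b' = q1 + 2 * q2 * 1"
    by (rule real_deriv_unique_Icc[of 0 1 1 f, OF _ _ DERIV_subset[OF db sub(2)] dq]) auto
  moreover have "f' 0 = p1 + 2 * p2 * 0"
    by (rule real_deriv_unique_Icc[of "-1" 0 0 f, OF _ _ DERIV_subset[OF f' sub(1)] dp]) auto
  moreover have "f' 0 = q1 + 2 * q2 * 0"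
    by (rule real_deriv_unique_Icc[of 0 1 0 f, OF _ _ DERIV_subset[OF f' sub(2)] dq]) auto
  moreover have "p0 = q0" using fp[of 0] fq[of 0] by simp
  moreover have "f (-1) = p0 - p1 + p2" "f 1 = q0 + q1 + q2" using fp[of "-1"] fq[of 1] by auto
  ultimately have e: "a' = p1 - 2 * p2" "b' = p1 + 2 * q2" "f (-1) = p0 - p1 + p2"
      "f 1 = p0 + p1 + q2" "q0 = p0" "q1 = p1"
    by auto
  have s: "s1 (f (-1)) a' (f 1) b' = 2 * p2" "s2 (f (-1)) a' (f 1) b' = 2 * q2"
    by (simp_all add: s1_def s2_def e field_simps)
  show ?thesis
  proof (cases "y \<le> 0")
    case True
    then have "f y = p0 + p1 * y + p2 * y\<^sup>2" using fp y by auto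
    then show ?thesis using True by (simp add: spl_def s) (simp add: e power2_eq_square field_simps)
  next
    case False
    then have "f y = p0 + p1 * y + q2 * y\<^sup>2" using fq[of y] y e by auto
    then show ?thesis using False by (simp add: spl_def s) (simp add: e power2_eq_square field_simps)
  qed
qed

text \<open>Existence comes from \<open>spl\<close>, uniqueness from \<open>macro_unique\<close>;
  together they resolve the choice in the definition, on the interval only.\<close>

lemma macro_phi_eq:
  assumes "y \<in> {-1..1}" "j \<in> {-1, 1}"
  shows "macro_phi j y = spl 0 (of_bool (j = -1)) 0 (of_bool (j = 1)) 0 y"
proof -
  let ?f = "spl 0 (of_bool (j = -1)) 0 (of_bool (j = 1)) 0"
  have "is_macro_phi j ?f"
    unfolding is_macro_phi_def
    using assms(2) by (auto simp: spl_macro spl_ends intro!: spl_end_derivs)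
  then have "is_macro_phi j (macro_phi j)"
    unfolding macro_phi_def by (rule someI[of "is_macro_phi j"])
  then have m: "macro_phi j \<in> C1_P2_macro" "macro_phi j (-1) = of_bool (j = -1)"
      "macro_phi j 1 = of_bool (j = 1)"
    "(macro_phi j has_real_derivative 0) (at (-1) within {-1..1})"
        "(macro_phi j has_real_derivative 0) (at 1 within {-1..1})"
    by (auto simp: is_macro_phi_def)
  show ?thesis using macro_unique[OF m(1,4,5) assms(1)] by (simp only: m(2,3))
qed

lemma macro_psi_eq:
  assumes "y \<in> {-1..1}" "j \<in> {-1, 1}"
  shows "macro_psi j y = spl 0 0 (of_bool (j = -1)) 0 (of_bool (j = 1)) y"
proof -
  let ?f = "spl 0 0 (of_bool (j = -1)) 0 (of_bool (j = 1))"
  have "is_macro_psi j ?f"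
    unfolding is_macro_psi_def
    using assms(2) by (auto simp: spl_macro spl_ends intro!: spl_end_derivs)
  then have "is_macro_psi j (macro_psi j)"
    unfolding macro_psi_def by (rule someI[of "is_macro_psi j"])
  then have m: "macro_psi j \<in> C1_P2_macro" "macro_psi j (-1) = 0" "macro_psi j 1 = 0"
    "(macro_psi j has_real_derivative of_bool (j = -1)) (at (-1) within {-1..1})"
    "(macro_psi j has_real_derivative of_bool (j = 1)) (at 1 within {-1..1})"
    by (auto simp: is_macro_psi_def)
  show ?thesis using macro_unique[OF m(1,4,5) assms(1)] by (simp only: m(2,3))
qed

text \<open>The index \<open>m\<close> is the order of differentiation. One formula covers both end
  nodes, since their sign enters as \<open>i\<close>.\<close>

definition lag :: "nat \<Rightarrow> real \<Rightarrow> real \<Rightarrow> real" where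
  "lag m i x = (if i = 0 then (if m = 0 then 1 - x\<^sup>2 else if m = 1 then - 2 * x else - 2)
    else (if m = 0 then x * (x + i) / 2 else if m = 1 then x + i / 2 else 1))"

lemma lagrange_eq: "i \<in> {-1, 0, 1} \<Longrightarrow> lagrange i x = lag 0 i x"
proof -
  have s: "{-1, 0, 1} - {-1::real} = {0, 1}" "{-1, 0, 1} - {0::real} = {-1, 1}"
      "{-1, 0, 1} - {1::real} = {-1, 0}"
    by auto
  have "lagrange (-1) x = lag 0 (-1) x" unfolding lagrange_def s by (simp add: lag_def field_simps)
  moreover have "lagrange 0 x = lag 0 0 x" unfolding lagrange_def s by (simp add: lag_def
      field_simps power2_eq_square)
  moreover have "lagrange 1 x = lag 0 1 x" unfolding lagrange_def s by (simp add: lag_def field_simps)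
  ultimately show "i \<in> {-1, 0, 1} \<Longrightarrow> lagrange i x = lag 0 i x" by blast
qed

lemma lag_deriv: "m \<le> 1 \<Longrightarrow> (lag m i has_real_derivative lag (Suc m) i x) (at x)"
  unfolding lag_def
  by (cases "m = 0") (auto intro!: derivative_eq_intros simp: field_simps)

text \<open>The \<open>(m, n)\<close>-th derivative of the interpolant with nodal values \<open>U\<close> and \<open>y\<close>-slopes \<open>W\<close>.\<close>

definition interp :: "nat \<Rightarrow> nat \<Rightarrow> (real \<times> real \<Rightarrow> real) \<Rightarrow> (real \<times> real \<Rightarrow> real) \<Rightarrow> real \<times> real \<Rightarrow> real" where
  "interp m n U W p = (\<Sum>i\<in>{-1, 0, 1}. lag m i (fst p) * spl n (U (i, -1)) (W (i, -1)) (U (i, 1))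
      (W (i, 1)) (snd p))"

text \<open>Linearity in the end data collects the two value functions and the two slope functions
  at an x-node into one spline.\<close>

lemma spl_superpose:
  "spl 0 a a' b b' y = a * spl 0 1 0 0 0 y + a' * spl 0 0 1 0 0 y + b * spl 0 0 0 1 0 y
      + b' * spl 0 0 0 0 1 y"
  by (simp add: spl_def s1_def s2_def field_simps)

lemma Pi_y_eq:
  assumes "p \<in> Lam"
  shows "Pi_y u p = interp 0 0 u (partial_y u) p"
proof -
  obtain x y where p: "p = (x, y)" "y \<in> {-1..1}" using assms by (auto simp: Lam_def)
  show ?thesis
    unfolding Pi_y_def interp_def p(1) prod.case fst_conv snd_conv
  proof (rule sum.cong[OF refl])
    fix i :: real assume i: "i \<in> {-1, 0, 1}"
    have "macro_phi (-1) y = spl 0 1 0 0 0 y" "macro_phi 1 y = spl 0 0 0 1 0 y"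
      "macro_psi (-1) y = spl 0 0 1 0 0 y" "macro_psi 1 y = spl 0 0 0 0 1 y"
      using macro_phi_eq[OF p(2), of "-1"] macro_phi_eq[OF p(2), of 1] macro_psi_eq[OF p(2), of
          "-1"] macro_psi_eq[OF p(2), of 1]
      by simp_all
    then show "(\<Sum>j\<in>{-1, 1}. u (i, j) * lagrange i x * macro_phi j y + partial_y u (i, j)
        * lagrange i x * macro_psi j y)
        = lag 0 i x * spl 0 (u (i, -1)) (partial_y u (i, -1)) (u (i, 1)) (partial_y u (i, 1)) y"
      using lagrange_eq[OF i] spl_superpose[of "u (i, -1)" "partial_y u (i, -1)" "u (i, 1)"
          "partial_y u (i, 1)" y]
      by (simp add: algebra_simps)
  qed
qed

lemma spl_borel [measurable]: "spl n a a' b b' \<in> borel_measurable borel"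
  unfolding spl_def by measurable

lemma lag_borel [measurable]: "lag m i \<in> borel_measurable borel"
  unfolding lag_def by measurable

lemma interp_borel: "interp m n U W \<in> borel_measurable borel"
  unfolding interp_def borel_prod[symmetric] by measurable

lemma lag_bound: "x \<in> {-1..1} \<Longrightarrow> i \<in> {-1, 0, 1} \<Longrightarrow> \<bar>lag m i x\<bar> \<le> 2"
proof -
  assume x: "x \<in> {-1..1}" and i: "i \<in> {-1, 0, 1}"
  have "\<bar>x\<bar> \<le> 1" "x\<^sup>2 \<le> 1" "0 \<le> x\<^sup>2" using x by (auto simp: abs_square_le_1)
  then show ?thesis using i by (auto simp: lag_def power2_eq_square field_simps abs_le_iff)
      ((use zero_le_square[of x] in linarith)+)
qed

text \<open>The bound for order \<open>n\<close> uses only data combinations that vanish on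
  polynomials of degree below \<open>n\<close>. For the second derivative put d = b' - a' and e = (b
  - a) - (a' + b'), the error of the trapezoidal rule for the slope; then s1 = e + d / 2 and s2 = d
  / 2 - e. The constant 20 is generous.\<close>

lemma spl_bound:
  assumes y: "y \<in> {-1..1}"
  shows "\<bar>spl 0 a a' b b' y\<bar> \<le> 20 * (\<bar>a\<bar> + \<bar>a'\<bar> + \<bar>b\<bar> + \<bar>b'\<bar>)"
    "\<bar>spl 1 a a' b b' y\<bar> \<le> 20 * (\<bar>a'\<bar> + \<bar>b'\<bar> + \<bar>b - a\<bar>)"
    "n \<ge> 2 \<Longrightarrow> \<bar>spl n a a' b b' y\<bar> \<le> 20 * (\<bar>b' - a'\<bar> + \<bar>(b - a) - (a' + b')\<bar>)"
proof -
  define u m where um: "u = y + 1" "m = max 0 y"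
  have w: "\<bar>u\<bar> \<le> 2" "\<bar>u\<^sup>2\<bar> \<le> 4" "\<bar>m\<bar> \<le> 1" "\<bar>m\<^sup>2\<bar> \<le> 1"
    using y power_mono[of u 2 2] by (auto simp: um abs_square_le_1)
  have h: "\<bar>c * w\<bar> \<le> K * \<bar>c\<bar>" if "\<bar>w\<bar> \<le> K" for c w K :: real
    using mult_left_mono[OF that, of "\<bar>c\<bar>"] by (simp add: abs_mult mult.commute)
  let ?s = "s1 a a' b b'" and ?t = "s2 a a' b b'"
  have s: "\<bar>?s\<bar> \<le> \<bar>a\<bar> + \<bar>b\<bar> + 2 * \<bar>a'\<bar> + \<bar>b'\<bar>" "\<bar>?t\<bar> \<le> \<bar>a\<bar> + \<bar>b\<bar> + \<bar>a'\<bar> + 2 * \<bar>b'\<bar>"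
    "\<bar>?s\<bar> \<le> \<bar>b - a\<bar> + 2 * \<bar>a'\<bar> + \<bar>b'\<bar>" "\<bar>?t\<bar> \<le> \<bar>b - a\<bar> + \<bar>a'\<bar> + 2 * \<bar>b'\<bar>"
    "\<bar>?s\<bar> \<le> \<bar>b' - a'\<bar> + \<bar>(b - a) - (a' + b')\<bar>" "\<bar>?t\<bar> \<le> \<bar>b' - a'\<bar> + \<bar>(b - a) - (a' + b')\<bar>"
    unfolding s1_def s2_def by argo+
  have ts: "\<bar>?t - ?s\<bar> \<le> \<bar>?t\<bar> + \<bar>?s\<bar>" by (rule abs_triangle_ineq4)
  \<comment> \<open>In these three facts every absolute value is a free variable, which leaves pure
    linear arithmetic.\<close>
  have g0: "X \<le> 20 * (p + p' + q + q')" if "X \<le> p + 2 * p' + 2 * S + D / 2" "S \<le> p + q + 2 * p' + q'"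
      "T \<le> p + q + p' + 2 * q'" "D \<le> T + S" "0 \<le> p" "0 \<le> p'" "0 \<le> q" "0 \<le> q'" for X p p' q q' S T D :: real
    using that by argo
  have g1: "X \<le> 20 * (p' + q' + d)" if "X \<le> p' + 2 * S + 1 * D" "S \<le> d + 2 * p' + q'"
      "T \<le> d + p' + 2 * q'" "D \<le> T + S" "0 \<le> p'" "0 \<le> q'" "0 \<le> d" for X p' q' d S T D :: real
    using that by argo
  have g2: "X \<le> 20 * (d + e)" if "X \<le> S + D" "S \<le> d + e" "T \<le> d + e" "D \<le> T + S" "0 \<le> d" "0 \<le> e"
    for X d e S T D :: real
    using that by argo
  have tri: "\<bar>x + y + z + w\<bar> \<le> \<bar>x\<bar> + \<bar>y\<bar> + \<bar>z\<bar> + \<bar>w\<bar>" for x y z w :: real by arith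
  have "\<bar>spl 0 a a' b b' y\<bar> \<le> \<bar>a\<bar> + \<bar>a' * u\<bar> + \<bar>?s / 2 * u\<^sup>2\<bar> + \<bar>(?t - ?s) / 2 * m\<^sup>2\<bar>"
    using tri[of a "a' * u" "?s / 2 * u\<^sup>2" "(?t - ?s) / 2 * m\<^sup>2"] by (simp add: spl_def um)
  also have "\<dots> \<le> \<bar>a\<bar> + 2 * \<bar>a'\<bar> + 4 * \<bar>?s / 2\<bar> + 1 * \<bar>(?t - ?s) / 2\<bar>"
    using h[OF w(1), of a'] h[OF w(2), of "?s / 2"] h[OF w(4), of "(?t - ?s) / 2"] by linarith
  also have "\<dots> = \<bar>a\<bar> + 2 * \<bar>a'\<bar> + 2 * \<bar>?s\<bar> + \<bar>?t - ?s\<bar> / 2" by simp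
  finally show "\<bar>spl 0 a a' b b' y\<bar> \<le> 20 * (\<bar>a\<bar> + \<bar>a'\<bar> + \<bar>b\<bar> + \<bar>b'\<bar>)"
    by (rule g0[OF _ s(1,2) ts]) simp_all
  have "\<bar>spl 1 a a' b b' y\<bar> \<le> \<bar>a'\<bar> + \<bar>?s * u\<bar> + \<bar>(?t - ?s) * m\<bar> + \<bar>0\<bar>"
    using tri[of a' "?s * u" "(?t - ?s) * m" 0] by (simp add: spl_def um)
  also have "\<dots> \<le> \<bar>a'\<bar> + 2 * \<bar>?s\<bar> + 1 * \<bar>?t - ?s\<bar>"
    using h[OF w(1), of ?s] h[OF w(3), of "?t - ?s"] by linarith
  finally show "\<bar>spl 1 a a' b b' y\<bar> \<le> 20 * (\<bar>a'\<bar> + \<bar>b'\<bar> + \<bar>b - a\<bar>)"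
    by (rule g1[OF _ s(3,4) ts]) simp_all
  show "\<bar>spl n a a' b b' y\<bar> \<le> 20 * (\<bar>b' - a'\<bar> + \<bar>(b - a) - (a' + b')\<bar>)" if n: "n \<ge> 2"
  proof -
    have "\<bar>spl n a a' b b' y\<bar> \<le> \<bar>?s\<bar> + \<bar>?t - ?s\<bar>" 
      using n abs_triangle_ineq[of ?s "?t - ?s"] by (simp add: spl_def)
    then show ?thesis
      by (rule g2[OF _ s(5,6) ts]) simp_all
  qed
qed

lemma spl_bounded: "\<exists>K. \<forall>y\<in>{-1..1}. \<bar>spl n a a' b b' y\<bar> \<le> K"
proof -
  consider "n = 0" | "n = 1" | "n \<ge> 2" by linarith
  then show ?thesis
  proof cases
    case 1
    then show ?thesis using spl_bound(1)[of _ a a' b b'] by blast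
  next
    case 2
    then show ?thesis using spl_bound(2)[of _ a a' b b'] by blast
  next
    case 3
    then show ?thesis using spl_bound(3)[of _ n a a' b b'] by blast
  qed
qed

lemma interp_bounded:
  obtains K where "\<And>p. p \<in> Lam \<Longrightarrow> \<bar>interp m n U W p\<bar> \<le> K"
proof -
  have "\<forall>i. \<exists>K. \<forall>y\<in>{-1..1}. \<bar>spl n (U (i, -1)) (W (i, -1)) (U (i, 1)) (W (i, 1)) y\<bar> \<le> K"
    using spl_bounded by blast
  from choice[OF this] obtain K where K:
    "\<And>i y. y \<in> {-1..1} \<Longrightarrow> \<bar>spl n (U (i, -1)) (W (i, -1)) (U (i, 1)) (W (i, 1)) y\<bar> \<le> K i"
    by blast
  have "\<bar>interp m n U W p\<bar> \<le> (\<Sum>i\<in>{-1, 0, 1}. 2 * K i)" if p: "p \<in> Lam" for p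
    unfolding interp_def
  proof (rule order_trans[OF sum_abs], rule sum_mono)
    fix i :: real assume i: "i \<in> {-1, 0, 1}"
    have "fst p \<in> {-1..1}" "snd p \<in> {-1..1}" using p by (auto simp: Lam_def)
    then show "\<bar>lag m i (fst p) * spl n (U (i, -1)) (W (i, -1)) (U (i, 1)) (W (i, 1)) (snd p)\<bar> \<le> 2 * K i"
      unfolding abs_mult by (intro mult_mono lag_bound K i) auto
  qed
  then show thesis by (rule that)
qed

lemma interp_dx:
  assumes m: "m \<le> 1"
  shows "has_weak_deriv (Suc 0, 0) (interp m n U W) (interp (Suc m) n U W)"
proof -
  obtain K where K: "\<And>p. p \<in> Lam \<Longrightarrow> \<bar>interp m n U W p\<bar> \<le> K" using interp_bounded[of m n U W] by metis
  obtain L where L: "\<And>p. p \<in> Lam \<Longrightarrow> \<bar>interp (Suc m) n U W p\<bar> \<le> L"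
      using interp_bounded[of "Suc m" n U W] by metis
  have d: "((\<lambda>x. interp m n U W (x, y)) has_real_derivative interp (Suc m) n U W (x, y)) (at x)" for x y
    unfolding interp_def fst_conv snd_conv by (intro DERIV_sum DERIV_cmult_right lag_deriv m)
  show ?thesis
  proof (rule weak_deriv_piecewise_x[where B="max K L" and S="{}"])
    show "continuous_on {-1..1} (\<lambda>x. interp m n U W (x, y))" for y
      by (intro continuous_at_imp_continuous_on ballI DERIV_isCont[OF d])
  qed (use K L d interp_borel in \<open>auto simp: le_max_iff_disj\<close>)
qed

lemma interp_dy:
  assumes n: "n \<le> 1"
  shows "has_weak_deriv (0, Suc 0) (interp m n U W) (interp m (Suc n) U W)"
proof -
  obtain K where K: "\<And>p. p \<in> Lam \<Longrightarrow> \<bar>interp m n U W p\<bar> \<le> K" using interp_bounded[of m n U W] by metis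
  obtain L where L: "\<And>p. p \<in> Lam \<Longrightarrow> \<bar>interp m (Suc n) U W p\<bar> \<le> L"
      using interp_bounded[of m "Suc n" U W] by metis
  have s: "(spl n a a' b b' has_real_derivative spl (Suc n) a a' b b' y) (at y)" if "y \<noteq> 0" for a a' b b' y
    using n that spl_deriv0[of a a' b b' y] spl_deriv1[of y a a' b b'] by (cases "n
        = 0") (auto simp: le_Suc_eq numeral_2_eq_2)
  have d: "((\<lambda>y. interp m n U W (x, y)) has_real_derivative interp m (Suc n) U W (x, y)) (at y)"
      if "y \<noteq> 0" for x y
    unfolding interp_def fst_conv snd_conv by (intro DERIV_sum DERIV_cmult s that)
  show ?thesis
  proof (rule weak_deriv_piecewise_y[where B="max K L" and S="{0}"])
    show "continuous_on {-1..1} (\<lambda>y. interp m n U W (x, y))" for x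
      unfolding interp_def fst_conv snd_conv by (intro continuous_intros spl_continuous n)
  qed (use K L d interp_borel in \<open>auto simp: le_max_iff_disj\<close>)
qed

lemma interp_weak_deriv:
  assumes "m \<le> 2" "n \<le> 2"
  shows "has_weak_deriv (m, n) (interp 0 0 U W) (interp m n U W)"
proof -
  obtain K where K: "\<And>p. p \<in> Lam \<Longrightarrow> \<bar>interp 0 0 U W p\<bar> \<le> K" using interp_bounded[of 0 0 U W] by metis
  have 0: "has_weak_deriv (0, 0) (interp 0 0 U W) (interp 0 0 U W)"
    by (rule has_weak_deriv_refl[OF bounded_borel_locally_integrable[OF interp_borel K]])
  have x: "has_weak_deriv (m, 0) (interp 0 0 U W) (interp m 0 U W)" if "m \<le> 2" for m
    using that
  proof (induction m)
    case (Suc m)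
    then have "has_weak_deriv (m + Suc 0, 0 + 0) (interp 0 0 U W) (interp (Suc m) 0 U W)"
      by (intro weak_deriv_comp1[of m 0 _ "interp m 0 U W"] interp_dx) auto
    then show ?case by simp
  qed (use 0 in simp)
  show ?thesis using assms(2)
  proof (induction n)
    case (Suc n)
    then have "has_weak_deriv (m + 0, n + Suc 0) (interp 0 0 U W) (interp m (Suc n) U W)"
      by (intro weak_deriv_comp1[of m n _ "interp m n U W"] interp_dy) auto
    then show ?case by simp
  qed (use x assms in simp)
qed

section \<open>Linearity of the interpolant and reproduction of quadratics\<close>

lemma spl_diff:
  "spl n (a - c) (a' - c') (b - d) (b' - d') y = spl n a a' b b' y - spl n c c' d d' y"
  by (simp add: spl_def s1_def s2_def field_simps)

lemma interp_diff:
  "interp m n (\<lambda>p. U p - U' p) (\<lambda>p. W p - W' p) p = interp m n U W p - interp m n U' W' p"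
  by (simp add: interp_def spl_diff right_diff_distrib sum_subtractf)

lemma interp_cong:
  assumes "\<And>x y. (x, y) \<in> Lam \<Longrightarrow> U (x, y) = U' (x, y)" "\<And>x y. (x, y) \<in> Lam \<Longrightarrow> W (x, y) = W' (x, y)"
  shows "interp m n U W = interp m n U' W'"
proof
  fix p
  have "U (i, j) = U' (i, j)" "W (i, j) = W' (i, j)" if "i \<in> {-1, 0, 1}" "j \<in> {-1, 1}" for i j :: real
    using that by (auto intro!: assms simp: Lam_def)
  then show "interp m n U W p = interp m n U' W' p"
    unfolding interp_def by (intro sum.cong) auto
qed

text \<open>The partial derivatives of a polynomial of total degree two.\<close>

definition quad :: "real \<Rightarrow> real \<Rightarrow> real \<Rightarrow> real \<Rightarrow> real \<Rightarrow> real \<Rightarrow> nat \<times> nat \<Rightarrow> real \<times> real \<Rightarrow> real" where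
  "quad c00 c10 c01 c20 c11 c02 \<gamma> p =
    (if \<gamma> = (0, 0) then c00 + c10 * fst p + c01 * snd p + c20 / 2 * (fst p)\<^sup>2 + c11 * fst p * snd p
        + c02 / 2 * (snd p)\<^sup>2
     else if \<gamma> = (Suc 0, 0) then c10 + c20 * fst p + c11 * snd p
     else if \<gamma> = (0, Suc 0) then c01 + c11 * fst p + c02 * snd p
     else if \<gamma> = (2, 0) then c20 else if \<gamma> = (Suc 0, Suc 0) then c11 else if \<gamma> = (0, 2) then c02 else 0)"

lemma quad_third: "i + j = 3 \<Longrightarrow> quad c00 c10 c01 c20 c11 c02 (i, j) p = 0"
  by (auto simp: quad_def)

lemma quad_continuous: "continuous_on S (quad c00 c10 c01 c20 c11 c02 \<gamma>)"
  unfolding quad_def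
  by (cases "\<gamma> = (0, 0)"; cases "\<gamma> = (Suc 0, 0)"; cases "\<gamma> = (0, Suc 0)"; simp; intro
      continuous_intros; simp)

lemma quad_deriv:
  assumes "i + j \<le> 2"
  shows "((\<lambda>x. quad c00 c10 c01 c20 c11 c02 (i, j) (x, y)) has_real_derivative quad c00 c10 c01 c20
      c11 c02 (Suc i, j) (x, y)) (at x)"
    "((\<lambda>y. quad c00 c10 c01 c20 c11 c02 (i, j) (x, y)) has_real_derivative quad c00 c10 c01 c20 c11
        c02 (i, Suc j) (x, y)) (at y)"
proof -
  have "(i, j) \<in> {(0, 0), (Suc 0, 0), (0, Suc 0), (2, 0), (Suc 0, Suc 0), (0, 2)}"
    using assms by (cases i; cases j; auto simp: numeral_2_eq_2 le_Suc_eq)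
  then show "((\<lambda>x. quad c00 c10 c01 c20 c11 c02 (i, j) (x, y)) has_real_derivative quad c00 c10 c01
      c20 c11 c02 (Suc i, j) (x, y)) (at x)"
    "((\<lambda>y. quad c00 c10 c01 c20 c11 c02 (i, j) (x, y)) has_real_derivative quad c00 c10 c01 c20 c11
        c02 (i, Suc j) (x, y)) (at y)"
    unfolding quad_def by (auto simp: numeral_2_eq_2 intro!: derivative_eq_intros)
qed

lemma jet_quad: "jet (quad c00 c10 c01 c20 c11 c02)"
  unfolding jet_def
proof (intro conjI allI impI)
  let ?q = "quad c00 c10 c01 c20 c11 c02"
  fix i j :: nat
  show "?q (i, j) \<in> borel_measurable borel" "integrable LL (\<lambda>p. (?q (i, j) p)\<^sup>2)"
    by (intro continuous_imp_LL quad_continuous continuous_intros)+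
  have "\<forall>\<gamma>. \<exists>K. \<forall>p\<in>Lam. \<bar>?q \<gamma> p\<bar> \<le> K"
  proof
    fix \<gamma>
    have "bounded (?q \<gamma> ` Lam)"
      by (intro compact_imp_bounded compact_continuous_image compact_Lam quad_continuous)
    then show "\<exists>K. \<forall>p\<in>Lam. \<bar>?q \<gamma> p\<bar> \<le> K" unfolding bounded_iff by auto
  qed
  from choice[OF this] obtain K where K: "\<And>p \<gamma>. p \<in> Lam \<Longrightarrow> \<bar>?q \<gamma> p\<bar> \<le> K \<gamma>" by blast
  assume ij: "i + j \<le> 2"
  show "has_weak_deriv (Suc 0, 0) (?q (i, j)) (?q (Suc i, j))"
  proof (rule weak_deriv_piecewise_x[where B="max (K (i, j)) (K (Suc i, j))" and S="{}"])
    show "continuous_on {-1..1} (\<lambda>x. ?q (i, j) (x, y))" for y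
      by (intro continuous_at_imp_continuous_on ballI DERIV_isCont[OF quad_deriv(1)[OF ij]])
  qed (use K quad_deriv[OF ij] quad_continuous in \<open>auto intro: borel_measurable_continuous_onI simp:
      le_max_iff_disj\<close>)
  show "has_weak_deriv (0, Suc 0) (?q (i, j)) (?q (i, Suc j))"
  proof (rule weak_deriv_piecewise_y[where B="max (K (i, j)) (K (i, Suc j))" and S="{}"])
    show "continuous_on {-1..1} (\<lambda>y. ?q (i, j) (x, y))" for x
      by (intro continuous_at_imp_continuous_on ballI DERIV_isCont[OF quad_deriv(2)[OF ij]])
  qed (use K quad_deriv[OF ij] quad_continuous in \<open>auto intro: borel_measurable_continuous_onI simp:
      le_max_iff_disj\<close>)
qed

text \<open>For data of a single quadratic both second derivatives equal
  \<open>2 * \<gamma>\<close>, so the knot term disappears.\<close>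

lemma spl_quadratic:
  "spl n (\<alpha> - \<beta> + \<gamma>) (\<beta> - 2 * \<gamma>) (\<alpha> + \<beta> + \<gamma>) (\<beta> + 2 * \<gamma>) y =
    (if n = 0 then \<alpha> + \<beta> * y + \<gamma> * y\<^sup>2 else if n = 1 then \<beta> + 2 * \<gamma> * y else 2 * \<gamma>)"
proof -
  have "s1 (\<alpha> - \<beta> + \<gamma>) (\<beta> - 2 * \<gamma>) (\<alpha> + \<beta> + \<gamma>) (\<beta> + 2 * \<gamma>) = 2 * \<gamma>"
    "s2 (\<alpha> - \<beta> + \<gamma>) (\<beta> - 2 * \<gamma>) (\<alpha> + \<beta> + \<gamma>) (\<beta> + 2 * \<gamma>) = 2 * \<gamma>"
    by (simp_all add: s1_def s2_def field_simps)
  then show ?thesis by (simp add: spl_def power2_eq_square algebra_simps)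
qed

text \<open>At each x-node the spline reproduces the quadratic in y. Its coefficients there are
  polynomials of degree at most two in the node, so Lagrange interpolation in x is exact as well,
  including derivatives.\<close>

lemma interp_quad:
  assumes "m + n \<le> 2"
  shows "interp m n (quad c00 c10 c01 c20 c11 c02 (0, 0)) (quad c00 c10 c01 c20 c11 c02 (0, Suc 0)) p
    = quad c00 c10 c01 c20 c11 c02 (m, n) p"
proof -
  let ?q = "quad c00 c10 c01 c20 c11 c02"
  have s: "spl n (?q (0, 0) (i, -1)) (?q (0, Suc 0) (i, -1)) (?q (0, 0) (i, 1)) (?q (0, Suc 0)
      (i, 1)) (snd p)
      = (let \<alpha> = c00 + c10 * i + c20 / 2 * i\<^sup>2; \<beta> = c01 + c11 * i; \<gamma> = c02 / 2 in
         if n = 0 then \<alpha> + \<beta> * snd p + \<gamma> * (snd p)\<^sup>2 else if n = 1 then \<beta> + 2 * \<gamma> * snd p else 2 * \<gamma>)" for i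
    unfolding Let_def spl_quadratic[symmetric] by (simp add: quad_def algebra_simps)
  have "(m, n) \<in> {(0, 0), (Suc 0, 0), (0, Suc 0), (2, 0), (Suc 0, Suc 0), (0, 2)}"
    using assms by (cases m; cases n; auto simp: numeral_2_eq_2 le_Suc_eq)
  then show ?thesis
    unfolding interp_def s by (auto simp: Let_def lag_def quad_def power2_eq_square field_simps)
qed

section \<open>The error estimate\<close>

definition nr :: "(real \<times> real \<Rightarrow> real) \<Rightarrow> real" where
  "nr f = sqrt (LINT p|LL. (f p)\<^sup>2)"

lemma nr_nonneg [simp]: "0 \<le> nr f"
  by (simp add: nr_def)

text \<open>Here \<open>f\<close> will be a chosen weak derivative, which need not be Borel;
  completeness of Lebesgue measure makes it measurable.\<close>

lemma L2_norm_eq_nr: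
  assumes ae: "AE p in LL. f p = g p" and g: "g \<in> borel_measurable borel"
  shows "L2_norm f = nr g"
proof -
  have gl: "g \<in> borel_measurable lebesgue" by (intro measurable_completion) (simp add: g)
  have a: "AE p in lebesgue. indicator Lam p *\<^sub>R g p = indicator Lam p *\<^sub>R f p"
    using ae unfolding AE_LL AE_completion_iff by eventually_elim (auto simp: indicator_def)
  have "(\<lambda>p. indicator Lam p *\<^sub>R g p) \<in> borel_measurable lebesgue"
    by (intro borel_measurable_scaleR borel_measurable_indicator gl) simp
  from borel_measurable_AE[OF this a] have fm: "f \<in> borel_measurable (lebesgue_on Lam)"
    by (subst borel_measurable_restrict_space_iff) auto
  have "(LINT p|lebesgue_on Lam. (f p)\<^sup>2) = (LINT p|lebesgue_on Lam. (g p)\<^sup>2)"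
  proof (rule integral_cong_AE)
    show "AE p in lebesgue_on Lam. (f p)\<^sup>2 = (g p)\<^sup>2"
      using ae unfolding AE_lebesgue_on_Lam by eventually_elim simp
  qed (use fm borel_imp_lebesgue_on[OF g, of Lam] in \<open>auto intro!: borel_measurable_power\<close>)
  also have "\<dots> = (LINT p|LL. (g p)\<^sup>2)" by (rule integral_LL) (use g in simp)
  finally show ?thesis by (simp add: L2_norm_def nr_def)
qed

text \<open>Removes the choice operator from all norms: any Borel weak derivative computes the norm
  of the chosen one.\<close>

lemma weak_deriv_eq:
  assumes "has_weak_deriv \<gamma> u v" "v \<in> borel_measurable borel"
  shows "has_weak_deriv \<gamma> u (weak_deriv \<gamma> u)" "L2_norm (weak_deriv \<gamma> u) = nr v"
proof -
  show w: "has_weak_deriv \<gamma> u (weak_deriv \<gamma> u)"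
    unfolding weak_deriv_def using assms(1) by (rule someI[of "has_weak_deriv \<gamma> u"])
  show "L2_norm (weak_deriv \<gamma> u) = nr v"
    by (rule L2_norm_eq_nr[OF weak_deriv_unique[OF w assms(1)] assms(2)])
qed

lemma nr_cong: "AE p in LL. f p = g p \<Longrightarrow> f \<in> borel_measurable borel \<Longrightarrow> g \<in> borel_measurable borel \<Longrightarrow>
    nr f = nr g"
  using L2_norm_eq_nr[of f g] L2_norm_eq_nr[of f f] by simp

text \<open>The pointwise bound (f + g)^2 \<le> 2 f^2 + 2 g^2 replaces Minkowski's inequality,
  whence the factor 2.\<close>

lemma square_integrable_add:
  fixes f g :: "real \<times> real \<Rightarrow> real"
  assumes f: "f \<in> borel_measurable borel" "integrable LL (\<lambda>p. (f p)\<^sup>2)"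
    and g: "g \<in> borel_measurable borel" "integrable LL (\<lambda>p. (g p)\<^sup>2)"
  shows "integrable LL (\<lambda>p. (f p + g p)\<^sup>2)" "nr (\<lambda>p. f p + g p) \<le> 2 * (nr f + nr g)"
proof -
  have le: "(f p + g p)\<^sup>2 \<le> 2 * (f p)\<^sup>2 + 2 * (g p)\<^sup>2" for p
    using sum_squares_bound[of "f p" "g p"] by (simp add: power2_sum)
  have i: "integrable LL (\<lambda>p. 2 * (f p)\<^sup>2 + 2 * (g p)\<^sup>2)" using f g by simp
  show s: "integrable LL (\<lambda>p. (f p + g p)\<^sup>2)"
  proof (rule Bochner_Integration.integrable_bound[OF i])
    have "(\<lambda>p. (f p + g p)\<^sup>2) \<in> borel_measurable borel" using f g by simp
    then show "(\<lambda>p. (f p + g p)\<^sup>2) \<in> borel_measurable LL" by simp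
    show "AE p in LL. norm ((f p + g p)\<^sup>2) \<le> norm (2 * (f p)\<^sup>2 + 2 * (g p)\<^sup>2)"
      using le by (intro AE_I2) simp
  qed
  have "(LINT p|LL. (f p + g p)\<^sup>2) \<le> (LINT p|LL. 2 * (f p)\<^sup>2 + 2 * (g p)\<^sup>2)"
    by (rule integral_mono[OF s i le])
  also have "\<dots> = 2 * (nr f)\<^sup>2 + 2 * (nr g)\<^sup>2"
    using f g by (simp add: nr_def)
  also have "\<dots> \<le> (2 * (nr f + nr g))\<^sup>2"
    by (simp add: power2_eq_square algebra_simps)
  finally have "nr (\<lambda>p. f p + g p) \<le> sqrt ((2 * (nr f + nr g))\<^sup>2)"
    unfolding nr_def by (rule real_sqrt_le_mono)
  then show "nr (\<lambda>p. f p + g p) \<le> 2 * (nr f + nr g)" by simp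
qed

lemma nr_uminus: "nr (\<lambda>p. - f p) = nr f"
  by (simp add: nr_def)

lemma square_integrable_diff:
  fixes f g :: "real \<times> real \<Rightarrow> real"
  assumes f: "f \<in> borel_measurable borel" "integrable LL (\<lambda>p. (f p)\<^sup>2)"
    and g: "g \<in> borel_measurable borel" "integrable LL (\<lambda>p. (g p)\<^sup>2)"
  shows "integrable LL (\<lambda>p. (f p - g p)\<^sup>2)" "nr (\<lambda>p. f p - g p) \<le> 2 * (nr f + nr g)"
  using square_integrable_add[OF f, of "\<lambda>p. - g p"] g by (simp_all add: nr_uminus)

lemma nr_bounded:
  assumes f: "f \<in> borel_measurable borel" and M: "\<And>p. p \<in> Lam \<Longrightarrow> \<bar>f p\<bar> \<le> M" and M0: "0 \<le> M"
  shows "integrable LL (\<lambda>p. (f p)\<^sup>2)" "nr f \<le> 2 * M"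
proof -
  have le: "(f p)\<^sup>2 \<le> M\<^sup>2" if "p \<in> Lam" for p
    using power_mono[OF M[OF that], of 2] by simp
  show i: "integrable LL (\<lambda>p. (f p)\<^sup>2)"
    by (rule LL_bounded_integrable[where B="M\<^sup>2"]) (use f le in auto)
  have "(LINT p|LL. (f p)\<^sup>2) \<le> (LINT p|LL. M\<^sup>2)"
  proof (rule integral_mono_AE[OF i])
    show "AE p in LL. (f p)\<^sup>2 \<le> M\<^sup>2" using AE_LL_Lam by eventually_elim (rule le)
  qed simp
  also have "\<dots> = (2 * M)\<^sup>2" by (simp add: power2_eq_square)
  finally have "nr f \<le> sqrt ((2 * M)\<^sup>2)" unfolding nr_def by (rule real_sqrt_le_mono)
  also have "\<dots> = 2 * M" using M0 by (subst real_sqrt_abs) simp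
  finally show "nr f \<le> 2 * M" .
qed

lemma integral_abs_le_nr:
  fixes g :: "real \<times> real \<Rightarrow> real"
  assumes "integrable LL g" "integrable LL (\<lambda>p. (g p)\<^sup>2)"
  shows "(LINT p|LL. \<bar>g p\<bar>) \<le> 2 * nr g"
proof -
  have "(LINT p|LL. \<bar>g p\<bar>)\<^sup>2 \<le> 4 * (LINT p|LL. \<bar>g p\<bar>\<^sup>2)"
    by (rule LL_integral_square_le) (use assms in auto)
  also have "\<dots> = (2 * nr g)\<^sup>2" by (simp add: nr_def power_mult_distrib)
  finally show ?thesis by (rule power2_le_imp_le) simp
qed

lemma jet_diff:
  assumes v: "jet v" and w: "jet w" shows "jet (\<lambda>\<gamma> p. v \<gamma> p - w \<gamma> p)"
  unfolding jet_def
proof (intro conjI allI impI)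
  fix i j :: nat
  show "(\<lambda>p. v (i, j) p - w (i, j) p) \<in> borel_measurable borel" if "i + j \<le> 3"
    using jetD(1)[OF v that] jetD(1)[OF w that] by simp
  show "integrable LL (\<lambda>p. (v (i, j) p - w (i, j) p)\<^sup>2)" if "i + j \<le> 3"
    by (intro square_integrable_diff jetD[OF v that] jetD[OF w that])
  show "has_weak_deriv (Suc 0, 0) (\<lambda>p. v (i, j) p - w (i, j) p) (\<lambda>p. v (Suc i, j) p - w (Suc i, j)
      p)" if "i + j \<le> 2"
    by (intro weak_deriv_diff jet_weak[OF v that] jet_weak[OF w that])
  show "has_weak_deriv (0, Suc 0) (\<lambda>p. v (i, j) p - w (i, j) p) (\<lambda>p. v (i, Suc j) p - w (i, Suc j)
      p)" if "i + j \<le> 2"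
    by (intro weak_deriv_diff jet_weak[OF v that] jet_weak[OF w that])
qed

text \<open>The factor 6 is three x-nodes times the bound 2 for the Lagrange functions and their
  derivatives.\<close>

lemma interp_bound_x0:
  assumes Z: "\<And>i. i \<in> {-1, 0, 1} \<Longrightarrow> \<bar>spl n (U (i, -1)) (W (i, -1)) (U (i, 1)) (W (i, 1)) (snd p)\<bar> \<le> Z"
    and p: "p \<in> Lam"
  shows "\<bar>interp m n U W p\<bar> \<le> 6 * Z"
proof -
  have "\<bar>interp m n U W p\<bar> \<le> (\<Sum>i\<in>{-1, 0, 1::real}. 2 * Z)"
    unfolding interp_def
  proof (rule order_trans[OF sum_abs], rule sum_mono)
    fix i :: real assume i: "i \<in> {-1, 0, 1}"
    have "fst p \<in> {-1..1}" using p by (auto simp: Lam_def)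
    then show "\<bar>lag m i (fst p) * spl n (U (i, -1)) (W (i, -1)) (U (i, 1)) (W (i, 1)) (snd p)\<bar> \<le> 2 * Z"
      unfolding abs_mult by (intro mult_mono lag_bound Z i) auto
  qed
  then show ?thesis by simp
qed

text \<open>The derivatives of the Lagrange basis sum to zero, so only differences of nodal data in \<open>x\<close> enter.\<close>

lemma interp_x_difference:
  assumes "0 < m" shows "interp m n U W = interp m n (\<lambda>p. U p - U (0, snd p)) (\<lambda>p. W p - W (0, snd p))"
proof
  fix p
  have l: "lag m 0 x = - lag m (-1) x - lag m 1 x" for x
    using assms by (simp add: lag_def)
  have z: "spl n 0 0 0 0 y = 0" for y by (simp add: spl_def s1_def s2_def)
  show "interp m n U W p = interp m n (\<lambda>p. U p - U (0, snd p)) (\<lambda>p. W p - W (0, snd p)) p"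
    by (simp add: interp_def spl_diff l z) (simp add: algebra_simps)
qed

section \<open>Bounds for functions with vanishing weighted means\<close>

context averaging
begin

lemma T2_nr:
  assumes "kernel \<kappa>" "kernel \<kappa>'" "jet e" "i + j \<le> 3"
  shows "\<bar>T2 \<kappa> \<kappa>' (e (i, j)) p\<bar> \<le> 2 * B\<^sup>2 * nr (e (i, j))"
proof -
  have "\<bar>T2 \<kappa> \<kappa>' (e (i, j)) p\<bar> \<le> B\<^sup>2 * (LINT q|LL. \<bar>e (i, j) q\<bar>)"
    using assms by (intro T2_bound jetD) auto
  also have "\<dots> \<le> B\<^sup>2 * (2 * nr (e (i, j)))"
    using assms by (intro mult_left_mono integral_abs_le_nr jetD) auto
  finally show ?thesis by simp
qed

lemma T1_nr:
  assumes "kernel \<kappa>" "jet e" "i + j \<le> 3"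
  shows "integrable LL (\<lambda>p. (T1 \<kappa> (e (i, j)) p)\<^sup>2)" "nr (T1 \<kappa> (e (i, j))) \<le> 2 * B * nr (e (i, j))"
proof -
  note e = jetD[OF assms(2,3)]
  show "integrable LL (\<lambda>p. (T1 \<kappa> (e (i, j)) p)\<^sup>2)" by (rule T1_square(1)[OF assms(1) e(3,1,2)])
  have "nr (T1 \<kappa> (e (i, j))) \<le> sqrt (4 * B\<^sup>2 * (LINT p|LL. (e (i, j) p)\<^sup>2))"
    unfolding nr_def by (rule real_sqrt_le_mono[OF T1_square(2)[OF assms(1) e(3,1,2)]])
  also have "\<dots> = 2 * B * nr (e (i, j))"
    using B_ge by (simp add: real_sqrt_mult nr_def)
  finally show "nr (T1 \<kappa> (e (i, j))) \<le> 2 * B * nr (e (i, j))" .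
qed

text \<open>A vanishing mean removes the first term of \<open>poincare_AE\<close>. The y-term is
  bounded pointwise and the x-term in L2; since \<open>1 \<le> B\<close>, the constant
  \<open>8 * B\<^sup>2\<close> covers both.\<close>

lemma poincare:
  assumes e: "jet e" and ij: "i + j \<le> 2" and mean: "pairing (e (i, j)) \<rho> \<rho> = 0"
  shows "nr (e (i, j)) \<le> 8 * B\<^sup>2 * (nr (e (Suc i, j)) + nr (e (i, Suc j)))"
proof -
  have ij3: "i + j \<le> 3" "Suc i + j \<le> 3" "i + Suc j \<le> 3" using ij by auto
  note f = jetD[OF e ij3(1)] and fx = jetD[OF e ij3(2)] and fy = jetD[OF e ij3(3)]
  let ?g = "T2 r k (e (i, Suc j))" and ?h = "T1 k (e (Suc i, j))"
  have gb: "?g \<in> borel_measurable borel" by (rule T2_borel[OF kernel_r kernel_k fy(3)])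
  have hb: "?h \<in> borel_measurable borel" by (rule T1_borel[OF kernel_k fx(1)])
  have "AE p in LL. e (i, j) p = ?g p + ?h p"
    using poincare_AE[OF f(3,1) fx(3,1) fy(3) jet_weak(3,4)[OF e ij]]
    by eventually_elim (simp add: T2_rr_const mean)
  then have "nr (e (i, j)) = nr (\<lambda>p. ?g p + ?h p)"
    using f gb hb by (intro nr_cong) auto
  also have "\<dots> \<le> 2 * (nr ?g + nr ?h)"
    by (intro square_integrable_add gb hb T1_nr[OF kernel_k e ij3(2)]
        nr_bounded[OF gb T2_nr[where i=i and j="Suc j", OF kernel_r kernel_k e ij3(3)]]) simp
  also have "\<dots> \<le> 2 * (2 * (2 * B\<^sup>2 * nr (e (i, Suc j))) + 2 * B * nr (e (Suc i, j)))"
    by (intro mult_left_mono add_mono T1_nr[OF kernel_k e ij3(2)]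
        nr_bounded[OF gb T2_nr[where i=i and j="Suc j", OF kernel_r kernel_k e ij3(3)]]) simp_all
  also have "\<dots> \<le> 8 * B\<^sup>2 * (nr (e (Suc i, j)) + nr (e (i, Suc j)))"
  proof -
    have "4 * B \<le> 8 * B\<^sup>2" using B_ge by (simp add: power2_eq_square)
    from mult_right_mono[OF this nr_nonneg[of "e (Suc i, j)"]]
    show ?thesis by (simp add: algebra_simps)
  qed
  finally show ?thesis .
qed

text \<open>The summands are the third-order derivatives whose index is at least (m, n) in both
  components, that is, those obtained by differentiating D^(m,n).\<close>

definition third :: "(nat \<times> nat \<Rightarrow> real \<times> real \<Rightarrow> real) \<Rightarrow> nat \<Rightarrow> nat \<Rightarrow> real" where
  "third e m n = (\<Sum>i=m..3 - n. nr (e (i, 3 - i)))"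

lemma third_nonneg [simp]: "0 \<le> third e m n"
  by (simp add: third_def sum_nonneg)

text \<open>Each Poincare step raises one index by one, so the indices stay above (m, n). The two
  successors turn the factor \<open>8 * B\<^sup>2\<close> into
  \<open>16 * B\<^sup>2\<close>.\<close>

lemma poincare_chain:
  assumes e: "jet e" and mean: "\<And>i j. i + j \<le> 2 \<Longrightarrow> pairing (e (i, j)) \<rho> \<rho> = 0"
    and ij: "m \<le> i" "n \<le> j" "i + j + t = 3"
  shows "nr (e (i, j)) \<le> (16 * B\<^sup>2) ^ t * third e m n"
  using ij
proof (induction t arbitrary: i j)
  case 0
  then have "j = 3 - i" "i \<in> {m..3 - n}" by auto
  then show ?case
    unfolding third_def using member_le_sum[of i "{m..3 - n}" "\<lambda>i. nr (e (i, 3 - i))"] by simp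
next
  case (Suc t)
  have "nr (e (i, j)) \<le> 8 * B\<^sup>2 * (nr (e (Suc i, j)) + nr (e (i, Suc j)))"
    using Suc.prems by (intro poincare e mean) auto
  also have "\<dots> \<le> 8 * B\<^sup>2 * ((16 * B\<^sup>2) ^ t * third e m n + (16 * B\<^sup>2) ^ t * third e m n)"
    using Suc.prems by (intro mult_left_mono add_mono Suc.IH) auto
  finally show ?case by (simp add: algebra_simps)
qed

lemma chain_bound:
  assumes e: "jet e" and mean: "\<And>i j. i + j \<le> 2 \<Longrightarrow> pairing (e (i, j)) \<rho> \<rho> = 0"
    and ij: "m \<le> i" "n \<le> j" "i + j \<le> 3"
  shows "nr (e (i, j)) \<le> (16 * B\<^sup>2) ^ 3 * third e m n"
proof -
  have "nr (e (i, j)) \<le> (16 * B\<^sup>2) ^ (3 - (i + j)) * third e m n"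
    using ij by (intro poincare_chain e mean) auto
  also have "\<dots> \<le> (16 * B\<^sup>2) ^ 3 * third e m n"
  proof (intro mult_right_mono power_increasing)
    have "1 \<le> B\<^sup>2" using B_ge by simp
    then show "1 \<le> 16 * B\<^sup>2" by simp
  qed auto
  finally show ?thesis .
qed

text \<open>An averaged variable no longer appears in the result, so these terms cancel in
  differences taken in that variable.\<close>

lemma T2_rx: "T2 r \<kappa> g (x, y) = T2 r \<kappa> g (x', y)" and T2_ry: "T2 \<kappa> r g (x, y) = T2 \<kappa> r g (x, y')"
  by (simp_all add: T2_def)

text \<open>A difference in x keeps only the terms with an x-derivative, a difference in y those
  with a y-derivative, and the mixed difference only the last term. The thresholds \<open>a\<close>
  and \<open>b\<close> record which derivatives may be used: each guard says that all surviving
  terms have index at least (a, b).\<close>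

lemma crep_bounds:
  assumes e: "jet e" and ij: "i + j \<le> 1"
    and D: "\<And>i' j'. i \<le> i' \<Longrightarrow> i' \<le> Suc i \<Longrightarrow> j \<le> j' \<Longrightarrow> j' \<le> Suc j \<Longrightarrow> a \<le> i' \<Longrightarrow> b \<le> j' \<Longrightarrow>
        2 * B\<^sup>2 * nr (e (i', j')) \<le> D"
  shows "a \<le> i \<Longrightarrow> b \<le> j \<Longrightarrow> \<bar>crep e i j (x, y)\<bar> \<le> 4 * D"
    "a \<le> Suc i \<Longrightarrow> b \<le> j \<Longrightarrow> \<bar>crep e i j (x, y) - crep e i j (x', y)\<bar> \<le> 4 * D"
    "a \<le> i \<Longrightarrow> b \<le> Suc j \<Longrightarrow> \<bar>crep e i j (x, y) - crep e i j (x, y')\<bar> \<le> 4 * D"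
    "a \<le> Suc i \<Longrightarrow> b \<le> Suc j \<Longrightarrow> \<bar>crep e i j (x, y) - crep e i j (x', y) - (crep e i j (x, y')
        - crep e i j (x', y'))\<bar> \<le> 4 * D"
proof -
  have ij3: "i + j \<le> 3" "Suc i + j \<le> 3" "i + Suc j \<le> 3" "Suc i + Suc j \<le> 3" using ij by auto
  have T: "\<bar>T2 \<kappa> \<kappa>' (e (i', j')) p\<bar> \<le> D"
    if "kernel \<kappa>" "kernel \<kappa>'" "i' + j' \<le> 3" "i \<le> i'" "i' \<le> Suc i" "j \<le> j'" "j' \<le> Suc j" "a \<le> i'"
        "b \<le> j'" for \<kappa> \<kappa>' i' j' p
    using T2_nr[where i=i' and j=j', OF that(1,2) e that(3), of p] D[OF that(4-9)] by linarith
  let ?A = "T2 r r (e (i, j))" and ?X = "T2 k r (e (Suc i, j))" and ?Y = "T2 r k (e (i, Suc j))"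
      and ?Z = "T2 k k (e (Suc i, Suc j))"
  have c: "crep e i j p = (?A p + ?X p) + (?Y p + ?Z p)" for p
    by (simp add: crep_def rep_def)
  have A: "\<bar>?A p\<bar> \<le> D" if "a \<le> i" "b \<le> j" for p using that ij3 by (intro T kernel_r kernel_k) auto
  have X: "\<bar>?X p\<bar> \<le> D" if "a \<le> Suc i" "b \<le> j" for p using that ij3 by (intro T kernel_r kernel_k) auto
  have Y: "\<bar>?Y p\<bar> \<le> D" if "a \<le> i" "b \<le> Suc j" for p using that ij3 by (intro T kernel_r kernel_k) auto
  have Z: "\<bar>?Z p\<bar> \<le> D" if "a \<le> Suc i" "b \<le> Suc j" for p using that ij3 by (intro T kernel_r kernel_k) auto
  have ab4: "\<bar>(p + q) + (s + t)\<bar> \<le> 4 * D" if "\<bar>p\<bar> \<le> D" "\<bar>q\<bar> \<le> D" "\<bar>s\<bar> \<le> D" "\<bar>t\<bar> \<le> D" for p q s t :: real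
    using that by linarith
  have ab4': "\<bar>p - q + (s - t)\<bar> \<le> 4 * D" if "\<bar>p\<bar> \<le> D" "\<bar>q\<bar> \<le> D" "\<bar>s\<bar> \<le> D" "\<bar>t\<bar> \<le> D" for p q s t :: real
    using that by linarith
  show "\<bar>crep e i j (x, y)\<bar> \<le> 4 * D" if "a \<le> i" "b \<le> j"
    unfolding c using that by (intro ab4 A X Y Z) auto
  show "\<bar>crep e i j (x, y) - crep e i j (x', y)\<bar> \<le> 4 * D" if "a \<le> Suc i" "b \<le> j"
  proof -
    have "crep e i j (x, y) - crep e i j (x', y) = ?X (x, y) - ?X (x', y) + (?Z (x, y) - ?Z (x', y))"
      unfolding c using T2_rx[of r "e (i, j)" x y x'] T2_rx[of k "e (i, Suc j)" x y x'] by simp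
    then show ?thesis using that by (auto intro!: ab4' X Z)
  qed
  show "\<bar>crep e i j (x, y) - crep e i j (x, y')\<bar> \<le> 4 * D" if "a \<le> i" "b \<le> Suc j"
  proof -
    have "crep e i j (x, y) - crep e i j (x, y') = ?Y (x, y) - ?Y (x, y') + (?Z (x, y) - ?Z (x, y'))"
      unfolding c using T2_ry[of r "e (i, j)" x y y'] T2_ry[of k "e (Suc i, j)" x y y'] by simp
    then show ?thesis using that by (auto intro!: ab4' Y Z)
  qed
  show "\<bar>crep e i j (x, y) - crep e i j (x', y) - (crep e i j (x, y') - crep e i j (x', y'))\<bar>
      \<le> 4 * D" if "a \<le> Suc i" "b \<le> Suc j"
  proof -
    have "crep e i j (x, y) - crep e i j (x', y) - (crep e i j (x, y') - crep e i j (x', y'))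
        = ?Z (x, y) - ?Z (x', y) + (?Z (x', y') - ?Z (x, y'))"
      unfolding c
      using T2_rx[of r "e (i, j)" x y x'] T2_rx[of k "e (i, Suc j)" x y x']
        T2_rx[of r "e (i, j)" x y' x'] T2_rx[of k "e (i, Suc j)" x y' x']
        T2_ry[of k "e (Suc i, j)" x y y'] T2_ry[of k "e (Suc i, j)" x' y y'] by simp
    then show ?thesis using that by (auto intro!: ab4' Z)
  qed
qed

end

text \<open>Needed because the interpolant agrees with its explicit formula on the square
  only.\<close>

lemma weak_deriv_cong_left:
  assumes u: "has_weak_deriv \<gamma> u v" and eq: "\<And>p. p \<in> Lam \<Longrightarrow> u p = u' p"
  shows "has_weak_deriv \<gamma> u' v"
proof -
  have i: "integrable (lebesgue_on K) u \<longleftrightarrow> integrable (lebesgue_on K) u'" if "K \<subseteq> interior Lam" for K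
    using that interior_subset[of Lam] eq
    by (intro Bochner_Integration.integrable_cong) (auto simp: space_restrict_space)
  have e: "(LINT p|lebesgue_on Lam. u p * f p) = (LINT p|lebesgue_on Lam. u' p * f p)" for f
    using eq by (intro Bochner_Integration.integral_cong) (auto simp: space_restrict_space)
  have "locally_integrable u'"
    using u i by (simp add: has_weak_deriv_def locally_integrable_def)
  then show ?thesis
    using u unfolding has_weak_deriv_def e by blast
qed

lemma H_seminorm_nonneg: "0 \<le> H_seminorm l w"
  by (simp add: H_seminorm_def sum_nonneg)

lemma L2_norm_le_H_seminorm:
  assumes "mi_order \<alpha> = l" shows "L2_norm (weak_deriv \<alpha> w) \<le> H_seminorm l w"
proof -
  have "{\<alpha>. mi_order \<alpha> = l} \<subseteq> {..l} \<times> {..l}" by (auto simp: mi_order_def)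
  then have "finite {\<alpha>. mi_order \<alpha> = l}" by (rule finite_subset) simp
  then have "(L2_norm (weak_deriv \<alpha> w))\<^sup>2 \<le> (\<Sum>\<alpha> | mi_order \<alpha> = l. (L2_norm (weak_deriv \<alpha> w))\<^sup>2)"
    using assms by (intro member_le_sum) auto
  then show ?thesis
    unfolding H_seminorm_def by (rule real_le_rsqrt)
qed

section \<open>Normalisation by a quadratic and the final estimate\<close>

context averaging
begin

lemma pairing_const: "pairing (\<lambda>p. c) \<rho> \<rho> = c"
proof -
  have b: "\<bar>\<rho> x\<bar> \<le> B" for x using rho_nonneg rho_le by simp
  have "(LINT x|NI. \<rho> x) = P 1 - P (-1)"
    by (rule FTC_NI[of _ B "{}"]) (use b P_deriv P_continuous in \<open>auto intro: continuous_on_subset\<close>)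
  then have "(LINT p|LL. \<rho> (fst p) * \<rho> (snd p)) = 1"
    using LL_integral_product[OF rho_borel rho_borel b b] by (simp add: P_ends)
  then show ?thesis by (simp add: pairing_def tensor_def case_prod_beta)
qed

lemma pairing_diff:
  assumes f: "integrable LL f" and g: "integrable LL g"
  shows "pairing (\<lambda>p. f p - g p) \<rho> \<rho> = pairing f \<rho> \<rho> - pairing g \<rho> \<rho>"
  unfolding pairing_def left_diff_distrib
  by (intro Bochner_Integration.integral_diff integrable_tensor f g rho_test)

lemma pairing_const_add:
  assumes "integrable LL f" shows "pairing (\<lambda>p. c + f p) \<rho> \<rho> = c + pairing f \<rho> \<rho>"
  using pairing_add[of "\<lambda>p. c" f \<rho> \<rho>] assms rho_test by (simp add: pairing_const)

text \<open>The system is triangular. Second derivatives of the quadratic are constants, hence equal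
  to the required means; the first-order coefficients then correct the first-order means, and the
  constant term comes last.\<close>

lemma zero_means:
  assumes v: "jet v"
  obtains c00 c10 c01 c20 c11 c02 where
    "\<And>i j. i + j \<le> 2 \<Longrightarrow> pairing (\<lambda>p. v (i, j) p - quad c00 c10 c01 c20 c11 c02 (i, j) p) \<rho> \<rho> = 0"
proof -
  have qi: "integrable LL (quad a b c d f g \<gamma>)" for a b c d f g \<gamma>
    by (rule continuous_imp_LL[OF quad_continuous])
  let ?m = "\<lambda>f. pairing f \<rho> \<rho>"
  define c20 c11 c02 where c2: "c20 = ?m (v (2, 0))" "c11 = ?m (v (Suc 0, Suc 0))" "c02 = ?m (v (0, 2))"
  define c10 c01 where c1: "c10 = ?m (v (Suc 0, 0)) - ?m (quad 0 0 0 c20 c11 c02 (Suc 0, 0))"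
    "c01 = ?m (v (0, Suc 0)) - ?m (quad 0 0 0 c20 c11 c02 (0, Suc 0))"
  define c00 where c0: "c00 = ?m (v (0, 0)) - ?m (quad 0 c10 c01 c20 c11 c02 (0, 0))"
  let ?q = "quad c00 c10 c01 c20 c11 c02"
  have q2: "?m (?q (2, 0)) = c20" "?m (?q (Suc 0, Suc 0)) = c11" "?m (?q (0, 2)) = c02"
    by (simp_all add: quad_def[abs_def] pairing_const)
  have q1: "?m (?q (Suc 0, 0)) = c10 + ?m (quad 0 0 0 c20 c11 c02 (Suc 0, 0))"
    by (subst pairing_const_add[OF qi, symmetric]) (simp add: quad_def[abs_def] add.assoc)
  have q1': "?m (?q (0, Suc 0)) = c01 + ?m (quad 0 0 0 c20 c11 c02 (0, Suc 0))"
    by (subst pairing_const_add[OF qi, symmetric]) (simp add: quad_def[abs_def] add.assoc)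
  have q0: "?m (?q (0, 0)) = c00 + ?m (quad 0 c10 c01 c20 c11 c02 (0, 0))"
    by (subst pairing_const_add[OF qi, symmetric]) (simp add: quad_def[abs_def] add.assoc)
  have "pairing (\<lambda>p. v (i, j) p - ?q (i, j) p) \<rho> \<rho> = 0" if ij: "i + j \<le> 2" for i j
  proof -
    have "?m (?q (i, j)) = ?m (v (i, j))"
    proof -
      have "(i, j) \<in> {(0, 0), (Suc 0, 0), (0, Suc 0), (2, 0), (Suc 0, Suc 0), (0, 2)}"
        using ij by (cases i; cases j; auto simp: numeral_2_eq_2 le_Suc_eq)
      then show ?thesis using q2 q1 q1' q0 c2 c1 c0 by auto
    qed
    then show ?thesis
      using ij by (subst pairing_diff[OF jetD(3)[OF v] qi]) auto
  qed
  then show thesis by (rule that)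
qed

text \<open>The function and its interpolant are bounded separately: the former by the chain of
  Poincare steps, the latter pointwise through the data differences that enter its (m, n)-th
  derivative.\<close>

lemma interp_error:
  assumes e: "jet e" and mean: "\<And>i j. i + j \<le> 2 \<Longrightarrow> pairing (e (i, j)) \<rho> \<rho> = 0" and mn: "m + n \<le> 2"
  shows "nr (\<lambda>p. e (m, n) p - interp m n (crep e 0 0) (crep e 0 (Suc 0)) p)
    \<le> 2 * ((1 + 4000 * (2 * B\<^sup>2)) * (16 * B\<^sup>2) ^ 3) * third e (min m 1) n"
proof -
  \<comment> \<open>The representations of the nodal data start at x-index 0 and a difference raises
    it to 1, so the threshold cannot exceed one even for \<open>m = 2\<close>.\<close>
  define a where "a = min m 1"
  define R where "R = (16 * B\<^sup>2) ^ 3 * third e a n"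
  define D where "D = 2 * B\<^sup>2 * R"
  let ?U = "crep e 0 0" and ?W = "crep e 0 (Suc 0)"
  have R0: "0 \<le> R" by (simp add: R_def)
  then have D0: "0 \<le> D" by (simp add: D_def)
  have N: "nr (e (i, j)) \<le> R" if "a \<le> i" "n \<le> j" "i + j \<le> 3" for i j
    unfolding R_def by (rule chain_bound[OF e mean that])
  have ND: "2 * B\<^sup>2 * nr (e (i, j)) \<le> D" if "a \<le> i" "n \<le> j" "i + j \<le> 3" for i j
    unfolding D_def using N[OF that] by (intro mult_left_mono) auto
  have U: "n = 0 \<Longrightarrow> a = 0 \<Longrightarrow> \<bar>?U (x, y)\<bar> \<le> 4 * D"
    "n = 0 \<Longrightarrow> \<bar>?U (x, y) - ?U (x', y)\<bar> \<le> 4 * D"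
    "n \<le> 1 \<Longrightarrow> a = 0 \<Longrightarrow> \<bar>?U (x, y) - ?U (x, y')\<bar> \<le> 4 * D"
    "n \<le> 1 \<Longrightarrow> \<bar>?U (x, y) - ?U (x', y) - (?U (x, y') - ?U (x', y'))\<bar> \<le> 4 * D" for x x' y y'
    by (intro crep_bounds[OF e, where a=a and b=n] ND; simp add: a_def)+
  have W: "n \<le> 1 \<Longrightarrow> a = 0 \<Longrightarrow> \<bar>?W (x, y)\<bar> \<le> 4 * D"
    "n \<le> 1 \<Longrightarrow> \<bar>?W (x, y) - ?W (x', y)\<bar> \<le> 4 * D"
    "a = 0 \<Longrightarrow> \<bar>?W (x, y) - ?W (x, y')\<bar> \<le> 4 * D" for x x' y y'
    using mn by (intro crep_bounds[OF e, where a=a and b=n] ND; simp add: a_def)+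
  \<comment> \<open>The data add up to at most \<open>16 * D\<close>; the spline bound contributes
    20 and the Lagrange sum 6, giving 1920, rounded to 2000.\<close>
  have bd: "\<bar>interp m n ?U ?W p\<bar> \<le> 2000 * D" if p: "p \<in> Lam" for p
  proof -
    have y: "snd p \<in> {-1..1}" using p by (auto simp: Lam_def)
    consider (a) "m = 0" "n = 0" | (b) "m = 0" "n = 1" | (c) "m = 0" "n = 2" | (d) "0 < m"
        "n = 0" | (f) "0 < m" "n = 1"
      using mn by linarith
    then have "\<bar>interp m n ?U ?W p\<bar> \<le> 6 * (320 * D)"
    proof cases
      case a
      show ?thesis
      proof (rule interp_bound_x0[OF _ p])
        fix i :: real
        have "\<bar>?U (i, -1)\<bar> + \<bar>?W (i, -1)\<bar> + \<bar>?U (i, 1)\<bar> + \<bar>?W (i, 1)\<bar> \<le> 16 * D"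
          using U(1)[of i "-1"] U(1)[of i 1] W(1)[of i "-1"] W(1)[of i 1] a by (simp add: a_def)
        then show "\<bar>spl n (?U (i, -1)) (?W (i, -1)) (?U (i, 1)) (?W (i, 1)) (snd p)\<bar> \<le> 320 * D"
          using spl_bound(1)[OF y, of "?U (i, -1)" "?W (i, -1)" "?U (i, 1)" "?W (i, 1)"] a by simp
      qed
    next
      case b
      show ?thesis
      proof (rule interp_bound_x0[OF _ p])
        fix i :: real
        have "\<bar>?W (i, -1)\<bar> + \<bar>?W (i, 1)\<bar> + \<bar>?U (i, 1) - ?U (i, -1)\<bar> \<le> 16 * D"
          using U(3)[of i 1 "-1"] W(1)[of i "-1"] W(1)[of i 1] b D0 by (simp add: a_def)
        then show "\<bar>spl n (?U (i, -1)) (?W (i, -1)) (?U (i, 1)) (?W (i, 1)) (snd p)\<bar> \<le> 320 * D"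
          using spl_bound(2)[OF y, of "?U (i, -1)" "?W (i, -1)" "?U (i, 1)" "?W (i, 1)"] b by simp
      qed
    next
      case c
      show ?thesis
      proof (rule interp_bound_x0[OF _ p])
        fix i :: real assume i: "i \<in> {-1, 0, 1}"
        \<comment> \<open>The mean value theorem turns the difference of values into a slope, so the
          trapezoidal error becomes a sum of slope differences in y, all controlled by second
          y-derivatives and above.\<close>
        have "\<exists>t\<in>{-1<..<1}. ?U (i, 1) - ?U (i, -1) = (\<lambda>h. ?W (i, t) * h) (1 - (-1))"
          by (rule mvt_simple) (use i crep_deriv(2)[OF e, of i, unfolded has_field_derivative_def]
              in \<open>auto\<close>)
        then obtain t where t: "?U (i, 1) - ?U (i, -1) = ?W (i, t) * 2" by auto
        have "\<bar>?W (i, t) - ?W (i, -1)\<bar> \<le> 4 * D" "\<bar>?W (i, t) - ?W (i, 1)\<bar> \<le> 4 * D"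
            "\<bar>?W (i, 1) - ?W (i, -1)\<bar> \<le> 4 * D"
          using W(3) c by (auto simp: a_def)
        then have "\<bar>?W (i, 1) - ?W (i, -1)\<bar> + \<bar>(?U (i, 1) - ?U (i, -1)) - (?W (i, -1) + ?W (i, 1))\<bar>
            \<le> 16 * D"
          unfolding t by linarith
        then show "\<bar>spl n (?U (i, -1)) (?W (i, -1)) (?U (i, 1)) (?W (i, 1)) (snd p)\<bar> \<le> 320 * D"
          using spl_bound(3)[OF y, of n "?U (i, -1)" "?W (i, -1)" "?U (i, 1)" "?W (i, 1)"] c by simp
      qed
    next
      case d
      show ?thesis
      proof (subst interp_x_difference[OF d(1)], rule interp_bound_x0[OF _ p])
        fix i :: real
        let ?u = "\<lambda>y. ?U (i, y) - ?U (0, y)" and ?w = "\<lambda>y. ?W (i, y) - ?W (0, y)"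
        have "\<bar>?u (-1)\<bar> + \<bar>?w (-1)\<bar> + \<bar>?u 1\<bar> + \<bar>?w 1\<bar> \<le> 16 * D"
          using U(2)[of i "-1" 0] U(2)[of i 1 0] W(2)[of i "-1" 0] W(2)[of i 1 0] d by simp
        then show "\<bar>spl n (?U (i, -1) - ?U (0, snd (i, -1))) (?W (i, -1) - ?W (0, snd (i, -1)))
            (?U (i, 1) - ?U (0, snd (i, 1))) (?W (i, 1) - ?W (0, snd (i, 1))) (snd p)\<bar> \<le> 320 * D"
          using spl_bound(1)[OF y, of "?u (-1)" "?w (-1)" "?u 1" "?w 1"] d by simp
      qed
    next
      case f
      show ?thesis
      proof (subst interp_x_difference[OF f(1)], rule interp_bound_x0[OF _ p])
        fix i :: real
        let ?u = "\<lambda>y. ?U (i, y) - ?U (0, y)" and ?w = "\<lambda>y. ?W (i, y) - ?W (0, y)"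
        \<comment> \<open>The mixed second difference of the nodal values retains only the term with
          the xy-derivative.\<close>
        have "\<bar>?w (-1)\<bar> + \<bar>?w 1\<bar> + \<bar>?u 1 - ?u (-1)\<bar> \<le> 16 * D"
          using U(4)[of i 1 0 "-1"] W(2)[of i "-1" 0] W(2)[of i 1 0] f D0 by simp
        then show "\<bar>spl n (?U (i, -1) - ?U (0, snd (i, -1))) (?W (i, -1) - ?W (0, snd (i, -1)))
            (?U (i, 1) - ?U (0, snd (i, 1))) (?W (i, 1) - ?W (0, snd (i, 1))) (snd p)\<bar> \<le> 320 * D"
          using spl_bound(2)[OF y, of "?u (-1)" "?w (-1)" "?u 1" "?w 1"] f by simp
      qed
    qed
    then show ?thesis using D0 by simp
  qed
  have em: "nr (e (m, n)) \<le> R" using mn by (intro N) (auto simp: a_def)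
  have "nr (\<lambda>p. e (m, n) p - interp m n ?U ?W p) \<le> 2 * (nr (e (m, n)) + nr (interp m n ?U ?W))"
    using mn D0 by (intro square_integrable_diff jetD[OF e] interp_borel nr_bounded(1)[OF
        interp_borel bd]) auto
  also have "\<dots> \<le> 2 * (R + 2 * (2000 * D))"
    using D0 by (intro mult_left_mono add_mono em nr_bounded(2)[OF interp_borel bd]) auto
  also have "\<dots> = 2 * ((1 + 4000 * (2 * B\<^sup>2)) * (16 * B\<^sup>2) ^ 3) * third e a n"
    by (simp add: D_def R_def algebra_simps)
  finally show ?thesis by (simp add: a_def)
qed

text \<open>Subtracting a quadratic leaves third derivatives unchanged. Each summand is a derivative
  of \<open>weak_deriv (m, n) u\<close> of the order measured by the seminorm, and there are at most
  four of them.\<close>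

lemma third_le_H_seminorm:
  assumes v: "jet v" "\<And>i j. i + j \<le> 3 \<Longrightarrow> has_weak_deriv (i, j) u (v (i, j))" and mn: "m + n \<le> 2"
  shows "third (\<lambda>\<gamma> p. v \<gamma> p - quad c00 c10 c01 c20 c11 c02 \<gamma> p) m n \<le> 4 * H_seminorm (3 - (m
      + n)) (weak_deriv (m, n) u)"
proof -
  let ?H = "H_seminorm (3 - (m + n)) (weak_deriv (m, n) u)"
  have "nr (\<lambda>p. v (i, 3 - i) p - quad c00 c10 c01 c20 c11 c02 (i, 3 - i) p) \<le> ?H"
      if i: "i \<in> {m..3 - n}" for i
  proof -
    have ij: "i + (3 - i) = 3" "m + (i - m) = i" "n + (3 - i - n) = 3 - i" using i mn by auto
    have "has_weak_deriv (m, n) u (weak_deriv (m, n) u)"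
      using mn by (intro weak_deriv_eq(1)[OF v(2) jetD(1)[OF v(1)]]) auto
    moreover have "has_weak_deriv (m + (i - m), n + (3 - i - n)) u (v (i, 3 - i))"
      using v(2)[of i "3 - i"] ij by simp
    ultimately have "has_weak_deriv (i - m, 3 - i - n) (weak_deriv (m, n) u) (v (i, 3 - i))"
      by (rule weak_deriv_comp2)
    then have "nr (v (i, 3 - i)) = L2_norm (weak_deriv (i - m, 3 - i - n) (weak_deriv (m, n) u))"
      using ij by (subst weak_deriv_eq(2)) (auto intro: jetD(1)[OF v(1)])
    also have "\<dots> \<le> ?H"
      by (rule L2_norm_le_H_seminorm) (use i mn in \<open>auto simp: mi_order_def\<close>)
    finally show ?thesis using ij by (simp add: quad_third)
  qed
  then have "third (\<lambda>\<gamma> p. v \<gamma> p - quad c00 c10 c01 c20 c11 c02 \<gamma> p) m n \<le> (\<Sum>i=m..3 - n. ?H)"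
    unfolding third_def by (rule sum_mono)
  also have "\<dots> \<le> 4 * ?H"
    using H_seminorm_nonneg by (auto intro!: mult_right_mono)
  finally show ?thesis .
qed

text \<open>\<open>min m 1\<close> treats both inequalities at once: it changes the index only for
  (2, 0), where the right-hand side becomes a seminorm of the x-derivative.\<close>

lemma interpolation_error:
  assumes u: "u \<in> H_Lam 3" and mn: "m + n \<le> 2"
  shows "L2_norm (weak_deriv (m, n) (\<lambda>p. u p - Pi_y (C1_rep u) p))
    \<le> 8 * ((1 + 4000 * (2 * B\<^sup>2)) * (16 * B\<^sup>2) ^ 3) * H_seminorm (3 - (min m 1
        + n)) (weak_deriv (min m 1, n) u)"
proof -
  obtain v where v: "jet v" "AE p in LL. u p = v (0, 0) p" "\<And>i j. i + j \<le> 3 \<Longrightarrow>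
      has_weak_deriv (i, j) u (v (i, j))"
    using H_Lam_jet[OF u] by metis
  obtain c00 c10 c01 c20 c11 c02 where
    c: "\<And>i j. i + j \<le> 2 \<Longrightarrow> pairing (\<lambda>p. v (i, j) p - quad c00 c10 c01 c20 c11 c02 (i, j) p) \<rho> \<rho> = 0"
    by (rule zero_means[OF v(1)], rule that, assumption)
  let ?q = "quad c00 c10 c01 c20 c11 c02"
  define e where "e \<gamma> p = v \<gamma> p - ?q \<gamma> p" for \<gamma> p
  have e: "jet e" unfolding e_def[abs_def] by (rule jet_diff[OF v(1) jet_quad])
  have mean: "pairing (e (i, j)) \<rho> \<rho> = 0" if "i + j \<le> 2" for i j
    using c[OF that] by (simp add: e_def[abs_def])
  \<comment> \<open>Not derived from linearity of the operators: both sides are continuous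
    representatives of the same class.\<close>
  have cr: "crep e i j p = crep v i j p - ?q (i, j) p" if "i + j \<le> 1" "p \<in> Lam" for i j p
  proof (rule continuous_AE_eq[OF _ _ _ that(2)])
    show "continuous_on Lam (crep e i j)" "continuous_on Lam (\<lambda>p. crep v i j p - ?q (i, j) p)"
      by (intro continuous_on_diff quad_continuous continuous_on_subset[OF crep(1)[OF e that(1)]]
          continuous_on_subset[OF crep(1)[OF v(1) that(1)]] subset_UNIV)+
    show "AE p in LL. crep e i j p = crep v i j p - ?q (i, j) p"
      using crep(2)[OF e that(1)] crep(2)[OF v(1) that(1)] by eventually_elim (simp add: e_def)
  qed
  have "interp m n (crep e 0 0) (crep e 0 (Suc 0)) p =
      interp m n (\<lambda>p. crep v 0 0 p - ?q (0, 0) p) (\<lambda>p. crep v 0 (Suc 0) p - ?q (0, Suc 0) p) p" for p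
    by (subst interp_cong) (auto simp: cr)
  \<comment> \<open>Quadratics are reproduced, so \<open>e\<close> and \<open>v\<close> have the
    same interpolation error.\<close>
  then have ie: "interp m n (crep e 0 0) (crep e 0 (Suc 0)) p = interp m n (crep v 0 0)
      (crep v 0 (Suc 0)) p - ?q (m, n) p" for p
    by (simp only: interp_diff interp_quad[OF mn])
  have "has_weak_deriv (m, n) (interp 0 0 (crep v 0 0) (crep v 0 (Suc 0))) (interp m n (crep v 0 0)
      (crep v 0 (Suc 0)))"
    using mn by (intro interp_weak_deriv) auto
  then have "has_weak_deriv (m, n) (Pi_y (C1_rep u)) (interp m n (crep v 0 0) (crep v 0 (Suc 0)))"
  proof (rule weak_deriv_cong_left)
    fix p assume p: "p \<in> Lam"
    have "interp 0 0 (crep v 0 0) (crep v 0 (Suc 0)) = interp 0 0 (C1_rep u) (partial_y (C1_rep u))"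
      by (rule interp_cong) (simp_all add: C1_rep_eq[OF v(1,2)])
    then show "interp 0 0 (crep v 0 0) (crep v 0 (Suc 0)) p = Pi_y (C1_rep u) p"
      by (simp add: Pi_y_eq[OF p])
  qed
  then have "has_weak_deriv (m, n) (\<lambda>p. u p - Pi_y (C1_rep u) p) (\<lambda>p. v (m, n) p - interp m n (crep
      v 0 0) (crep v 0 (Suc 0)) p)"
    using mn by (intro weak_deriv_diff v(3)) auto
  then have "L2_norm (weak_deriv (m, n) (\<lambda>p. u p - Pi_y (C1_rep u) p))
      = nr (\<lambda>p. v (m, n) p - interp m n (crep v 0 0) (crep v 0 (Suc 0)) p)"
    using mn by (intro weak_deriv_eq(2) borel_measurable_diff jetD(1)[OF v(1)] interp_borel) auto
  also have "\<dots> = nr (\<lambda>p. e (m, n) p - interp m n (crep e 0 0) (crep e 0 (Suc 0)) p)"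
    by (simp add: ie e_def)
  also have "\<dots> \<le> 2 * ((1 + 4000 * (2 * B\<^sup>2)) * (16 * B\<^sup>2) ^ 3) * third e (min m 1) n"
    by (rule interp_error[OF e mean mn])
  also have "\<dots> \<le> 2 * ((1 + 4000 * (2 * B\<^sup>2)) * (16 * B\<^sup>2) ^ 3) * (4 * H_seminorm (3 - (min m 1
      + n)) (weak_deriv (min m 1, n) u))"
  proof (rule mult_left_mono)
    show "third e (min m 1) n \<le> 4 * H_seminorm (3 - (min m 1 + n)) (weak_deriv (min m 1, n) u)"
      unfolding e_def[abs_def] using mn by (intro third_le_H_seminorm[OF v(1,3)]) auto
  qed simp
  finally show ?thesis by simp
qed

end

theorem theorem19:
  "\<exists>C::real. \<forall>u\<in>H_Lam 3.
     (\<forall>\<gamma>. mi_order \<gamma> \<le> 2 \<and> \<gamma> \<noteq> (2, 0) \<longrightarrow>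
        L2_norm (weak_deriv \<gamma> (\<lambda>p. u p - Pi_y (C1_rep u) p))
          \<le> C * H_seminorm (3 - mi_order \<gamma>) (weak_deriv \<gamma> u)) \<and>
     L2_norm (weak_deriv (2, 0) (\<lambda>p. u p - Pi_y (C1_rep u) p))
       \<le> C * (H_seminorm 1 (weak_deriv (2, 0) u) + H_seminorm 2 (weak_deriv (1, 0) u))"
proof -
  obtain \<rho> P B where "averaging \<rho> P B" using averaging_exists by blast
  then interpret averaging \<rho> P B .
  let ?C = "8 * ((1 + 4000 * (2 * B\<^sup>2)) * (16 * B\<^sup>2) ^ 3)"
  have C: "0 \<le> ?C" by simp
  show ?thesis
  proof (intro exI[of _ ?C] ballI conjI allI impI)
    fix u assume u: "u \<in> H_Lam 3"
    {
      fix \<gamma> :: "nat \<times> nat" assume \<gamma>: "mi_order \<gamma> \<le> 2 \<and> \<gamma> \<noteq> (2, 0)"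
      obtain m n where mn: "\<gamma> = (m, n)" by fastforce
      have "m + n \<le> 2" "min m 1 = m" using \<gamma> mn by (auto simp: mi_order_def)
      then show "L2_norm (weak_deriv \<gamma> (\<lambda>p. u p - Pi_y (C1_rep u) p))
          \<le> ?C * H_seminorm (3 - mi_order \<gamma>) (weak_deriv \<gamma> u)"
        using interpolation_error[OF u, of m n] by (simp add: mn mi_order_def)
    }
    \<comment> \<open>With \<open>min 2 1 = 1\<close> the second x-derivative of the error is
      estimated through u_x.\<close>
    have "L2_norm (weak_deriv (2, 0) (\<lambda>p. u p - Pi_y (C1_rep u) p)) \<le> ?C * H_seminorm 2 (weak_deriv (1, 0) u)"
      using interpolation_error[OF u, of 2 0] by simp
    also have "\<dots> \<le> ?C * (H_seminorm 1 (weak_deriv (2, 0) u) + H_seminorm 2 (weak_deriv (1, 0) u))"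
      by (rule mult_left_mono[OF _ C]) (simp add: H_seminorm_nonneg)
    finally show "L2_norm (weak_deriv (2, 0) (\<lambda>p. u p - Pi_y (C1_rep u) p))
        \<le> ?C * (H_seminorm 1 (weak_deriv (2, 0) u) + H_seminorm 2 (weak_deriv (1, 0) u))" .
  qed
qed

end
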